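(* Assume that there exist $k,m\ge1$ with $p_k>0$, $p_m>0$ such that $\gamma_{k,m}=\infty$. Then for $\mathbb{P}$-almost every environment $\omega$, $\lim_{n\to\infty}|X_n|/n=0$ ${\mathtt P}_\omega$-almost surely.
   Context: Let $(p_j)_{j\ge 0}$ be an offspring distribution with $p_0=0$ and $\mu:=\sum_{j\ge1} j p_j\in(1,\infty)$. For a vertex $x$ of a tree, its index is $\hat\iota(x)=\deg(x)-1$, and $|x|$ is its graph distance to the root. For every unordered pair $\{k,m\}$ of positive integers let $\tilde\mu_{k,m}=\tilde\mu_{m,k}$ be a probability law on $(0,\infty)$ with mean $\gamma_{k,m}\in(0,\infty]$. The augmented weighted Galton--Watson tree (law $\mathbb{P}$) is constructed as follows: choose $k\ge1$ with probability $p_k$; the root $\mathbf{o}$ has $k+1$ neighbours $w_0,\dots,w_k$; each $w_j$ is the root of an independent Galton--Watson tree with offspring law $(p_j)$ (so every non-root vertex has index equal to its number of children). Conditionally on the tree, the conductances $\xi(e)>0$ are independent, an edge joining vertices of indices $k$ and $m$ having law $\tilde\mu_{k,m}$. The random walk in environment $\omega=(\mathbf{T},\mathbf{o},\xi)$ has law ${\mathtt P}_\omega$, starts at $X_0=\mathbf{o}$ and jumps from $x$ to neighbour $y$ with probability $\xi(x,y)/\sum_{z\sim x}\xi(x,z)$. *)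

theory Defs
  imports "HOL-Probability.Probability"
begin

text \<open>Vertices of the (augmented) tree are encoded Ulam--Harris style as lists of
naturals: the root is the empty list, the i-th child of v is i # v, the parent of a
non-root vertex v is tl v, and the graph distance to the root is length v.

An environment omega assigns to every potential vertex v a pair
(N v, xi v): N v is the number of offspring drawn from (p_j) and xi v is a family
of conductance candidates, xi v (k,m) distributed according to mu_{k,m}.
The root has N [] + 1 children, any other vertex v has N v children.
The conductance of the edge joining a non-root vertex v to its parent is
xi v (index(parent v), index v).  Conditionally on the tree these conductances are
independent with the required laws, so this gives the law P of the
augmented weighted Galton--Watson tree.\<close>

type_synonym env = "nat list \<Rightarrow> nat \<times> (nat \<times> nat \<Rightarrow> real)"

definition nch :: "env \<Rightarrow> nat list \<Rightarrow> nat" where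
  "nch \<omega> v = (if v = [] then fst (\<omega> v) + 1 else fst (\<omega> v))"

fun in_tree :: "env \<Rightarrow> nat list \<Rightarrow> bool" where
  "in_tree \<omega> [] = True"
| "in_tree \<omega> (i # v) = (in_tree \<omega> v \<and> i < nch \<omega> v)"

definition nbrs :: "env \<Rightarrow> nat list \<Rightarrow> nat list set" where
  "nbrs \<omega> x = {i # x | i. i < nch \<omega> x} \<union> (if x = [] then {} else {tl x})"

definition idx :: "env \<Rightarrow> nat list \<Rightarrow> nat" where
  "idx \<omega> x = card (nbrs \<omega> x) - 1"

definition conductance :: "env \<Rightarrow> nat list \<Rightarrow> nat list \<Rightarrow> real" where
  "conductance \<omega> x y =
     (if y \<in> nbrs \<omega> x then
        (if y \<noteq> [] \<and> tl y = x then snd (\<omega> y) (idx \<omega> x, idx \<omega> y)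
         else snd (\<omega> x) (idx \<omega> y, idx \<omega> x))
      else 0)"

definition trans_prob :: "env \<Rightarrow> nat list \<Rightarrow> nat list \<Rightarrow> real" where
  "trans_prob \<omega> x y = conductance \<omega> x y / (\<Sum>z\<in>nbrs \<omega> x. conductance \<omega> x z)"

definition cond_law :: "(nat \<Rightarrow> nat \<Rightarrow> real measure) \<Rightarrow> nat \<times> nat \<Rightarrow> real measure" where
  "cond_law \<mu>t km = (if 1 \<le> fst km \<and> 1 \<le> snd km then \<mu>t (fst km) (snd km) else return borel 1)"

definition env_measure :: "nat pmf \<Rightarrow> (nat \<Rightarrow> nat \<Rightarrow> real measure) \<Rightarrow> env measure" where
  "env_measure p \<mu>t =
     (\<Pi>\<^sub>M v\<in>(UNIV :: nat list set). measure_pmf p \<Otimes>\<^sub>M (\<Pi>\<^sub>M km\<in>UNIV. cond_law \<mu>t km))"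

definition walk_law :: "env \<Rightarrow> (nat \<Rightarrow> nat list) measure \<Rightarrow> bool" where
  "walk_law \<omega> Q \<longleftrightarrow> prob_space Q \<and>
     sets Q = sets (\<Pi>\<^sub>M i\<in>(UNIV :: nat set). count_space (UNIV :: nat list set)) \<and>
     (\<forall>n xs. measure Q {X \<in> space Q. \<forall>i\<le>n. X i = xs i}
              = (if xs 0 = [] then 1 else 0) * (\<Prod>i<n. trans_prob \<omega> (xs i) (xs (Suc i))))"

end

theory Submission
  imports Defs
begin

text \<open>A walk that has visited \<open>V\<close> distinct vertices is at distance less than \<open>V\<close> from the root, so it
suffices that the range up to time \<open>t\<close> is \<open>o(t)\<close>. Reveal the marks of the children of a vertex when the
walk first visits it; revealed marks are then i.i.d. in the annealed law, whatever the walk does.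

Call a visited vertex good if its index and the conductance to its parent are bounded. As the
offspring law has finite mean, a second-moment law of large numbers with truncation along the revealed
marks shows that at most \<open>\<kappa>t\<close> visited vertices are not good, \<open>\<kappa>\<close> being as small as we please.
From a fresh good vertex, the walk next enters with probability bounded below a fresh vertex \<open>v\<close> of
index \<open>k\<close>, and then a fresh child \<open>w\<close> of \<open>v\<close> of index \<open>m\<close>, all conductances at \<open>v\<close> and \<open>w\<close> being bounded
except that of the edge \<open>vw\<close>, whose conditional law still has infinite mean. The time spent on this edge
is at least geometric with mean of the order of its conductance. An exponential supermartingale turns
this into: the number of good visited vertices is at most \<open>\<epsilon>t\<close> for every \<open>\<epsilon> > 0\<close>, eventually.

Annealed expectations are sums over finite histories of integrals over the environment, which together
with Borel--Cantelli yields statements about every law of the walk in almost every environment.\<close>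

section \<open>Splitting product measures\<close>

text \<open>The obstacle is that the environment near the walk is biased by its past, so excursions
  into traps are not independent copies. A potential avoids any renewal structure. Let every step
  cost a discount \<open>M / (M + 1)\<close> and every good vertex earn a reward
  \<open>1 + \<theta>\<close>. Being held on an edge of conductance x lowers the expected discount
  by about min x M / M, up to a factor depending on \<open>L\<close>. A trap met with probability
  bounded below thus yields an amount of order J / M on average, J being the mean conductance
  truncated at \<open>M\<close>, and this pays for a \<open>\<theta>\<close> of the same order. If
  the product of rewards and discounts has bounded expectation, at most of order t / (M * \<theta>),
  that is t / J, good vertices are visited in t steps. An infinite mean makes J as large as desired,
  while the other constants depend on \<open>T\<close> and \<open>L\<close> only. The trap edge
  spans two revelations: its conductance is seen at the first visit to v, the conductances below w
  only at the first visit to w. Hence the potential distinguishes three stages: v is fresh, w is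
  fresh, and the trap is completely known.\<close>

lemma distr_PiM_split:
  fixes M :: "'c measure" and r :: "'i \<Rightarrow> 'a + 'b"
  assumes "prob_space M" and inj: "inj r"
  shows "distr (PiM (UNIV::'a set) (\<lambda>_. M) \<Otimes>\<^sub>M PiM (UNIV::'b set) (\<lambda>_. M)) (PiM (UNIV::'i set) (\<lambda>_. M))
           (\<lambda>(\<omega>, \<eta>) v. case r v of Inl a \<Rightarrow> \<omega> a | Inr b \<Rightarrow> \<eta> b) = PiM UNIV (\<lambda>_. M)"
    (is "distr (?A \<Otimes>\<^sub>M ?B) ?I ?f = _")
proof -
  interpret M: prob_space M by fact
  interpret A: product_prob_space "\<lambda>_. M" "UNIV :: 'a set" by unfold_locales
  interpret B: product_prob_space "\<lambda>_. M" "UNIV :: 'b set" by unfold_locales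
  interpret I: product_prob_space "\<lambda>_. M" "UNIV :: 'i set" by unfold_locales
  have f[measurable]: "?f \<in> measurable (?A \<Otimes>\<^sub>M ?B) ?I"
  proof (rule measurable_PiM_single')
    fix i :: 'i
    show "(\<lambda>x. ?f x i) \<in> measurable (?A \<Otimes>\<^sub>M ?B) M"
      by (cases "r i") (auto simp: case_prod_beta)
    show "(\<lambda>x i. ?f x i) \<in> space (?A \<Otimes>\<^sub>M ?B) \<rightarrow> UNIV \<rightarrow>\<^sub>E space M"
      by (auto simp: space_pair_measure space_PiM PiE_def Pi_def split: sum.split)
  qed
  show ?thesis
  proof (rule I.PiM_eq)
    fix J :: "'i set" and F
    assume J: "finite J" and F: "\<And>j. j \<in> J \<Longrightarrow> F j \<in> sets M"
    \<comment> \<open>A cylinder over \<open>J\<close> splits into one cylinder for each factor.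
      Injectivity of \<open>r\<close> keeps the coordinates read by distinct indices distinct;
      coordinates outside the range of \<open>r\<close> are unconstrained and contribute mass
      one.\<close>
    define JA where "JA = {j\<in>J. \<exists>a. r j = Inl a}"
    define JB where "JB = {j\<in>J. \<exists>b. r j = Inr b}"
    have "r j = Inl (projl (r j)) \<or> r j = Inr (projr (r j))" for j
      by (cases "r j") auto
    then have JJ1: "J = JA \<union> JB"
      unfolding JA_def JB_def by blast
    have JJ2: "JA \<inter> JB = {}"
      unfolding JA_def JB_def by auto
    have JJ3: "finite JA" "finite JB"
      unfolding JA_def JB_def using J by simp_all
    note JJ = JJ1 JJ2 JJ3
    define LA where "LA j = projl (r j)" for j
    define LB where "LB j = projr (r j)" for j
    have LA: "r j = Inl (LA j)" if "j \<in> JA" for j using that by (auto simp: JA_def LA_def)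
    have LB: "r j = Inr (LB j)" if "j \<in> JB" for j using that by (auto simp: JB_def LB_def)
    have injA: "inj_on LA JA" using LA inj by (metis inj_onI injD)
    have injB: "inj_on LB JB" using LB inj by (metis inj_onI injD)
    define FA where "FA a = F (the_inv_into JA LA a)" for a
    define FB where "FB a = F (the_inv_into JB LB a)" for a
    have FA: "FA (LA j) = F j" if "j \<in> JA" for j using that injA by (simp add: FA_def the_inv_into_f_f)
    have FB: "FB (LB j) = F j" if "j \<in> JB" for j using that injB by (simp add: FB_def the_inv_into_f_f)
    have FsA: "j \<in> JA \<Longrightarrow> F j \<in> sets M" and FsB: "j \<in> JB \<Longrightarrow> F j \<in> sets M" for j
      using F by (simp_all add: JA_def JB_def)
    let ?SA = "{x\<in>space ?A. \<forall>i\<in>LA ` JA. x i \<in> FA i}"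
    let ?SB = "{x\<in>space ?B. \<forall>i\<in>LB ` JB. x i \<in> FB i}"
    have J_split: "(\<forall>j\<in>J. (case r j of Inl x \<Rightarrow> a x | Inr x \<Rightarrow> b x) \<in> F j) \<longleftrightarrow>
        (\<forall>j\<in>JA. a (LA j) \<in> F j) \<and> (\<forall>j\<in>JB. b (LB j) \<in> F j)" for a b
      unfolding JJ(1) ball_Un using LA LB by auto
    have "?f -` prod_emb UNIV (\<lambda>_. M) J (\<Pi>\<^sub>E j\<in>J. F j) \<inter> space (?A \<Otimes>\<^sub>M ?B) =
        {x \<in> space (?A \<Otimes>\<^sub>M ?B). \<forall>j\<in>J. (case r j of Inl a \<Rightarrow> fst x a | Inr b \<Rightarrow> snd x b) \<in> F j}"
    proof -
      have "?f x \<in> prod_emb UNIV (\<lambda>_. M) J (\<Pi>\<^sub>E j\<in>J. F j) \<longleftrightarrow>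
          (\<forall>j\<in>J. (case r j of Inl a \<Rightarrow> fst x a | Inr b \<Rightarrow> snd x b) \<in> F j)"
        if "x \<in> space (?A \<Otimes>\<^sub>M ?B)" for x
        using measurable_space[OF f that] by (simp add: prod_emb_iff space_PiM PiE_iff case_prod_beta)
      then show ?thesis by blast
    qed
    also have "\<dots> = ?SA \<times> ?SB"
      unfolding J_split by (auto simp: space_pair_measure FA FB)
    finally have "?f -` prod_emb UNIV (\<lambda>_. M) J (\<Pi>\<^sub>E j\<in>J. F j) \<inter> space (?A \<Otimes>\<^sub>M ?B) = ?SA \<times> ?SB" .
    moreover have SA: "emeasure ?A ?SA = (\<Prod>i\<in>LA`JA. emeasure M (FA i))"
      by (rule A.emeasure_PiM_Collect) (use JJ3 FA FsA in auto)
    moreover have SB: "emeasure ?B ?SB = (\<Prod>i\<in>LB`JB. emeasure M (FB i))"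
      by (rule B.emeasure_PiM_Collect) (use JJ3 FB FsB in auto)
    moreover have "?SA \<in> sets ?A" "?SB \<in> sets ?B"
      using JJ3 FA FB FsA FsB by (auto intro!: sets.sets_Collect_finite_All sets_Collect_single')
    moreover have "prod_emb UNIV (\<lambda>_. M) J (\<Pi>\<^sub>E j\<in>J. F j) \<in> sets ?I"
      using J F by (intro sets_PiM_I) auto
    ultimately have "emeasure (distr (?A \<Otimes>\<^sub>M ?B) ?I ?f) (prod_emb UNIV (\<lambda>_. M) J (\<Pi>\<^sub>E j\<in>J. F j)) =
        (\<Prod>i\<in>LA`JA. emeasure M (FA i)) * (\<Prod>i\<in>LB`JB. emeasure M (FB i))"
      by (simp add: emeasure_distr B.emeasure_pair_measure_Times)
    also have "\<dots> = (\<Prod>j\<in>J. emeasure M (F j))"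
      unfolding JJ1 prod.union_disjoint[OF JJ3 JJ2] by (simp add: prod.reindex injA injB FA FB)
    finally show "emeasure (distr (?A \<Otimes>\<^sub>M ?B) ?I ?f) (prod_emb UNIV (\<lambda>_. M) J (\<Pi>\<^sub>E j\<in>J. F j)) =
      (\<Prod>j\<in>J. emeasure M (F j))" .
  qed simp
qed

lemma nn_integral_PiM_split:
  fixes M :: "'c measure" and r :: "'i \<Rightarrow> 'a + 'b"
  assumes M: "prob_space M" and inj: "inj r"
    and [measurable]: "F \<in> borel_measurable (PiM (UNIV::'i set) (\<lambda>_. M))"
  shows "(\<integral>\<^sup>+x. F x \<partial>PiM (UNIV::'i set) (\<lambda>_. M)) =
    (\<integral>\<^sup>+\<omega>. \<integral>\<^sup>+\<eta>. F (\<lambda>v. case r v of Inl a \<Rightarrow> \<omega> a | Inr b \<Rightarrow> \<eta> b)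
       \<partial>PiM (UNIV::'b set) (\<lambda>_. M) \<partial>PiM (UNIV::'a set) (\<lambda>_. M))"
proof -
  interpret M: prob_space M by fact
  interpret A: product_prob_space "\<lambda>_. M" "UNIV :: 'a set" by unfold_locales
  interpret B: product_prob_space "\<lambda>_. M" "UNIV :: 'b set" by unfold_locales
  let ?f = "\<lambda>(\<omega>, \<eta>) v. case r v of Inl a \<Rightarrow> \<omega> a | Inr b \<Rightarrow> \<eta> b"
  have f[measurable]: "?f \<in> measurable (PiM (UNIV::'a set) (\<lambda>_. M) \<Otimes>\<^sub>M PiM (UNIV::'b set) (\<lambda>_. M)) (PiM (UNIV::'i set) (\<lambda>_. M))"
  proof (rule measurable_PiM_single')
    fix i :: 'i
    show "(\<lambda>x. ?f x i) \<in> measurable (PiM (UNIV::'a set) (\<lambda>_. M) \<Otimes>\<^sub>M PiM (UNIV::'b set) (\<lambda>_. M)) M"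
      by (cases "r i") (auto simp: case_prod_beta)
  qed (auto simp: space_pair_measure space_PiM PiE_def Pi_def split: sum.split)
  have Ff: "(\<lambda>x. F (?f x)) \<in> borel_measurable (PiM (UNIV::'a set) (\<lambda>_. M) \<Otimes>\<^sub>M PiM (UNIV::'b set) (\<lambda>_. M))"
    using measurable_compose[OF f assms(3)] .
  show "(\<integral>\<^sup>+x. F x \<partial>PiM (UNIV::'i set) (\<lambda>_. M)) =
    (\<integral>\<^sup>+\<omega>. \<integral>\<^sup>+\<eta>. F (\<lambda>v. case r v of Inl a \<Rightarrow> \<omega> a | Inr b \<Rightarrow> \<eta> b)
       \<partial>PiM (UNIV::'b set) (\<lambda>_. M) \<partial>PiM (UNIV::'a set) (\<lambda>_. M))"
    apply (subst distr_PiM_split[OF M inj, symmetric])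
    apply (subst nn_integral_distr[OF f], simp)
    apply (subst B.nn_integral_fst[symmetric, OF Ff])
    by simp
qed

lemma nn_integral_PiM_component:
  fixes M :: "'c measure"
  assumes M: "prob_space M" and f: "f \<in> borel_measurable M"
  shows "(\<integral>\<^sup>+x. f (x i) \<partial>PiM UNIV (\<lambda>_. M)) = (\<integral>\<^sup>+z. f z \<partial>M)"
proof -
  have "M = distr (PiM UNIV (\<lambda>_. M)) M (\<lambda>x. x i)"
    using distr_PiM_component[of UNIV "\<lambda>_. M" i] M by simp
  then have "(\<integral>\<^sup>+z. f z \<partial>M) = (\<integral>\<^sup>+z. f z \<partial>distr (PiM UNIV (\<lambda>_. M)) M (\<lambda>x. x i))" by simp
  also have "\<dots> = (\<integral>\<^sup>+x. f (x i) \<partial>PiM UNIV (\<lambda>_. M))"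
    by (rule nn_integral_distr) (use f in simp_all)
  finally show ?thesis by simp
qed

text \<open>The marks of all children of \<open>x\<close> are replaced by the sequence
  \<open>\<eta>\<close>, indexed by child number. For independent \<open>\<omega>\<close> and
  \<open>\<eta>\<close> the result is again distributed as an environment, so the children of a
  fresh vertex can be averaged out with everything else held fixed.\<close>

definition graft :: "nat list \<Rightarrow> (nat list \<Rightarrow> 'a) \<Rightarrow> (nat \<Rightarrow> 'a) \<Rightarrow> nat list \<Rightarrow> 'a" where
  "graft x \<omega> \<eta> v = (if v \<noteq> [] \<and> tl v = x then \<eta> (hd v) else \<omega> v)"

lemma graft_child[simp]: "graft x \<omega> \<eta> (j # x) = \<eta> j"
  by (simp add: graft_def)

lemma graft_other: "v = [] \<or> tl v \<noteq> x \<Longrightarrow> graft x \<omega> \<eta> v = \<omega> v"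
  by (auto simp: graft_def)

lemma graft_self[simp]: "graft x \<omega> \<eta> x = \<omega> x"
  by (cases x) (auto simp: graft_def)

lemma graft_tl_self[simp]: "graft x \<omega> \<eta> (tl x) = \<omega> (tl x)"
proof (rule graft_other)
  have "length (tl (tl x)) < length x" if "tl x \<noteq> []"
    using that by (cases x) (auto simp: neq_Nil_conv)
  then show "tl x = [] \<or> tl (tl x) \<noteq> x"
    by (metis less_irrefl)
qed

lemma nn_integral_PiM_graft:
  fixes M :: "'c measure" and F :: "(nat list \<Rightarrow> 'c) \<Rightarrow> ennreal"
  assumes M: "prob_space M"
    and F: "F \<in> borel_measurable (PiM UNIV (\<lambda>_. M))"
  shows "(\<integral>\<^sup>+\<omega>. F \<omega> \<partial>PiM UNIV (\<lambda>_. M)) =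
    (\<integral>\<^sup>+\<omega>. \<integral>\<^sup>+\<eta>. F (graft x \<omega> \<eta>) \<partial>PiM UNIV (\<lambda>_. M) \<partial>PiM UNIV (\<lambda>_. M))"
proof -
  \<comment> \<open>Children of \<open>x\<close> read from the second factor, all other vertices
    from the first. The entries of \<open>\<omega>\<close> at the children of \<open>x\<close> are
    never read.\<close>
  define r :: "nat list \<Rightarrow> nat list + nat" where
    "r v = (if v \<noteq> [] \<and> tl v = x then Inr (hd v) else Inl v)" for v
  have "inj r"
    by (rule injI) (auto simp: r_def split: if_splits intro: list.expand)
  note * = nn_integral_PiM_split[OF M this F]
  have **: "(\<lambda>v. case r v of Inl a \<Rightarrow> \<omega> a | Inr b \<Rightarrow> \<eta> b) = graft x \<omega> \<eta>" for \<omega> :: "nat list \<Rightarrow> 'c" and \<eta>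
    by (auto simp: fun_eq_iff graft_def r_def)
  show ?thesis using * unfolding ** .
qed

text \<open>Resampling one coordinate serves two purposes: induction over the children of a vertex,
  and separating child \<open>0\<close> from its siblings.\<close>

lemma nn_integral_PiM_upd:
  fixes M :: "'c measure" and F :: "('i \<Rightarrow> 'c) \<Rightarrow> ennreal"
  assumes M: "prob_space M"
    and F: "F \<in> borel_measurable (PiM UNIV (\<lambda>_. M))"
  shows "(\<integral>\<^sup>+\<omega>. F \<omega> \<partial>PiM UNIV (\<lambda>_. M)) =
    (\<integral>\<^sup>+\<omega>. \<integral>\<^sup>+z. F (fun_upd \<omega> i z) \<partial>M \<partial>PiM UNIV (\<lambda>_. M))"
proof -
  define r :: "'i \<Rightarrow> 'i + unit" where
    "r v = (if v = i then Inr () else Inl v)" for v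
  have "inj r"
    by (rule injI) (auto simp: r_def split: if_splits)
  note * = nn_integral_PiM_split[OF M this F]
  have **: "(\<lambda>v. case r v of Inl a \<Rightarrow> \<omega> a | Inr b \<Rightarrow> \<eta> b) = fun_upd \<omega> i (\<eta> ())" for \<omega> :: "'i \<Rightarrow> 'c" and \<eta>
    by (auto simp: fun_eq_iff r_def)
  have "(\<lambda>z. F (fun_upd \<omega> i z)) \<in> borel_measurable M" if "\<omega> \<in> space (PiM UNIV (\<lambda>_. M))" for \<omega>
  proof (rule measurable_compose[OF _ F], rule measurable_PiM_single')
    show "(\<lambda>z. fun_upd \<omega> i z j) \<in> measurable M M" for j
      using that by (cases "j = i") (auto simp: space_PiM PiE_iff)
    show "(\<lambda>z. fun_upd \<omega> i z) \<in> space M \<rightarrow> UNIV \<rightarrow>\<^sub>E space M"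
      using that by (auto simp: space_PiM PiE_iff)
  qed
  then show ?thesis unfolding * **
    by (intro nn_integral_cong nn_integral_PiM_component[OF M]) auto
qed

lemma measurable_sum_lessThan:
  fixes f :: "'a \<Rightarrow> nat" and g :: "nat \<Rightarrow> 'a \<Rightarrow> 'b :: {second_countable_topology, topological_comm_monoid_add}"
  assumes [measurable]: "f \<in> measurable M (count_space UNIV)" "\<And>j. g j \<in> borel_measurable M"
  shows "(\<lambda>x. \<Sum>j<f x. g j x) \<in> borel_measurable M"
  by (rule measurable_compose_countable[where f="\<lambda>n x. \<Sum>j<n. g j x" and g=f]) simp_all

lemma nn_integral_countable_measurable:
  fixes f :: "'a :: countable \<Rightarrow> 'b \<Rightarrow> ennreal"
  assumes [measurable]: "\<And>i. f i \<in> borel_measurable M"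
  shows "(\<lambda>x. \<integral>\<^sup>+i. f i x \<partial>count_space A) \<in> borel_measurable M"
proof -
  interpret sigma_finite_measure "count_space A"
    by (rule sigma_finite_measure_count_space_countable) simp
  have "(\<lambda>(x, i). f i x) \<in> borel_measurable (M \<Otimes>\<^sub>M count_space A)"
    unfolding case_prod_beta
    by (rule measurable_compose_countable'[where f="\<lambda>i p. f i (fst p)" and g=snd and I=A]) auto
  then show ?thesis by (rule borel_measurable_nn_integral)
qed

section \<open>Environments, transition probabilities and histories\<close>

type_synonym mark = "nat \<times> (nat \<times> nat \<Rightarrow> real)"

text \<open>A mark \<open>(N, \<xi>)\<close> carries the conductance candidates of the edge to the parent; \<open>cn a\<close> selects the
  one that is used when the parent has index \<open>a\<close>.\<close>

definition cn :: "nat \<Rightarrow> mark \<Rightarrow> real" where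
  "cn a z = snd z (a, fst z)"

definition cpar :: "env \<Rightarrow> nat list \<Rightarrow> real" where
  "cpar \<omega> v = cn (fst (\<omega> (tl v))) (\<omega> v)"

text \<open>Positivity is demanded of every candidate, also of those never selected, so that it
  survives grafting. It still holds almost surely: the candidates are countably many, and those with
  a zero index are constantly 1.\<close>

definition okm :: "mark \<Rightarrow> bool" where
  "okm z \<longleftrightarrow> 1 \<le> fst z \<and> (\<forall>km. 0 < snd z km)"

lemma finite_nbrs[simp]: "finite (nbrs \<omega> x)"
  by (auto simp: nbrs_def)

lemma tl_tl_neq: "x \<noteq> [] \<Longrightarrow> tl (tl x) \<noteq> x"
  by (metis graft_tl_self length_tl diff_le_self le_antisym length_0_conv diff_less le_trans not_less length_greater_0_conv zero_less_one)

text \<open>The additional child of the root makes up for its missing parent.\<close>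

lemma idx_eq[simp]: "idx \<omega> x = fst (\<omega> x)"
proof (cases x)
  case Nil
  have "{[i] |i. i < Suc (fst (\<omega> []))} = (\<lambda>i. [i]) ` {..<Suc (fst (\<omega> []))}" by auto
  then show ?thesis using Nil by (simp add: idx_def nbrs_def nch_def card_image inj_on_def)
next
  case (Cons a y)
  have "{i # x |i. i < fst (\<omega> x)} = (\<lambda>i. i # x) ` {..<fst (\<omega> x)}" by auto
  moreover have "y \<notin> (\<lambda>i. i # x) ` {..<fst (\<omega> x)}"
    using Cons by (auto dest: arg_cong[where f=length])
  ultimately show ?thesis using Cons by (simp add: idx_def nbrs_def nch_def card_image inj_on_def)
qed

lemma conductance_child: "j < nch \<omega> x \<Longrightarrow> conductance \<omega> x (j # x) = cpar \<omega> (j # x)"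
  by (auto simp: conductance_def nbrs_def cpar_def cn_def)

lemma conductance_parent: "x \<noteq> [] \<Longrightarrow> conductance \<omega> x (tl x) = cpar \<omega> x"
  using tl_tl_neq[of x] by (auto simp: conductance_def nbrs_def cpar_def cn_def)

lemma conductance_outside: "y \<notin> nbrs \<omega> x \<Longrightarrow> conductance \<omega> x y = 0"
  by (simp add: conductance_def)

lemma sum_nbrs:
  fixes f :: "nat list \<Rightarrow> 'b :: comm_monoid_add"
  shows "(\<Sum>z\<in>nbrs \<omega> x. f z) = (if x = [] then 0 else f (tl x)) + (\<Sum>j<nch \<omega> x. f (j # x))"
proof -
  have 1: "{i # x |i. i < nch \<omega> x} = (\<lambda>i. i # x) ` {..<nch \<omega> x}" by auto
  have 2: "tl x \<notin> (\<lambda>i. i # x) ` {..<nch \<omega> x}"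
    by (auto dest!: arg_cong[where f=length])
  have 3: "(\<Sum>z\<in>(\<lambda>i. i # x) ` {..<nch \<omega> x}. f z) = (\<Sum>j<nch \<omega> x. f (j # x))"
    by (subst sum.reindex) (auto simp: inj_on_def)
  show ?thesis
    unfolding nbrs_def 1 using 2 3 by (auto simp: add.commute)
qed

definition ctot :: "env \<Rightarrow> nat list \<Rightarrow> real" where
  "ctot \<omega> x = (if x = [] then 0 else cpar \<omega> x) + (\<Sum>j<nch \<omega> x. cpar \<omega> (j # x))"

lemma trans_prob_eq: "trans_prob \<omega> x y = conductance \<omega> x y / ctot \<omega> x"
  by (simp add: trans_prob_def ctot_def sum_nbrs conductance_child conductance_parent)

lemma trans_prob_child: "j < nch \<omega> x \<Longrightarrow> trans_prob \<omega> x (j # x) = cpar \<omega> (j # x) / ctot \<omega> x"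
  by (simp add: trans_prob_eq conductance_child)

lemma trans_prob_parent: "x \<noteq> [] \<Longrightarrow> trans_prob \<omega> x (tl x) = cpar \<omega> x / ctot \<omega> x"
  by (simp add: trans_prob_eq conductance_parent)

lemma trans_prob_outside: "y \<notin> nbrs \<omega> x \<Longrightarrow> trans_prob \<omega> x y = 0"
  by (simp add: trans_prob_eq conductance_outside)

definition ok :: "env \<Rightarrow> bool" where
  "ok \<omega> \<longleftrightarrow> (\<forall>v. okm (\<omega> v))"

lemma ok_cpar: "ok \<omega> \<Longrightarrow> 0 < cpar \<omega> v"
  by (simp add: ok_def okm_def cpar_def cn_def)

lemma ok_fst: "ok \<omega> \<Longrightarrow> 1 \<le> fst (\<omega> v)"
  by (simp add: ok_def okm_def)

lemma ok_nch: "ok \<omega> \<Longrightarrow> 0 < nch \<omega> v"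
  using ok_fst[of \<omega> v] by (simp add: nch_def)

lemma ok_graft: "ok \<omega> \<Longrightarrow> (\<And>j. okm (\<eta> j)) \<Longrightarrow> ok (graft x \<omega> \<eta>)"
  by (simp add: ok_def graft_def)

lemma ok_ctot: "ok \<omega> \<Longrightarrow> 0 < ctot \<omega> v"
proof -
  assume ok: "ok \<omega>"
  have "0 < (\<Sum>j<nch \<omega> v. cpar \<omega> (j # v))"
    using ok_nch[OF ok, of v] by (intro sum_pos) (auto simp: ok_cpar[OF ok])
  then show ?thesis using ok_cpar[OF ok, of v] by (auto simp: ctot_def)
qed

lemma trans_prob_nonneg: "ok \<omega> \<Longrightarrow> 0 \<le> trans_prob \<omega> x y"
  using ok_ctot[of \<omega> x] ok_cpar[of \<omega>]
  by (cases "y \<in> nbrs \<omega> x")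
     (auto simp: nbrs_def trans_prob_outside trans_prob_child trans_prob_parent less_imp_le split: if_splits)

lemma sum_trans_prob: "ok \<omega> \<Longrightarrow> (\<Sum>y\<in>nbrs \<omega> x. trans_prob \<omega> x y) = 1"
  using ok_ctot[of \<omega> x]
  by (cases "x = []") (simp_all add: sum_nbrs trans_prob_child trans_prob_parent ctot_def flip: sum_divide_distrib add_divide_distrib)

text \<open>The one-step expectation of the walk at \<open>x\<close>. It runs over all vertices
  rather than over the environment-dependent set of neighbours, so that Fubini and measurability in
  \<open>\<omega>\<close> apply directly.\<close>

definition nxt :: "env \<Rightarrow> nat list \<Rightarrow> (nat list \<Rightarrow> ennreal) \<Rightarrow> ennreal" where
  "nxt \<omega> x \<Psi> = (\<integral>\<^sup>+y. ennreal (trans_prob \<omega> x y) * \<Psi> y \<partial>count_space UNIV)"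

lemma nxt_eq: "nxt \<omega> x \<Psi> = (\<Sum>y\<in>nbrs \<omega> x. ennreal (trans_prob \<omega> x y) * \<Psi> y)"
  unfolding nxt_def by (rule nn_integral_count_space') (auto simp: trans_prob_outside)

lemma sum_trans_prob_ennreal: "ok \<omega> \<Longrightarrow> (\<Sum>y\<in>nbrs \<omega> x. ennreal (trans_prob \<omega> x y)) = 1"
  by (subst sum_ennreal) (auto simp: trans_prob_nonneg sum_trans_prob)

lemma nxt_const: "ok \<omega> \<Longrightarrow> nxt \<omega> x (\<lambda>_. c) = c"
  by (simp add: nxt_eq sum_trans_prob_ennreal flip: sum_distrib_right)

lemma nxt_cmult: "nxt \<omega> x (\<lambda>y. c * \<Psi> y) = c * nxt \<omega> x \<Psi>"
  by (simp add: nxt_eq sum_distrib_left ac_simps)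

text \<open>The only way in which potentials are shown to drop: one favourable neighbour is singled
  out and all the others are bounded by 1.\<close>

lemma nxt_gain:
  assumes ok: "ok \<omega>" and y: "y0 \<in> nbrs \<omega> x" and le: "\<And>y. y \<in> nbrs \<omega> x \<Longrightarrow> \<psi> y \<le> 1"
    and nn: "\<And>y. 0 \<le> \<psi> y"
    and g: "\<psi> y0 \<le> 1 - g"
  shows "nxt \<omega> x (\<lambda>y. ennreal (\<psi> y)) \<le> ennreal (1 - trans_prob \<omega> x y0 * g)"
proof -
  have "nxt \<omega> x (\<lambda>y. ennreal (\<psi> y)) = ennreal (\<Sum>y\<in>nbrs \<omega> x. trans_prob \<omega> x y * \<psi> y)"
    unfolding nxt_eq using ok nn
    by (subst sum_ennreal[symmetric]) (auto simp: ennreal_mult trans_prob_nonneg intro!: sum.cong)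
  also have "(\<Sum>y\<in>nbrs \<omega> x. trans_prob \<omega> x y * \<psi> y) \<le>
     (\<Sum>y\<in>nbrs \<omega> x. trans_prob \<omega> x y - (if y = y0 then trans_prob \<omega> x y0 * g else 0))"
  proof (rule sum_mono)
    fix y assume y: "y \<in> nbrs \<omega> x"
    show "trans_prob \<omega> x y * \<psi> y \<le> trans_prob \<omega> x y - (if y = y0 then trans_prob \<omega> x y0 * g else 0)"
      using mult_left_mono[OF le[OF y] trans_prob_nonneg[OF ok, of x y]]
        mult_left_mono[OF g trans_prob_nonneg[OF ok, of x y0]]
      by (auto simp: algebra_simps)
  qed
  also have "\<dots> = 1 - trans_prob \<omega> x y0 * g"
    using y by (simp add: sum_subtractf sum_trans_prob[OF ok])
  finally show ?thesis by (simp add: ennreal_leI)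
qed

lemma nxt_le_one:
  assumes ok: "ok \<omega>" and le: "\<And>y. y \<in> nbrs \<omega> x \<Longrightarrow> \<Psi> y \<le> 1"
  shows "nxt \<omega> x \<Psi> \<le> 1"
proof -
  have "nxt \<omega> x \<Psi> \<le> nxt \<omega> x (\<lambda>_. 1)"
    unfolding nxt_eq by (intro sum_mono mult_left_mono le) auto
  then show ?thesis by (simp add: nxt_const[OF ok])
qed

text \<open>A history lists the positions of the walk in reverse order, the current one first.\<close>

fun W :: "env \<Rightarrow> nat list list \<Rightarrow> ennreal" where
  "W \<omega> [] = 0"
| "W \<omega> [x] = (if x = [] then 1 else 0)"
| "W \<omega> (y # x # hs) = W \<omega> (x # hs) * ennreal (trans_prob \<omega> x y)"

text \<open>The range of a nearest-neighbour path from the root contains all ancestors of its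
  points. This has two uses: below a fresh vertex nothing has been visited, and the depth of a
  visited vertex is less than the size of the range.\<close>

definition tl_closed :: "nat list list \<Rightarrow> bool" where
  "tl_closed hs \<longleftrightarrow> (\<forall>c\<in>set hs. tl c \<in> set hs)"

lemma W_prefix: "W \<omega> (x # hs) \<noteq> 0 \<Longrightarrow> hs \<noteq> [] \<Longrightarrow> W \<omega> hs \<noteq> 0"
  by (cases hs) auto

lemma W_step: "W \<omega> (y # x # hs) \<noteq> 0 \<Longrightarrow> y \<in> nbrs \<omega> x"
  using trans_prob_outside[of y \<omega> x] by (cases "y \<in> nbrs \<omega> x") auto

lemma nbrs_tl: "y \<in> nbrs \<omega> x \<Longrightarrow> y = tl x \<or> (\<exists>j<nch \<omega> x. y = j # x)"
  by (auto simp: nbrs_def split: if_splits)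

lemma W_tl_closed: "W \<omega> hs \<noteq> 0 \<Longrightarrow> tl_closed hs"
proof (induction \<omega> hs rule: W.induct)
  case (3 \<omega> y x hs)
  then have "tl_closed (x # hs)" by auto
  then show ?case using nbrs_tl[OF W_step[OF 3(2)]]
    by (auto simp: tl_closed_def)
qed (auto simp: tl_closed_def split: if_splits)

lemma nch_graft: "v = [] \<or> tl v \<noteq> x \<Longrightarrow> nch (graft x \<omega> \<eta>) v = nch \<omega> v"
  by (auto simp: nch_def graft_def)

text \<open>The transition probabilities at \<open>a\<close> read the marks of \<open>tl a\<close>,
  of \<open>a\<close> and of the children of \<open>a\<close>. The three assumptions say that none
  of these vertices is a child of \<open>x\<close>.\<close>

lemma trans_prob_graft:
  assumes "a \<noteq> x" "a = [] \<or> tl a \<noteq> x" "tl a = [] \<or> tl (tl a) \<noteq> x"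
  shows "trans_prob (graft x \<omega> \<eta>) a b = trans_prob \<omega> a b"
proof -
  have c: "graft x \<omega> \<eta> a = \<omega> a" "graft x \<omega> \<eta> (tl a) = \<omega> (tl a)" "graft x \<omega> \<eta> (j # a) = \<omega> (j # a)" for j
    using assms by (auto simp: graft_def)
  then have n: "nch (graft x \<omega> \<eta>) a = nch \<omega> a" by (cases "a = []") (simp_all add: nch_def)
  then have nb: "nbrs (graft x \<omega> \<eta>) a = nbrs \<omega> a" by (simp add: nbrs_def)
  have cp: "cpar (graft x \<omega> \<eta>) a = cpar \<omega> a" "cpar (graft x \<omega> \<eta>) (j # a) = cpar \<omega> (j # a)" for j
    by (simp_all add: cpar_def c)
  have "ctot (graft x \<omega> \<eta>) a = ctot \<omega> a" by (simp add: ctot_def cp n)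
  moreover have "conductance (graft x \<omega> \<eta>) a b = conductance \<omega> a b"
    using n cp nb by (cases "b \<in> nbrs \<omega> a")
       (auto simp: conductance_outside conductance_child conductance_parent nbrs_def split: if_splits)
  ultimately show ?thesis by (simp add: trans_prob_eq)
qed

text \<open>Since \<open>x\<close> is fresh and the past is closed under parents, no earlier
  position is \<open>x\<close>, a child of \<open>x\<close> or a grandchild of \<open>x\<close>; so
  no factor of the weight sees the grafted marks. The current position \<open>x\<close> has not yet
  contributed a factor for leaving it.\<close>

lemma W_graft:
  assumes "x \<notin> set rest"
  shows "W (graft x \<omega> \<eta>) (x # rest) = W \<omega> (x # rest)"
proof -
  have *: "W (graft x \<omega> \<eta>) (y # hs) = W \<omega> (y # hs)" if "x \<notin> set hs" "tl_closed hs" for y hs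
    using that
  proof (induction hs arbitrary: y)
    case (Cons a hs)
    have cl: "W (graft x \<omega> \<eta>) (a # hs) = W \<omega> (a # hs)"
    proof (cases "hs = [] \<or> tl_closed hs")
      case True
      then show ?thesis using Cons by auto
    next
      \<comment> \<open>A past that is not closed under parents has weight zero in both
        environments.\<close>
      case False
      then show ?thesis
        using W_prefix[of _ a hs] W_tl_closed[of _ hs] by metis
    qed
    have "a \<in> set (a # hs)" "tl a \<in> set (a # hs)" "tl (tl a) \<in> set (a # hs)"
      using Cons by (auto simp: tl_closed_def)
    then have "trans_prob (graft x \<omega> \<eta>) a y = trans_prob \<omega> a y"
      using Cons by (intro trans_prob_graft) auto
    then show ?case by (simp add: cl)
  qed simp
  show ?thesis
  proof (cases "rest = [] \<or> tl_closed rest")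
    case True
    then show ?thesis using *[of rest x] assms by auto
  next
    case False
    then show ?thesis using W_prefix[of _ x rest] W_tl_closed[of _ rest] by metis
  qed
qed

section \<open>Annealed expectations along histories\<close>

locale gw_env =
  fixes p :: "nat pmf" and \<mu>t :: "nat \<Rightarrow> nat \<Rightarrow> real measure"
  assumes p0: "pmf p 0 = 0"
    and mean_fin: "summable (\<lambda>j. real j * pmf p j)"
    and mu_prob: "\<And>k m. 1 \<le> k \<Longrightarrow> 1 \<le> m \<Longrightarrow> prob_space (\<mu>t k m)"
    and mu_sets: "\<And>k m. 1 \<le> k \<Longrightarrow> 1 \<le> m \<Longrightarrow> sets (\<mu>t k m) = sets borel"
    and mu_pos: "\<And>k m. 1 \<le> k \<Longrightarrow> 1 \<le> m \<Longrightarrow> (AE x in \<mu>t k m. 0 < x)"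
begin

definition MV :: "mark measure" where
  "MV = measure_pmf p \<Otimes>\<^sub>M (\<Pi>\<^sub>M km\<in>UNIV. cond_law \<mu>t km)"

definition P :: "env measure" where
  "P = (\<Pi>\<^sub>M v\<in>UNIV. MV)"

definition PN :: "(nat \<Rightarrow> mark) measure" where
  "PN = (\<Pi>\<^sub>M j\<in>UNIV. MV)"

lemma env_measure_eq: "env_measure p \<mu>t = P"
  by (simp add: env_measure_def P_def MV_def)

lemma prob_space_cond_law: "prob_space (cond_law \<mu>t km)"
  using mu_prob by (auto simp: cond_law_def intro!: prob_space_return)

lemma sets_cond_law[measurable_cong]: "sets (cond_law \<mu>t km) = sets borel"
  using mu_sets by (auto simp: cond_law_def)

lemma prob_space_MV: "prob_space MV"
proof -
  interpret A: prob_space "measure_pmf p" by (rule prob_space_measure_pmf)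
  interpret B: prob_space "\<Pi>\<^sub>M km\<in>UNIV. cond_law \<mu>t km"
    by (rule prob_space_PiM) (rule prob_space_cond_law)
  interpret pair_prob_space "measure_pmf p" "\<Pi>\<^sub>M km\<in>UNIV. cond_law \<mu>t km" ..
  show ?thesis unfolding MV_def by unfold_locales
qed

lemma prob_space_P: "prob_space P"
  unfolding P_def by (rule prob_space_PiM) (rule prob_space_MV)

lemma prob_space_PN: "prob_space PN"
  unfolding PN_def by (rule prob_space_PiM) (rule prob_space_MV)

sublocale MV: prob_space MV by (rule prob_space_MV)
sublocale env: prob_space P by (rule prob_space_P)
sublocale PN: prob_space PN by (rule prob_space_PN)

lemma measurable_fst_MV[measurable]: "fst \<in> measurable MV (count_space UNIV)"
proof -
  have "fst \<in> measurable MV (measure_pmf p)" unfolding MV_def by measurable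
  then show ?thesis by simp
qed

lemma measurable_snd_MV[measurable]: "(\<lambda>z. snd z km) \<in> borel_measurable MV"
proof -
  have "(\<lambda>z. snd z km) \<in> measurable MV (cond_law \<mu>t km)" unfolding MV_def by measurable
  then show ?thesis using measurable_cong_sets[OF refl sets_cond_law] by blast
qed

lemma measurable_coord_P[measurable]: "(\<lambda>\<omega>. \<omega> v) \<in> measurable P MV"
  unfolding P_def by measurable

lemma measurable_coord_PN[measurable]: "(\<lambda>\<eta>. \<eta> j) \<in> measurable PN MV"
  unfolding PN_def by measurable

lemma measurable_fst_P[measurable]: "(\<lambda>\<omega>. fst (\<omega> v)) \<in> measurable P (count_space UNIV)"
  by measurable

lemma measurable_snd_P[measurable]: "(\<lambda>\<omega>. snd (\<omega> v) km) \<in> borel_measurable P"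
  using measurable_compose[OF measurable_coord_P measurable_snd_MV] .

lemma measurable_cn[measurable]: "cn a \<in> borel_measurable MV"
  unfolding cn_def
  by (rule measurable_compose_countable[where f="\<lambda>i z. snd z (a, i)" and g=fst]) measurable

lemma measurable_cn_PN[measurable]: "(\<lambda>\<eta>. cn a (\<eta> j)) \<in> borel_measurable PN"
  by measurable

lemma measurable_cpar[measurable]: "(\<lambda>\<omega>. cpar \<omega> v) \<in> borel_measurable P"
  unfolding cpar_def
  by (rule measurable_compose_countable[where f="\<lambda>a \<omega>. cn a (\<omega> v)" and g="\<lambda>\<omega>. fst (\<omega> (tl v))"]) measurable

lemma measurable_nch[measurable]: "(\<lambda>\<omega>. nch \<omega> v) \<in> measurable P (count_space UNIV)"
  unfolding nch_def by measurable

lemma pred_okm[measurable]: "Measurable.pred MV okm"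
  unfolding okm_def by measurable

lemma AE_okm: "AE z in MV. okm z"
proof -
  interpret A: prob_space "measure_pmf p" by (rule prob_space_measure_pmf)
  interpret B: prob_space "\<Pi>\<^sub>M km\<in>UNIV. cond_law \<mu>t km"
    by (rule prob_space_PiM) (rule prob_space_cond_law)
  interpret pair_prob_space "measure_pmf p" "\<Pi>\<^sub>M km\<in>UNIV. cond_law \<mu>t km" ..
  have 1: "AE N in measure_pmf p. 1 \<le> N"
    unfolding AE_measure_pmf_iff using p0 by (auto simp: set_pmf_iff Suc_le_eq intro!: gr0I)
  have "AE x in cond_law \<mu>t km. 0 < x" for km
  proof (cases "1 \<le> fst km \<and> 1 \<le> snd km")
    case True
    then have "cond_law \<mu>t km = \<mu>t (fst km) (snd km)" by (simp add: cond_law_def)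
    with mu_pos[of "fst km" "snd km"] True show ?thesis by metis
  next
    case False
    have "AE x in return borel (1::real). 0 < x" by (subst AE_return) auto
    moreover have "cond_law \<mu>t km = return borel 1" using False by (auto simp: cond_law_def)
    ultimately show ?thesis by metis
  qed
  then have "AE \<xi> in (\<Pi>\<^sub>M km\<in>UNIV. cond_law \<mu>t km). 0 < \<xi> km" for km
    by (intro AE_PiM_component prob_space_cond_law) auto
  then have 2: "AE \<xi> in (\<Pi>\<^sub>M km\<in>UNIV. cond_law \<mu>t km). \<forall>km. 0 < \<xi> km"
    by (subst AE_all_countable) auto
  have 3: "{z \<in> space MV. okm z} \<in> sets MV" by measurable
  show ?thesis unfolding MV_def
  proof (rule AE_pair_measure)
    show "{z \<in> space (measure_pmf p \<Otimes>\<^sub>M Pi\<^sub>M UNIV (cond_law \<mu>t)). okm z} \<in>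
      sets (measure_pmf p \<Otimes>\<^sub>M Pi\<^sub>M UNIV (cond_law \<mu>t))"
      using 3 unfolding MV_def .
    show "AE x in measure_pmf p. AE y in Pi\<^sub>M UNIV (cond_law \<mu>t). okm (x, y)"
      using 1 by eventually_elim (use 2 in \<open>auto simp: okm_def\<close>)
  qed
qed

lemma AE_ok: "AE \<omega> in P. ok \<omega>"
  unfolding ok_def P_def
  by (subst AE_all_countable) (auto intro!: AE_PiM_component prob_space_MV AE_okm)

lemma AE_okm_PN: "AE \<eta> in PN. \<forall>j. okm (\<eta> j)"
  unfolding PN_def
  by (subst AE_all_countable) (auto intro!: AE_PiM_component prob_space_MV AE_okm)

lemma space_MV[simp]: "space MV = UNIV"
proof -
  have "space (cond_law \<mu>t km) = UNIV" for km
    using sets_eq_imp_space_eq[OF sets_cond_law, of km] by simp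
  then show ?thesis by (simp add: MV_def space_pair_measure space_PiM)
qed

lemma space_P[simp]: "space P = UNIV" and space_PN[simp]: "space PN = UNIV"
  by (simp_all add: P_def PN_def space_PiM)

text \<open>Free of the random set \<open>nbrs \<omega> x\<close>, so that measurability in
  \<open>\<omega>\<close> is visible.\<close>

lemma conductance_alt: "conductance \<omega> x y =
   (if y \<noteq> [] \<and> tl y = x then (if hd y < nch \<omega> x then cpar \<omega> y else 0)
    else if x \<noteq> [] \<and> y = tl x then cpar \<omega> x else 0)"
proof (cases "y \<in> nbrs \<omega> x")
  case True
  then show ?thesis
    using tl_tl_neq[of x] conductance_parent[of x \<omega>]
    by (auto simp: nbrs_def conductance_child split: if_splits)
next
  case False
  then show ?thesis
    by (cases y) (auto simp: nbrs_def conductance_outside split: if_splits)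
qed

lemma measurable_ctot[measurable]: "(\<lambda>\<omega>. ctot \<omega> x) \<in> borel_measurable P"
  unfolding ctot_def by (intro borel_measurable_add measurable_sum_lessThan) measurable

lemma measurable_trans_prob[measurable]: "(\<lambda>\<omega>. trans_prob \<omega> x y) \<in> borel_measurable P"
  unfolding trans_prob_eq conductance_alt by measurable

lemma measurable_W[measurable]: "(\<lambda>\<omega>. W \<omega> hs) \<in> borel_measurable P"
proof (induction hs rule: induct_list012)
  case (3 y x hs)
  have [measurable]: "(\<lambda>\<omega>. W \<omega> (x # hs)) \<in> borel_measurable P" by fact
  show ?case by simp
qed simp_all

lemma measurable_nxt[measurable (raw)]:
  assumes [measurable]: "\<And>y. (\<lambda>\<omega>. \<Psi> \<omega> y) \<in> borel_measurable P"
  shows "(\<lambda>\<omega>. nxt \<omega> x (\<Psi> \<omega>)) \<in> borel_measurable P"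
  unfolding nxt_def by (rule nn_integral_countable_measurable) measurable

text \<open>The annealed expectation of \<open>\<Phi>\<close> at time \<open>t\<close>; histories
  have length \<open>t + 1\<close> because they include the starting point. As a countable sum of
  integrals it needs neither a construction of the walk nor a measurable choice of its law as a
  function of \<open>\<omega>\<close>.\<close>

definition annE :: "nat \<Rightarrow> (env \<Rightarrow> nat list list \<Rightarrow> ennreal) \<Rightarrow> ennreal" where
  "annE t \<Phi> = (\<integral>\<^sup>+hs. (if length hs = Suc t then (\<integral>\<^sup>+\<omega>. W \<omega> hs * \<Phi> \<omega> hs \<partial>P) else 0) \<partial>count_space UNIV)"

lemma annE_Suc:
  assumes [measurable]: "\<And>hs. (\<lambda>\<omega>. \<Phi> \<omega> hs) \<in> borel_measurable P"
  shows "annE (Suc t) \<Phi> = (\<integral>\<^sup>+hs. (if length hs = Suc t then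
      (\<integral>\<^sup>+\<omega>. W \<omega> hs * nxt \<omega> (hd hs) (\<lambda>y. \<Phi> \<omega> (y # hs)) \<partial>P) else 0) \<partial>count_space UNIV)"
proof -
  define g where "g hs = (if length hs = Suc (Suc t) then (\<integral>\<^sup>+\<omega>. W \<omega> hs * \<Phi> \<omega> hs \<partial>P) else 0)" for hs
  have bij: "bij_betw (\<lambda>(y, hs). y # hs) UNIV (- {[] :: nat list list})"
    by (rule bij_betwI[where g="\<lambda>l. (hd l, tl l)"]) auto
  have "annE (Suc t) \<Phi> = (\<integral>\<^sup>+hs. g hs \<partial>count_space UNIV)"
    by (simp add: annE_def g_def)
  also have "\<dots> = (\<integral>\<^sup>+hs. g hs \<partial>count_space (- {[]}))"
    by (rule nn_integral_count_space_eq) (auto simp: g_def)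
  also have "\<dots> = (\<integral>\<^sup>+yh. g ((\<lambda>(y, hs). y # hs) yh) \<partial>count_space UNIV)"
    using nn_integral_bij_count_space[OF bij, of g] by simp
  also have "\<dots> = (\<integral>\<^sup>+hs. \<integral>\<^sup>+y. g (y # hs) \<partial>count_space UNIV \<partial>count_space UNIV)"
    using nn_integral_snd_count_space[of "\<lambda>yh. g ((\<lambda>(y, hs). y # hs) yh)"] by simp
  also have "\<dots> = (\<integral>\<^sup>+hs. (if length hs = Suc t then
      (\<integral>\<^sup>+\<omega>. W \<omega> hs * nxt \<omega> (hd hs) (\<lambda>y. \<Phi> \<omega> (y # hs)) \<partial>P) else 0) \<partial>count_space UNIV)"
  proof (rule nn_integral_cong)
    fix hs :: "nat list list"
    show "(\<integral>\<^sup>+y. g (y # hs) \<partial>count_space UNIV) = (if length hs = Suc t then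
      (\<integral>\<^sup>+\<omega>. W \<omega> hs * nxt \<omega> (hd hs) (\<lambda>y. \<Phi> \<omega> (y # hs)) \<partial>P) else 0)"
    proof (cases "length hs = Suc t")
      case True
      then obtain x rest where hs: "hs = x # rest" by (cases hs) auto
      have "(\<integral>\<^sup>+y. g (y # hs) \<partial>count_space UNIV) =
          (\<integral>\<^sup>+y. \<integral>\<^sup>+\<omega>. W \<omega> hs * (ennreal (trans_prob \<omega> x y) * \<Phi> \<omega> (y # hs)) \<partial>P \<partial>count_space UNIV)"
        using True by (simp add: g_def hs mult.assoc)
      also have "\<dots> = (\<integral>\<^sup>+\<omega>. \<integral>\<^sup>+y. W \<omega> hs * (ennreal (trans_prob \<omega> x y) * \<Phi> \<omega> (y # hs)) \<partial>count_space UNIV \<partial>P)"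
        by (rule nn_integral_count_space_nn_integral[symmetric]) auto
      also have "\<dots> = (\<integral>\<^sup>+\<omega>. W \<omega> hs * nxt \<omega> x (\<lambda>y. \<Phi> \<omega> (y # hs)) \<partial>P)"
        unfolding nxt_def by (simp add: nn_integral_cmult)
      finally show ?thesis using True by (simp add: hs)
    qed (simp add: g_def)
  qed
  finally show ?thesis .
qed

lemma annE_cong_mono:
  assumes "\<And>\<omega> hs. ok \<omega> \<Longrightarrow> W \<omega> hs \<noteq> 0 \<Longrightarrow> length hs = Suc t \<Longrightarrow> \<Phi> \<omega> hs \<le> \<Phi>' \<omega> hs"
  shows "annE t \<Phi> \<le> annE t \<Phi>'"
  unfolding annE_def
proof (intro nn_integral_mono, clarsimp)
  fix hs :: "nat list list" assume l: "length hs = Suc t"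
  show "(\<integral>\<^sup>+\<omega>. W \<omega> hs * \<Phi> \<omega> hs \<partial>P) \<le> (\<integral>\<^sup>+\<omega>. W \<omega> hs * \<Phi>' \<omega> hs \<partial>P)"
  proof (rule nn_integral_mono_AE)
    show "AE \<omega> in P. W \<omega> hs * \<Phi> \<omega> hs \<le> W \<omega> hs * \<Phi>' \<omega> hs"
      using AE_ok
    proof eventually_elim
      case (elim \<omega>)
      then show ?case using assms[of \<omega> hs] l by (cases "W \<omega> hs = 0") (auto intro: mult_left_mono)
    qed
  qed
qed

lemma annE_add:
  assumes [measurable]: "\<And>hs. (\<lambda>\<omega>. \<Phi> \<omega> hs) \<in> borel_measurable P" "\<And>hs. (\<lambda>\<omega>. \<Phi>' \<omega> hs) \<in> borel_measurable P"
  shows "annE t (\<lambda>\<omega> hs. \<Phi> \<omega> hs + \<Phi>' \<omega> hs) = annE t \<Phi> + annE t \<Phi>'"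
proof -
  have "annE t (\<lambda>\<omega> hs. \<Phi> \<omega> hs + \<Phi>' \<omega> hs) = (\<integral>\<^sup>+hs. (if length hs = Suc t then (\<integral>\<^sup>+\<omega>. W \<omega> hs * \<Phi> \<omega> hs \<partial>P) else 0) +
      (if length hs = Suc t then (\<integral>\<^sup>+\<omega>. W \<omega> hs * \<Phi>' \<omega> hs \<partial>P) else 0) \<partial>count_space UNIV)"
    unfolding annE_def by (intro nn_integral_cong) (simp add: distrib_left nn_integral_add)
  also have "\<dots> = annE t \<Phi> + annE t \<Phi>'"
    unfolding annE_def by (rule nn_integral_add) auto
  finally show ?thesis .
qed

lemma annE_cmult:
  assumes [measurable]: "\<And>hs. (\<lambda>\<omega>. \<Phi> \<omega> hs) \<in> borel_measurable P"
  shows "annE t (\<lambda>\<omega> hs. c * \<Phi> \<omega> hs) = c * annE t \<Phi>"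
proof -
  have "annE t (\<lambda>\<omega> hs. c * \<Phi> \<omega> hs) = (\<integral>\<^sup>+hs. c * (if length hs = Suc t then (\<integral>\<^sup>+\<omega>. W \<omega> hs * \<Phi> \<omega> hs \<partial>P) else 0) \<partial>count_space UNIV)"
    unfolding annE_def by (intro nn_integral_cong) (simp add: mult.left_commute[of _ c] nn_integral_cmult)
  also have "\<dots> = c * annE t \<Phi>"
    unfolding annE_def by (rule nn_integral_cmult) auto
  finally show ?thesis .
qed

lemma annE_0:
  assumes [measurable]: "\<And>hs. (\<lambda>\<omega>. \<Phi> \<omega> hs) \<in> borel_measurable P"
  shows "annE 0 \<Phi> = (\<integral>\<^sup>+\<omega>. \<Phi> \<omega> [[]] \<partial>P)"
proof -
  have "annE 0 \<Phi> = (\<Sum>hs\<in>{[[]]}. (if length hs = Suc 0 then (\<integral>\<^sup>+\<omega>. W \<omega> hs * \<Phi> \<omega> hs \<partial>P) else 0))"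
    unfolding annE_def
  proof (rule nn_integral_count_space')
    fix hs :: "nat list list" assume hs: "hs \<notin> {[[]]}"
    have "W \<omega> hs = 0" if "length hs = Suc 0" for \<omega>
      using that hs by (cases hs) auto
    then show "(if length hs = Suc 0 then (\<integral>\<^sup>+\<omega>. W \<omega> hs * \<Phi> \<omega> hs \<partial>P) else 0) = 0" by simp
  qed auto
  then show ?thesis by simp
qed

lemma graft_measurable:
  assumes "F \<in> borel_measurable P"
  shows "(\<lambda>\<eta>. F (graft x \<omega> \<eta>)) \<in> borel_measurable PN"
proof (rule measurable_compose[OF _ assms])
  show "graft x \<omega> \<in> measurable PN P"
    unfolding P_def
  proof (rule measurable_PiM_single')
    show "(\<lambda>\<eta>. graft x \<omega> \<eta> v) \<in> measurable PN MV" for v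
      by (cases "v \<noteq> [] \<and> tl v = x") (auto simp: graft_def)
  qed (auto simp: PiE_def)
qed

lemma nn_integral_P_graft:
  assumes "F \<in> borel_measurable P"
  shows "(\<integral>\<^sup>+\<omega>. F \<omega> \<partial>P) = (\<integral>\<^sup>+\<omega>. \<integral>\<^sup>+\<eta>. F (graft x \<omega> \<eta>) \<partial>PN \<partial>P)"
  using nn_integral_PiM_graft[OF prob_space_MV, of F x] assms by (simp add: P_def PN_def)

text \<open>At a fresh vertex the marks of its children are still independent of the past,
  so they may be averaged out; at an already visited vertex only the step of the walk is averaged.\<close>

lemma annE_step:
  assumes [measurable]: "\<And>hs. (\<lambda>\<omega>. \<Phi> \<omega> hs) \<in> borel_measurable P"
    and old: "\<And>\<omega> x rest. ok \<omega> \<Longrightarrow> W \<omega> (x # rest) \<noteq> 0 \<Longrightarrow> x \<in> set rest \<Longrightarrow>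
      nxt \<omega> x (\<lambda>y. \<Phi> \<omega> (y # x # rest)) \<le> \<Phi>' \<omega> (x # rest)"
    and new: "\<And>\<omega> x rest. ok \<omega> \<Longrightarrow> W \<omega> (x # rest) \<noteq> 0 \<Longrightarrow> x \<notin> set rest \<Longrightarrow>
      (\<integral>\<^sup>+\<eta>. nxt (graft x \<omega> \<eta>) x (\<lambda>y. \<Phi> (graft x \<omega> \<eta>) (y # x # rest)) \<partial>PN) \<le> \<Phi>' \<omega> (x # rest)"
  shows "annE (Suc t) \<Phi> \<le> annE t \<Phi>'"
  unfolding annE_Suc[OF assms(1)] unfolding annE_def
proof (intro nn_integral_mono, clarsimp)
  fix hs :: "nat list list" assume l: "length hs = Suc t"
  then obtain x rest where hs: "hs = x # rest" by (cases hs) auto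
  show "(\<integral>\<^sup>+\<omega>. W \<omega> hs * nxt \<omega> (hd hs) (\<lambda>y. \<Phi> \<omega> (y # hs)) \<partial>P) \<le> (\<integral>\<^sup>+\<omega>. W \<omega> hs * \<Phi>' \<omega> hs \<partial>P)"
  proof (cases "x \<in> set rest")
    case True
    show ?thesis
    proof (rule nn_integral_mono_AE)
      show "AE \<omega> in P. W \<omega> hs * nxt \<omega> (hd hs) (\<lambda>y. \<Phi> \<omega> (y # hs)) \<le> W \<omega> hs * \<Phi>' \<omega> hs"
        using AE_ok
      proof eventually_elim
        case (elim \<omega>)
        then show ?case using old[of \<omega> x rest] True
          by (cases "W \<omega> hs = 0") (auto simp: hs intro: mult_left_mono)
      qed
    qed
  next
    case False
    have "(\<integral>\<^sup>+\<omega>. W \<omega> hs * nxt \<omega> (hd hs) (\<lambda>y. \<Phi> \<omega> (y # hs)) \<partial>P) =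
       (\<integral>\<^sup>+\<omega>. \<integral>\<^sup>+\<eta>. W (graft x \<omega> \<eta>) hs * nxt (graft x \<omega> \<eta>) (hd hs) (\<lambda>y. \<Phi> (graft x \<omega> \<eta>) (y # hs)) \<partial>PN \<partial>P)"
      by (rule nn_integral_P_graft) measurable
    also have "\<dots> = (\<integral>\<^sup>+\<omega>. W \<omega> hs * (\<integral>\<^sup>+\<eta>. nxt (graft x \<omega> \<eta>) x (\<lambda>y. \<Phi> (graft x \<omega> \<eta>) (y # hs)) \<partial>PN) \<partial>P)"
    proof (rule nn_integral_cong)
      fix \<omega>
      have "(\<lambda>\<omega>. nxt \<omega> x (\<lambda>y. \<Phi> \<omega> (y # hs))) \<in> borel_measurable P" by measurable
      from graft_measurable[OF this, of x \<omega>]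
      show "(\<integral>\<^sup>+\<eta>. W (graft x \<omega> \<eta>) hs * nxt (graft x \<omega> \<eta>) (hd hs) (\<lambda>y. \<Phi> (graft x \<omega> \<eta>) (y # hs)) \<partial>PN) =
        W \<omega> hs * (\<integral>\<^sup>+\<eta>. nxt (graft x \<omega> \<eta>) x (\<lambda>y. \<Phi> (graft x \<omega> \<eta>) (y # hs)) \<partial>PN)"
        unfolding hs W_graft[OF False] by (simp add: nn_integral_cmult)
    qed
    also have "\<dots> \<le> (\<integral>\<^sup>+\<omega>. W \<omega> hs * \<Phi>' \<omega> hs \<partial>P)"
    proof (rule nn_integral_mono_AE)
      show "AE \<omega> in P. W \<omega> hs * (\<integral>\<^sup>+\<eta>. nxt (graft x \<omega> \<eta>) x (\<lambda>y. \<Phi> (graft x \<omega> \<eta>) (y # hs)) \<partial>PN) \<le> W \<omega> hs * \<Phi>' \<omega> hs"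
        using AE_ok
      proof eventually_elim
        case (elim \<omega>)
        then show ?case using new[of \<omega> x rest] False
          by (cases "W \<omega> hs = 0") (auto simp: hs intro: mult_left_mono)
      qed
    qed
    finally show ?thesis .
  qed
qed

section \<open>From annealed bounds to all walk laws in almost every environment\<close>

definition hist :: "(nat \<Rightarrow> nat list) \<Rightarrow> nat \<Rightarrow> nat list list" where
  "hist X t = map X (rev [0..<Suc t])"

lemma hist_0: "hist X 0 = [X 0]" by (simp add: hist_def)
lemma hist_Suc: "hist X (Suc t) = X (Suc t) # hist X t" by (simp add: hist_def)
lemma length_hist[simp]: "length (hist X t) = Suc t" by (simp add: hist_def)
lemma hist_neq_Nil[simp]: "hist X t \<noteq> []" by (simp add: hist_def)
lemma hd_hist[simp]: "hd (hist X t) = X t" by (simp add: hist_def)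

lemma W_hist: "ok \<omega> \<Longrightarrow> W \<omega> (hist xs t) =
   ennreal ((if xs 0 = [] then 1 else 0) * (\<Prod>i<t. trans_prob \<omega> (xs i) (xs (Suc i))))"
proof (induction t)
  case (Suc t)
  have "W \<omega> (hist xs (Suc t)) = W \<omega> (hist xs t) * ennreal (trans_prob \<omega> (xs t) (xs (Suc t)))"
    by (cases t) (simp_all add: hist_Suc hist_0)
  then show ?case using Suc
    by (simp add: ennreal_mult[symmetric] prod_nonneg trans_prob_nonneg mult.assoc)
qed (simp add: hist_0)

lemma walk_law_emeasure:
  assumes ok: "ok \<omega>" and Q: "walk_law \<omega> Q" and l: "length hs = Suc t"
  shows "emeasure Q {X \<in> space Q. hist X t = hs} = W \<omega> hs"
proof -
  interpret Q: prob_space Q using Q by (simp add: walk_law_def)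
  define xs where "xs i = rev hs ! i" for i
  have xs: "hist xs t = hs"
  proof -
    have "hist xs t = rev (map (\<lambda>i. rev hs ! i) [0..<length (rev hs)])"
      by (simp add: hist_def xs_def rev_map l)
    also have "\<dots> = hs" by (simp only: map_nth rev_rev_ident)
    finally show ?thesis .
  qed
  have "hist X t = hs \<longleftrightarrow> (\<forall>i\<le>t. X i = xs i)" for X
    unfolding xs[symmetric] by (auto simp: hist_def)
  then have "emeasure Q {X \<in> space Q. hist X t = hs} = ennreal (measure Q {X \<in> space Q. \<forall>i\<le>t. X i = xs i})"
    by (simp add: Q.emeasure_eq_measure)
  also have "\<dots> = W \<omega> (hist xs t)"
    using Q by (simp add: walk_law_def W_hist[OF ok])
  finally show ?thesis by (simp add: xs)
qed

lemma measurable_hist: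
  assumes Q: "walk_law \<omega> Q"
  shows "(\<lambda>X. hist X t) \<in> measurable Q (count_space UNIV)"
proof -
  have s: "sets Q = sets (\<Pi>\<^sub>M i\<in>(UNIV :: nat set). count_space (UNIV :: nat list set))"
    using Q by (simp add: walk_law_def)
  have X: "(\<lambda>X. X i) \<in> measurable Q (count_space UNIV)" for i
    unfolding measurable_cong_sets[OF s refl] by (rule measurable_component_singleton) simp
  show ?thesis
  proof (induction t)
    case 0
    have "(\<lambda>X. [X 0]) \<in> measurable Q (count_space UNIV)"
      by (rule measurable_compose[OF X]) simp
    then show ?case by (simp add: hist_0)
  next
    case (Suc t)
    have "(\<lambda>X. X (Suc t) # hist X t) \<in> measurable Q (count_space UNIV)"
      by (rule measurable_compose_countable[where g="\<lambda>X. X (Suc t)" and f="\<lambda>y X. y # hist X t", OF _ X])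
         (rule measurable_compose[OF Suc], simp)
    then show ?case by (simp add: hist_Suc)
  qed
qed

text \<open>The quenched probability \<open>q j \<omega>\<close> of the j-th event is a sum of
  weights and therefore the same for every law of the walk. Its sum over \<open>j\<close> has finite
  integral, hence is finite off one null set of environments chosen before \<open>Q\<close>; the
  usual Borel-Cantelli lemma then applies under each \<open>Q\<close>.\<close>

lemma quenched_Borel_Cantelli:
  assumes [measurable]: "\<And>j hs. Measurable.pred P (\<lambda>\<omega>. Ev j \<omega> hs)"
    and fin: "(\<Sum>j. annE (\<tau> j) (\<lambda>\<omega> hs. of_bool (Ev j \<omega> hs))) < \<infinity>"
  shows "AE \<omega> in P. \<forall>Q. walk_law \<omega> Q \<longrightarrow>
    (AE X in Q. eventually (\<lambda>j. \<not> Ev j \<omega> (hist X (\<tau> j))) sequentially)"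
proof -
  define q where "q j \<omega> = (\<integral>\<^sup>+hs. (if length hs = Suc (\<tau> j) then W \<omega> hs * of_bool (Ev j \<omega> hs) else 0) \<partial>count_space UNIV)" for j \<omega>
  have [measurable]: "(\<lambda>\<omega>. of_bool (Ev j \<omega> hs) :: ennreal) \<in> borel_measurable P" for j hs
    by (simp add: of_bool_def)
  have m: "q j \<in> borel_measurable P" for j
    unfolding q_def by (rule nn_integral_countable_measurable) measurable
  have "(\<integral>\<^sup>+\<omega>. q j \<omega> \<partial>P) = annE (\<tau> j) (\<lambda>\<omega> hs. of_bool (Ev j \<omega> hs))" for j
    unfolding q_def annE_def
    by (subst nn_integral_count_space_nn_integral) (auto intro!: nn_integral_cong)
  then have "(\<integral>\<^sup>+\<omega>. (\<Sum>j. q j \<omega>) \<partial>P) < \<infinity>"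
    using fin by (subst nn_integral_suminf) (use m in auto)
  then have "AE \<omega> in P. (\<Sum>j. q j \<omega>) \<noteq> \<infinity>"
    using m by (intro nn_integral_PInf_AE) auto
  with AE_ok show ?thesis
  proof eventually_elim
    case (elim \<omega>)
    show ?case
    proof (intro allI impI)
      fix Q assume Q: "walk_law \<omega> Q"
      then interpret Q: prob_space Q by (simp add: walk_law_def)
      define A where "A j = {X \<in> space Q. Ev j \<omega> (hist X (\<tau> j))}" for j
      have [measurable]: "(\<lambda>X. hist X t) \<in> measurable Q (count_space UNIV)" for t
        by (rule measurable_hist[OF Q])
      have A[measurable]: "A j \<in> sets Q" for j
        unfolding A_def by measurable
      have le: "emeasure Q (A j) \<le> q j \<omega>" for j
      proof -
        define B where "B hs = {X \<in> space Q. hist X (\<tau> j) = hs}" for hs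
        define H where "H = {hs. length hs = Suc (\<tau> j) \<and> Ev j \<omega> hs}"
        have B: "B hs \<in> sets Q" for hs unfolding B_def by measurable
        have "A j = (\<Union>hs\<in>H. B hs)" by (auto simp: A_def B_def H_def)
        then have "emeasure Q (A j) = (\<integral>\<^sup>+hs. emeasure Q (B hs) \<partial>count_space H)"
          using B by (simp add: emeasure_UN_countable disjoint_family_on_def) (auto simp: B_def intro!: emeasure_UN_countable simp: disjoint_family_on_def)
        also have "\<dots> = (\<integral>\<^sup>+hs. W \<omega> hs \<partial>count_space H)"
          by (rule nn_integral_cong) (simp add: B_def H_def walk_law_emeasure[OF elim(1) Q])
        also have "\<dots> = q j \<omega>"
          unfolding q_def H_def nn_integral_count_space_indicator[of "{hs. length hs = Suc (\<tau> j) \<and> Ev j \<omega> hs}"]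
          by (subst nn_integral_count_space_indicator) (auto intro!: nn_integral_cong simp: indicator_def)
        finally show ?thesis by simp
      qed
      have "(\<Sum>j. ennreal (measure Q (A j))) \<le> (\<Sum>j. q j \<omega>)"
        using le by (intro suminf_le) (auto simp: Q.emeasure_eq_measure)
      then have "summable (\<lambda>j. measure Q (A j))"
        using elim(2) by (intro summable_suminf_not_top) (auto simp: top_unique)
      then have "AE X in Q. eventually (\<lambda>j. X \<in> space Q - A j) sequentially"
        by (intro borel_cantelli_AE1) (auto simp: Q.emeasure_eq_measure)
      then show "AE X in Q. eventually (\<lambda>j. \<not> Ev j \<omega> (hist X (\<tau> j))) sequentially"
        by eventually_elim (auto simp: A_def elim!: eventually_mono)
    qed
  qed
qed

lemma AE_valid:
  "AE \<omega> in P. \<forall>Q. walk_law \<omega> Q \<longrightarrow> (AE X in Q. \<forall>t. W \<omega> (hist X t) \<noteq> 0)"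
  using AE_ok
proof eventually_elim
  case (elim \<omega>)
  show ?case
  proof (intro allI impI)
    fix Q assume Q: "walk_law \<omega> Q"
    have [measurable]: "(\<lambda>X. hist X t) \<in> measurable Q (count_space UNIV)" for t
      by (rule measurable_hist[OF Q])
    have "AE X in Q. W \<omega> (hist X t) \<noteq> 0" for t
    proof -
      have "AE X in Q. W \<omega> hs = 0 \<longrightarrow> hist X t \<noteq> hs" for hs
      proof (cases "W \<omega> hs = 0 \<and> length hs = Suc t")
        case True
        then have "emeasure Q {X \<in> space Q. hist X t = hs} = 0"
          using walk_law_emeasure[OF elim Q] by simp
        moreover have "{X \<in> space Q. hist X t = hs} \<in> sets Q" by measurable
        ultimately have "{X \<in> space Q. hist X t = hs} \<in> null_sets Q" by auto
        then show ?thesis by (rule AE_I'[where N="{X \<in> space Q. hist X t = hs}"]) auto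
      qed auto
      then have "AE X in Q. \<forall>hs. W \<omega> hs = 0 \<longrightarrow> hist X t \<noteq> hs"
        by (subst AE_all_countable) auto
      then show ?thesis by eventually_elim auto
    qed
    then show "AE X in Q. \<forall>t. W \<omega> (hist X t) \<noteq> 0"
      by (subst AE_all_countable) auto
  qed
qed

end

section \<open>Marks of revealed vertices\<close>

abbreviation heavy :: "nat \<Rightarrow> mark \<Rightarrow> real" where
  "heavy T \<equiv> \<lambda>z. if T < fst z then real (fst z) else 0"

text \<open>The vertices whose marks influence the walk up to its current position are the root and the
  children of all earlier positions. The children of the current position are not among them.\<close>

definition SF :: "(mark \<Rightarrow> 'b) \<Rightarrow> env \<Rightarrow> nat list list \<Rightarrow> 'b :: comm_monoid_add" where
  "SF f \<omega> hs = f (\<omega> []) + (\<Sum>v\<in>set (tl hs). \<Sum>j<nch \<omega> v. f (\<omega> (j # v)))"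

definition Rev :: "env \<Rightarrow> nat list list \<Rightarrow> nat list set" where
  "Rev \<omega> hs = insert [] (\<Union>v\<in>set (tl hs). (\<lambda>j. j # v) ` {..<nch \<omega> v})"

lemma finite_Rev[simp]: "finite (Rev \<omega> hs)"
  by (simp add: Rev_def)

lemma SF_Rev: "SF f \<omega> hs = (\<Sum>c\<in>Rev \<omega> hs. f (\<omega> c))"
proof -
  have "(\<Sum>c\<in>(\<Union>v\<in>set (tl hs). (\<lambda>j. j # v) ` {..<nch \<omega> v}). f (\<omega> c)) =
     (\<Sum>v\<in>set (tl hs). \<Sum>c\<in>(\<lambda>j. j # v) ` {..<nch \<omega> v}. f (\<omega> c))"
    by (rule sum.UNION_disjoint) auto
  also have "\<dots> = (\<Sum>v\<in>set (tl hs). \<Sum>j<nch \<omega> v. f (\<omega> (j # v)))"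
    by (intro sum.cong refl) (simp add: sum.reindex inj_on_def)
  finally show ?thesis
    unfolding Rev_def SF_def by (subst sum.insert) auto
qed

lemma SF_ennreal: "(\<And>z. 0 \<le> g z) \<Longrightarrow> SF (\<lambda>z. ennreal (g z)) \<omega> hs = ennreal (SF g \<omega> hs)"
  unfolding SF_Rev by (simp add: sum_ennreal)

lemma SF_Cons: "SF f \<omega> (y # x # rest) =
  SF f \<omega> (x # rest) + (if x \<in> set rest then 0 else \<Sum>j<nch \<omega> x. f (\<omega> (j # x)))"
  by (auto simp: SF_def insert_absorb ac_simps)

lemma W_tl_closed_tl: "W \<omega> hs \<noteq> 0 \<Longrightarrow> tl_closed (tl hs)"
  using W_prefix[of \<omega> "hd hs" "tl hs"] W_tl_closed
  by (cases hs; cases "tl hs = []") (auto simp: tl_closed_def)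

lemma SF_graft:
  assumes "x \<notin> set rest" "W \<omega> (x # rest) \<noteq> 0"
  shows "SF f (graft x \<omega> \<eta>) (x # rest) = SF f \<omega> (x # rest)"
proof -
  have "tl_closed rest" using W_tl_closed_tl[OF assms(2)] by simp
  then have tl: "tl v \<noteq> x" if "v \<in> set rest" for v using that assms by (auto simp: tl_closed_def)
  have "(\<Sum>j<nch (graft x \<omega> \<eta>) v. f (graft x \<omega> \<eta> (j # v))) = (\<Sum>j<nch \<omega> v. f (\<omega> (j # v)))"
    if "v \<in> set rest" for v
  proof -
    have v: "v \<noteq> x" using that assms(1) by blast
    have "nch (graft x \<omega> \<eta>) v = nch \<omega> v" using tl[OF that] by (simp add: nch_graft)
    moreover have "graft x \<omega> \<eta> (j # v) = \<omega> (j # v)" for j using v by (simp add: graft_other)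
    ultimately show ?thesis by simp
  qed
  then show ?thesis by (simp add: SF_def graft_def)
qed

lemma nch_graft_self[simp]: "nch (graft x \<omega> \<eta>) x = nch \<omega> x"
  by (cases "x = []") (simp_all add: nch_def graft_def)

lemma SF_graft_Cons:
  assumes "x \<notin> set rest" "W \<omega> (x # rest) \<noteq> 0"
  shows "SF f (graft x \<omega> \<eta>) (y # x # rest) = SF f \<omega> (x # rest) + (\<Sum>j<nch \<omega> x. f (\<eta> j))"
  using assms by (simp add: SF_Cons SF_graft)

text \<open>A step down leads to a child of an earlier position; a step up leads, by closure under
  parents, to a vertex that was already visited.\<close>

lemma W_subset_Rev: "W \<omega> hs \<noteq> 0 \<Longrightarrow> set hs \<subseteq> Rev \<omega> hs"
proof (induction \<omega> hs rule: W.induct)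
  case (3 \<omega> y x hs)
  then have IH: "set (x # hs) \<subseteq> Rev \<omega> (x # hs)" and cl: "tl_closed (x # hs)"
    using W_tl_closed by auto
  have "Rev \<omega> (x # hs) \<subseteq> Rev \<omega> (y # x # hs)" by (auto simp: Rev_def)
  moreover have "y \<in> Rev \<omega> (y # x # hs)"
  proof -
    consider "y = tl x" | j where "j < nch \<omega> x" "y = j # x" using nbrs_tl[OF W_step[OF 3(2)]] by auto
    then show ?thesis
    proof cases
      case 1
      then have "y \<in> set (x # hs)" using cl by (auto simp: tl_closed_def)
      then show ?thesis using IH \<open>Rev \<omega> (x # hs) \<subseteq> Rev \<omega> (y # x # hs)\<close> by blast
    qed (auto simp: Rev_def)
  qed
  ultimately show ?case using IH by auto
qed (auto simp: Rev_def split: if_splits)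

lemma SF_visited:
  fixes f :: "mark \<Rightarrow> 'b :: ordered_comm_monoid_add"
  assumes "W \<omega> hs \<noteq> 0" "\<And>z. 0 \<le> f z" "A \<subseteq> set hs"
  shows "(\<Sum>v\<in>A. f (\<omega> v)) \<le> SF f \<omega> hs"
  unfolding SF_Rev by (rule sum_mono2) (use W_subset_Rev[OF assms(1)] assms in auto)

section \<open>Dyadic sums and small tails for the law of large numbers\<close>

lemma sum_pow2_below:
  fixes x :: real assumes "0 \<le> x"
  shows "(\<Sum>j<n. if 2 ^ j < x then 2 ^ j else 0) \<le> 2 * x"
proof (induction n)
  case (Suc n)
  show ?case
  proof (cases "2 ^ n < x")
    case True
    have "(\<Sum>j<Suc n. if 2 ^ j < x then 2 ^ j else 0) \<le> (\<Sum>j<Suc n. 2 ^ j :: real)"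
      by (intro sum_mono) auto
    also have "\<dots> = 2 ^ Suc n - 1" by (subst geometric_sum) auto
    finally show ?thesis using True by simp
  qed (use Suc in simp)
qed (use assms in simp)

lemma sum_pow2_above:
  fixes x :: real assumes "0 \<le> x"
  shows "(\<Sum>j<n. if x \<le> 2 ^ j then x\<^sup>2 / 2 ^ j else 0) \<le> 2 * x"
proof -
  \<comment> \<open>The induction needs the stronger bound that leaves room for the remaining
    geometric tail: once \<open>x \<le> 2 ^ n\<close>, the terms from \<open>n\<close> on add up to
    \<open>2 * x\<^sup>2 / 2 ^ n\<close>. Before that the sum is empty, whence the maximum with
    0.\<close>
  have "(\<Sum>j<n. if x \<le> 2 ^ j then x\<^sup>2 / 2 ^ j else 0) \<le> max 0 (2 * x - 2 * x\<^sup>2 / 2 ^ n)"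
  proof (induction n)
    case (Suc n)
    have le: "x \<le> 2 ^ n \<longleftrightarrow> 2 * x\<^sup>2 / 2 ^ n \<le> 2 * x" if "x > 0"
      using that by (simp add: field_simps power2_eq_square)
    show ?case
    proof (cases "x \<le> 2 ^ n")
      case True
      then have "0 \<le> 2 * x - 2 * x\<^sup>2 / 2 ^ n" using le assms by (cases "x = 0") auto
      with Suc have "(\<Sum>j<n. if x \<le> 2 ^ j then x\<^sup>2 / 2 ^ j else 0) \<le> 2 * x - 2 * x\<^sup>2 / 2 ^ n" by simp
      moreover have "2 * x\<^sup>2 / 2 ^ Suc n = x\<^sup>2 / 2 ^ n" "2 * x\<^sup>2 / 2 ^ n = x\<^sup>2 / 2 ^ n + x\<^sup>2 / 2 ^ n" by simp_all
      ultimately have "(\<Sum>j<Suc n. if x \<le> 2 ^ j then x\<^sup>2 / 2 ^ j else 0) \<le> 2 * x - 2 * x\<^sup>2 / 2 ^ Suc n"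
        using True by (simp only: sum.lessThan_Suc if_True)
      then show ?thesis by (rule order_trans) (rule max.cobounded2)
    next
      case False
      then have "x > 0" using less_le_trans[of 0 "2 ^ n" x] by simp
      with False le have "2 * x - 2 * x\<^sup>2 / 2 ^ n \<le> 0" by simp
      with Suc False show ?thesis by simp
    qed
  qed (use assms in simp)
  also have "\<dots> \<le> 2 * x" using assms by simp
  finally show ?thesis .
qed

lemma suminf_ennreal_bound:
  fixes f :: "nat \<Rightarrow> real"
  assumes "\<And>j. 0 \<le> f j" "\<And>n. sum f {..<n} \<le> c"
  shows "(\<Sum>j. ennreal (f j)) \<le> ennreal c"
proof -
  have "sum (\<lambda>j. ennreal (f j)) {..<n} \<le> ennreal c" for n
    using assms by (simp add: sum_ennreal ennreal_leI)
  then show ?thesis by (intro suminf_le_const) auto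
qed

lemma nn_integral_tail_small:
  fixes f :: "'a \<Rightarrow> ennreal"
  assumes [measurable]: "f \<in> borel_measurable M" "\<And>n::nat. Measurable.pred M (A n)"
    and fin: "(\<integral>\<^sup>+x. f x \<partial>M) < \<infinity>" and "0 < e"
    and ev: "\<And>x. x \<in> space M \<Longrightarrow> eventually (\<lambda>n. \<not> A n x) sequentially"
  shows "eventually (\<lambda>n. (\<integral>\<^sup>+x. (if A n x then f x else 0) \<partial>M) < e) sequentially"
proof -
  have "(\<lambda>n. \<integral>\<^sup>+x. (if A n x then f x else 0) \<partial>M) \<longlonglongrightarrow> (\<integral>\<^sup>+x. 0 \<partial>M)"
  proof (rule nn_integral_dominated_convergence[where w=f])
    show "AE x in M. (\<lambda>n. if A n x then f x else 0) \<longlonglongrightarrow> 0"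
    proof (rule AE_I2)
      fix x assume "x \<in> space M"
      from ev[OF this] show "(\<lambda>n. if A n x then f x else 0) \<longlonglongrightarrow> 0"
        by (rule tendsto_eventually[OF eventually_mono]) simp
    qed
  qed (use fin in auto)
  then show ?thesis using \<open>0 < e\<close> by (simp add: order_tendstoD)
qed

context gw_env
begin

lemma annE_Suc_const:
  assumes [measurable]: "\<And>hs. (\<lambda>\<omega>. \<Phi> \<omega> hs) \<in> borel_measurable P"
    and eq: "\<And>\<omega> y x rest. \<Phi> \<omega> (y # x # rest) = \<Phi>' \<omega> (x # rest)"
  shows "annE (Suc t) \<Phi> = annE t \<Phi>'"
  unfolding annE_Suc[OF assms(1)] unfolding annE_def
proof (intro nn_integral_cong, clarsimp)
  fix hs :: "nat list list" assume l: "length hs = Suc t"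
  then obtain x rest where hs: "hs = x # rest" by (cases hs) auto
  show "(\<integral>\<^sup>+\<omega>. W \<omega> hs * nxt \<omega> (hd hs) (\<lambda>y. \<Phi> \<omega> (y # hs)) \<partial>P) = (\<integral>\<^sup>+\<omega>. W \<omega> hs * \<Phi>' \<omega> hs \<partial>P)"
  proof (rule nn_integral_cong_AE)
    show "AE \<omega> in P. W \<omega> hs * nxt \<omega> (hd hs) (\<lambda>y. \<Phi> \<omega> (y # hs)) = W \<omega> hs * \<Phi>' \<omega> hs"
      using AE_ok by eventually_elim (simp add: hs eq nxt_const)
  qed
qed

lemma annE_const: "annE t (\<lambda>_ _. c) = c"
proof (induction t)
  case 0
  then show ?case by (simp add: annE_0 env.emeasure_space_1[simplified])
next
  case (Suc t)
  have "annE (Suc t) (\<lambda>_ _. c) = annE t (\<lambda>_ _. c)" by (rule annE_Suc_const) auto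
  then show ?case using Suc by simp
qed

lemma measurable_SF[measurable (raw)]:
  fixes f :: "mark \<Rightarrow> 'b :: {second_countable_topology, topological_comm_monoid_add}"
  assumes [measurable]: "f \<in> borel_measurable MV"
  shows "(\<lambda>\<omega>. SF f \<omega> hs) \<in> borel_measurable P"
  unfolding SF_def by (intro borel_measurable_add borel_measurable_sum measurable_sum_lessThan) measurable

section \<open>The expected number of revealed vertices grows at most linearly\<close>

definition inc :: "env \<Rightarrow> nat list list \<Rightarrow> ennreal" where
  "inc \<omega> hs = (if hd hs \<in> set (tl hs) then 0 else of_nat (nch \<omega> (hd hs)))"

lemma measurable_inc[measurable]: "(\<lambda>\<omega>. inc \<omega> hs) \<in> borel_measurable P"
  unfolding inc_def by measurable

definition \<rho> :: "nat \<Rightarrow> ennreal" where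
  "\<rho> t = annE t (SF (\<lambda>_. 1))"

lemma rho_0: "\<rho> 0 = 1"
  by (simp add: \<rho>_def annE_0 SF_def env.emeasure_space_1[simplified])

lemma rho_Suc: "\<rho> (Suc t) = \<rho> t + annE t inc"
proof -
  have "\<rho> (Suc t) = annE t (\<lambda>\<omega> hs. SF (\<lambda>_. 1) \<omega> hs + inc \<omega> hs)"
    unfolding \<rho>_def by (rule annE_Suc_const) (auto simp: SF_Cons inc_def)
  then show ?thesis by (simp add: annE_add \<rho>_def)
qed

text \<open>An inequality of Wald type: whether and how many marks are revealed at a step is decided
  by the past, of which the new marks are independent. So each contributes the mean of
  \<open>f\<close>.\<close>

lemma annE_SF_le:
  fixes f :: "mark \<Rightarrow> ennreal"
  assumes [measurable]: "f \<in> borel_measurable MV"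
  shows "annE t (SF f) \<le> (\<integral>\<^sup>+z. f z \<partial>MV) * \<rho> t"
proof (induction t)
  case 0
  have "annE 0 (SF f) = (\<integral>\<^sup>+\<omega>. SF f \<omega> [[]] \<partial>P)" by (rule annE_0) measurable
  also have "\<dots> = (\<integral>\<^sup>+z. f z \<partial>MV)"
    using nn_integral_PiM_component[OF prob_space_MV assms, of "[] :: nat list"]
    by (simp add: SF_def P_def)
  finally show ?case by (simp add: rho_0)
next
  case (Suc t)
  let ?c = "\<integral>\<^sup>+z. f z \<partial>MV"
  have int: "(\<integral>\<^sup>+\<eta>. f (\<eta> j) \<partial>PN) = ?c" for j
    unfolding PN_def by (rule nn_integral_PiM_component[OF prob_space_MV assms])
  have "annE (Suc t) (SF f) \<le> annE t (\<lambda>\<omega> hs. SF f \<omega> hs + ?c * inc \<omega> hs)"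
  proof (rule annE_step)
    fix \<omega> x rest assume *: "ok \<omega>" "W \<omega> (x # rest) \<noteq> 0" "x \<notin> set rest"
    have "(\<integral>\<^sup>+\<eta>. nxt (graft x \<omega> \<eta>) x (\<lambda>y. SF f (graft x \<omega> \<eta>) (y # x # rest)) \<partial>PN) =
        (\<integral>\<^sup>+\<eta>. SF f \<omega> (x # rest) + (\<Sum>j<nch \<omega> x. f (\<eta> j)) \<partial>PN)"
      unfolding SF_graft_Cons[OF *(3,2)]
      by (intro nn_integral_cong_AE, use AE_okm_PN in eventually_elim)
         (simp add: nxt_const ok_graft *)
    also have "\<dots> = SF f \<omega> (x # rest) + ?c * of_nat (nch \<omega> x)"
      by (simp add: nn_integral_add nn_integral_sum int PN.emeasure_space_1[simplified] mult.commute)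
    finally show "(\<integral>\<^sup>+\<eta>. nxt (graft x \<omega> \<eta>) x (\<lambda>y. SF f (graft x \<omega> \<eta>) (y # x # rest)) \<partial>PN) \<le>
        SF f \<omega> (x # rest) + ?c * inc \<omega> (x # rest)"
      using *(3) by (simp add: inc_def)
  qed (auto simp: SF_Cons nxt_const inc_def)
  also have "\<dots> = annE t (SF f) + ?c * annE t inc"
    by (simp add: annE_add annE_cmult)
  also have "\<dots> \<le> ?c * \<rho> t + ?c * annE t inc"
    using Suc by (rule add_right_mono)
  finally show ?case by (simp add: rho_Suc distrib_left)
qed

lemma nn_integral_MV_fst: "(\<integral>\<^sup>+z. f (fst z) \<partial>MV) = (\<integral>\<^sup>+N. f N \<partial>measure_pmf p)"
proof -
  interpret B: prob_space "\<Pi>\<^sub>M km\<in>UNIV. cond_law \<mu>t km"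
    by (rule prob_space_PiM) (rule prob_space_cond_law)
  have "(\<integral>\<^sup>+z. f (fst z) \<partial>MV) = (\<integral>\<^sup>+N. \<integral>\<^sup>+\<xi>. f (fst (N, \<xi>)) \<partial>(\<Pi>\<^sub>M km\<in>UNIV. cond_law \<mu>t km) \<partial>measure_pmf p)"
    unfolding MV_def by (rule B.nn_integral_fst[symmetric]) measurable
  also have "\<dots> = (\<integral>\<^sup>+N. f N \<partial>measure_pmf p)"
    by (simp add: B.emeasure_space_1)
  finally show ?thesis .
qed

lemma mean_finite: "(\<integral>\<^sup>+z. ennreal (real (fst z)) \<partial>MV) < \<infinity>"
proof -
  have "(\<integral>\<^sup>+z. ennreal (real (fst z)) \<partial>MV) = (\<integral>\<^sup>+N. ennreal (real N) \<partial>measure_pmf p)"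
    by (rule nn_integral_MV_fst)
  also have "\<dots> = (\<Sum>j. ennreal (real j * pmf p j))"
    by (simp add: nn_integral_measure_pmf nn_integral_count_space_nat ennreal_mult mult.commute)
  also have "\<dots> = ennreal (\<Sum>j. real j * pmf p j)"
    by (rule suminf_ennreal2[OF _ mean_fin]) simp
  finally show ?thesis by simp
qed

text \<open>The number of vertices revealed next is at most one more than the index of the current
  position, whose own mark is already revealed; its expectation is controlled by the Wald bound.
  Finiteness is what allows \<open>\<rho> t\<close> to be absorbed in the linear bound
  below.\<close>

lemma rho_finite: "\<rho> t < \<infinity>"
proof (induction t)
  case (Suc t)
  have "annE t inc \<le> annE t (\<lambda>\<omega> hs. 1 + SF (\<lambda>z. ennreal (real (fst z))) \<omega> hs)"
  proof (rule annE_cong_mono)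
    fix \<omega> hs assume *: "W \<omega> hs \<noteq> 0" "length hs = Suc t"
    then have "hd hs \<in> set hs" by (cases hs) auto
    then have "ennreal (real (fst (\<omega> (hd hs)))) \<le> SF (\<lambda>z. ennreal (real (fst z))) \<omega> hs"
      using SF_visited[OF *(1), of "\<lambda>z. ennreal (real (fst z))" "{hd hs}"] by simp
    moreover have "inc \<omega> hs \<le> 1 + ennreal (real (fst (\<omega> (hd hs))))"
      by (auto simp: inc_def nch_def ennreal_of_nat_eq_real_of_nat)
    ultimately show "inc \<omega> hs \<le> 1 + SF (\<lambda>z. ennreal (real (fst z))) \<omega> hs"
      by (meson add_left_mono order_trans)
  qed
  also have "\<dots> = 1 + annE t (SF (\<lambda>z. ennreal (real (fst z))))"
    by (simp add: annE_add annE_const)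
  also have "\<dots> < \<infinity>"
    using le_less_trans[OF annE_SF_le[of "\<lambda>z. ennreal (real (fst z))" t]] mean_finite Suc
    by (auto simp: ennreal_mult_less_top)
  finally show ?case using Suc by (simp add: rho_Suc)
qed (simp add: rho_0)

text \<open>Each of the at most \<open>t\<close> vertices in \<open>tl hs\<close> has at most
  \<open>T\<close> children or is charged its own index. The constant 2 accounts for the root and
  for its additional child.\<close>

lemma SF_one_le:
  assumes "W \<omega> hs \<noteq> 0" "length hs = Suc t"
  shows "SF (\<lambda>_. 1 :: real) \<omega> hs \<le> 2 + real T * real t + SF (heavy T) \<omega> hs"
proof -
  have "(\<Sum>v\<in>set (tl hs). real (nch \<omega> v)) \<le>
     (\<Sum>v\<in>set (tl hs). (if v = [] then 1 else 0) + real T + (if T < fst (\<omega> v) then real (fst (\<omega> v)) else 0))"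
    by (rule sum_mono) (auto simp: nch_def)
  also have "\<dots> = (\<Sum>v\<in>set (tl hs). if v = [] then 1 else 0) + real T * real (card (set (tl hs))) +
      (\<Sum>v\<in>set (tl hs). if T < fst (\<omega> v) then real (fst (\<omega> v)) else 0)"
    by (simp add: sum.distrib)
  also have "\<dots> \<le> 1 + real T * real t + SF (heavy T) \<omega> hs"
  proof (intro add_mono mult_left_mono)
    show "(\<Sum>v\<in>set (tl hs). if v = [] then 1 else 0 :: real) \<le> 1" by simp
    show "real (card (set (tl hs))) \<le> real t"
      using card_length[of "tl hs"] assms(2) by simp
    show "(\<Sum>v\<in>set (tl hs). if T < fst (\<omega> v) then real (fst (\<omega> v)) else 0) \<le>
        SF (heavy T) \<omega> hs"
      by (rule SF_visited[OF assms(1), of "heavy T"])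
         (cases hs; auto)+
  qed simp
  finally show ?thesis by (simp add: SF_def)
qed

lemma tail_mean_small:
  assumes "0 < (e :: ennreal)"
  shows "eventually (\<lambda>T. (\<integral>\<^sup>+z. ennreal (heavy T z) \<partial>MV) < e) sequentially"
proof -
  have "eventually (\<lambda>T. (\<integral>\<^sup>+z. (if T < fst z then ennreal (real (fst z)) else 0) \<partial>MV) < e) sequentially"
  proof (rule nn_integral_tail_small[OF _ _ mean_finite assms])
    show "eventually (\<lambda>T. \<not> T < fst z) sequentially" for z :: mark
      using eventually_ge_at_top[of "fst z"] by (rule eventually_mono) simp
  qed auto
  then show ?thesis by (simp add: if_distrib cong: if_cong)
qed

text \<open>A bootstrap: \<open>T\<close> is chosen so that heavy marks have mean below 1/2. By the
  Wald bound they then account for at most \<open>\<rho> t / 2\<close> of the revealed vertices, and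
  this half is moved to the left-hand side.\<close>

lemma rho_linear: "\<exists>C. 0 \<le> C \<and> (\<forall>t. \<rho> t \<le> ennreal (C * real (Suc t)))"
proof -
  obtain T where T: "(\<integral>\<^sup>+z. ennreal (heavy T z) \<partial>MV) < ennreal (1/2)"
    using eventually_happens[OF tail_mean_small[of "ennreal (1/2)"]]
    by (auto simp: ennreal_less_zero_iff simp del: ennreal_half)
  define f where "f z = heavy T z" for z :: mark
  have [measurable]: "f \<in> borel_measurable MV" unfolding f_def by measurable
  have "\<rho> t \<le> ennreal (2 * (2 + real T * real t))" for t
  proof -
    have "\<rho> t \<le> annE t (\<lambda>\<omega> hs. ennreal (2 + real T * real t) + SF (\<lambda>z. ennreal (f z)) \<omega> hs)"
      unfolding \<rho>_def
    proof (rule annE_cong_mono)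
      fix \<omega> hs assume *: "W \<omega> hs \<noteq> 0" "length hs = Suc t"
      have "SF (\<lambda>_. 1) \<omega> hs = ennreal (SF (\<lambda>_. 1) \<omega> hs)" using SF_ennreal[of "\<lambda>_. 1" \<omega> hs] by simp
      also have "\<dots> \<le> ennreal (2 + real T * real t + SF f \<omega> hs)"
        using SF_one_le[OF *, of T] by (intro ennreal_leI) (simp add: f_def[abs_def])
      also have "\<dots> = ennreal (2 + real T * real t) + ennreal (SF f \<omega> hs)"
        by (rule ennreal_plus) (auto simp: SF_Rev f_def intro!: sum_nonneg)
      finally show "SF (\<lambda>_. 1) \<omega> hs \<le> ennreal (2 + real T * real t) + SF (\<lambda>z. ennreal (f z)) \<omega> hs"
        by (subst SF_ennreal) (auto simp: f_def)
    qed
    also have "\<dots> = ennreal (2 + real T * real t) + annE t (SF (\<lambda>z. ennreal (f z)))"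
      by (simp add: annE_add annE_const)
    also have "\<dots> \<le> ennreal (2 + real T * real t) + ennreal (1/2) * \<rho> t"
    proof (rule add_left_mono)
      have "annE t (SF (\<lambda>z. ennreal (f z))) \<le> (\<integral>\<^sup>+z. ennreal (f z) \<partial>MV) * \<rho> t"
        by (rule annE_SF_le) measurable
      also have "\<dots> \<le> ennreal (1/2) * \<rho> t"
        using T unfolding f_def by (intro mult_right_mono) auto
      finally show "annE t (SF (\<lambda>z. ennreal (f z))) \<le> ennreal (1/2) * \<rho> t" .
    qed
    finally have le: "\<rho> t \<le> ennreal (2 + real T * real t) + ennreal (1/2) * \<rho> t" .
    obtain r where r: "\<rho> t = ennreal r" "0 \<le> r" using rho_finite[of t] by (cases "\<rho> t") auto
    have "ennreal (1/2) * ennreal r = ennreal (1/2 * r)"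
      by (rule ennreal_mult[symmetric]) (use r in auto)
    moreover have "ennreal (2 + real T * real t) + ennreal (1/2 * r) = ennreal (2 + real T * real t + 1/2 * r)"
      by (rule ennreal_plus[symmetric]) (use r in auto)
    ultimately have "ennreal r \<le> ennreal (2 + real T * real t + 1/2 * r)"
      using le r by (simp only:)
    then have "r \<le> 2 + real T * real t + 1 / 2 * r"
      using r by (subst (asm) ennreal_le_iff) auto
    then have "r \<le> 2 * (2 + real T * real t)" by simp
    then show ?thesis unfolding r(1) by (rule ennreal_leI)
  qed
  then have "\<rho> t \<le> ennreal ((4 + 2 * real T) * real (Suc t))" for t
    by (rule order_trans) (rule ennreal_leI, simp add: algebra_simps)
  then show ?thesis by (intro exI[of _ "4 + 2 * real T"]) auto
qed

end

section \<open>Second moments and a law of large numbers for revealed marks\<close>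

context gw_env
begin

lemma single_second_moment:
  fixes Y :: "mark \<Rightarrow> real"
  assumes [measurable]: "Y \<in> borel_measurable MV" and bd: "\<And>z. \<bar>Y z\<bar> \<le> B"
  shows "(\<integral>\<^sup>+z. ennreal ((c + (Y z - (\<integral>z. Y z \<partial>MV)))\<^sup>2) \<partial>MV) \<le> ennreal (c\<^sup>2) + (\<integral>\<^sup>+z. ennreal ((Y z)\<^sup>2) \<partial>MV)"
proof -
  define m where "m = (\<integral>z. Y z \<partial>MV)"
  have iY: "integrable MV Y"
    by (rule MV.integrable_const_bound[of _ B]) (use bd in auto)
  have iY2: "integrable MV (\<lambda>z. (Y z)\<^sup>2)"
  proof (rule MV.integrable_const_bound[of _ "B\<^sup>2"])
    show "AE z in MV. norm ((Y z)\<^sup>2) \<le> B\<^sup>2"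
      using power_mono[OF bd abs_ge_zero, of _ 2] by simp
  qed measurable
  have eq: "(c + (Y z - m))\<^sup>2 = (c - m)\<^sup>2 + 2 * (c - m) * Y z + (Y z)\<^sup>2" for z
    by (simp add: power2_eq_square algebra_simps)
  have i: "integrable MV (\<lambda>z. (c + (Y z - m))\<^sup>2)"
    unfolding eq by (intro Bochner_Integration.integrable_add integrable_mult_right iY iY2) simp
  have "(\<integral>z. (c + (Y z - m))\<^sup>2 \<partial>MV) = (c - m)\<^sup>2 + 2 * (c - m) * m + (\<integral>z. (Y z)\<^sup>2 \<partial>MV)"
    unfolding eq using iY iY2 by (simp add: m_def MV.prob_space[simplified])
  also have "\<dots> \<le> c\<^sup>2 + (\<integral>z. (Y z)\<^sup>2 \<partial>MV)"
    by (simp add: power2_eq_square algebra_simps)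
  finally have le: "(\<integral>z. (c + (Y z - m))\<^sup>2 \<partial>MV) \<le> c\<^sup>2 + (\<integral>z. (Y z)\<^sup>2 \<partial>MV)" .
  have "(\<integral>\<^sup>+z. ennreal ((c + (Y z - m))\<^sup>2) \<partial>MV) = ennreal (\<integral>z. (c + (Y z - m))\<^sup>2 \<partial>MV)"
    by (rule nn_integral_eq_integral[OF i]) simp
  also have "\<dots> \<le> ennreal (c\<^sup>2 + (\<integral>z. (Y z)\<^sup>2 \<partial>MV))"
    by (rule ennreal_leI[OF le])
  also have "\<dots> = ennreal (c\<^sup>2) + ennreal (\<integral>z. (Y z)\<^sup>2 \<partial>MV)"
    by (rule ennreal_plus) auto
  also have "ennreal (\<integral>z. (Y z)\<^sup>2 \<partial>MV) = (\<integral>\<^sup>+z. ennreal ((Y z)\<^sup>2) \<partial>MV)"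
    by (rule nn_integral_eq_integral[OF iY2, symmetric]) simp
  finally show ?thesis by (simp add: m_def)
qed

lemma batch_second_moment:
  fixes Y :: "mark \<Rightarrow> real"
  assumes [measurable]: "Y \<in> borel_measurable MV" and bd: "\<And>z. \<bar>Y z\<bar> \<le> B"
  defines "Z \<equiv> \<lambda>z. Y z - (\<integral>z. Y z \<partial>MV)"
  shows "(\<integral>\<^sup>+\<eta>. ennreal ((c + (\<Sum>j<b. Z (\<eta> j)))\<^sup>2) \<partial>PN) \<le> ennreal (c\<^sup>2) + of_nat b * (\<integral>\<^sup>+z. ennreal ((Y z)\<^sup>2) \<partial>MV)"
proof (induction b)
  case 0
  then show ?case by (simp add: PN.emeasure_space_1[simplified])
next
  case (Suc b)
  let ?v = "\<integral>\<^sup>+z. ennreal ((Y z)\<^sup>2) \<partial>MV"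
  have [measurable]: "Z \<in> borel_measurable MV" unfolding Z_def by measurable
  have m: "(\<lambda>\<eta>. ennreal ((c + (\<Sum>j<Suc b. Z (\<eta> j)))\<^sup>2)) \<in> borel_measurable (PiM UNIV (\<lambda>_::nat. MV))"
    unfolding PN_def[symmetric] by measurable
  have "(\<integral>\<^sup>+\<eta>. ennreal ((c + (\<Sum>j<Suc b. Z (\<eta> j)))\<^sup>2) \<partial>PN) =
     (\<integral>\<^sup>+\<eta>. \<integral>\<^sup>+z. ennreal (((c + (\<Sum>j<b. Z (\<eta> j))) + Z z)\<^sup>2) \<partial>MV \<partial>PN)"
    unfolding PN_def nn_integral_PiM_upd[OF prob_space_MV m, of b] by (simp add: add.assoc)
  also have "\<dots> \<le> (\<integral>\<^sup>+\<eta>. ennreal ((c + (\<Sum>j<b. Z (\<eta> j)))\<^sup>2) + ?v \<partial>PN)"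
    unfolding Z_def by (intro nn_integral_mono single_second_moment[OF assms(1) bd])
  also have "\<dots> = (\<integral>\<^sup>+\<eta>. ennreal ((c + (\<Sum>j<b. Z (\<eta> j)))\<^sup>2) \<partial>PN) + ?v"
    by (subst nn_integral_add) (auto simp: PN.emeasure_space_1[simplified])
  also have "\<dots> \<le> ennreal (c\<^sup>2) + of_nat b * ?v + ?v"
    using Suc by (rule add_right_mono)
  finally show ?case by (simp add: distrib_right ac_simps)
qed

text \<open>Orthogonality of martingale increments: given the past, newly revealed centred marks
  have mean zero, so the cross terms vanish and second moments add. Boundedness of \<open>Y\<close>
  only serves integrability, and its second moment stands in for the variance.\<close>

lemma annE_second_moment:
  fixes Y :: "mark \<Rightarrow> real"
  assumes [measurable]: "Y \<in> borel_measurable MV" and bd: "\<And>z. \<bar>Y z\<bar> \<le> B"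
  defines "Z \<equiv> \<lambda>z. Y z - (\<integral>z. Y z \<partial>MV)"
  shows "annE t (\<lambda>\<omega> hs. ennreal ((SF Z \<omega> hs)\<^sup>2)) \<le> (\<integral>\<^sup>+z. ennreal ((Y z)\<^sup>2) \<partial>MV) * \<rho> t"
proof (induction t)
  let ?v = "\<integral>\<^sup>+z. ennreal ((Y z)\<^sup>2) \<partial>MV"
  have [measurable]: "Z \<in> borel_measurable MV" unfolding Z_def by measurable
  case 0
  have "annE 0 (\<lambda>\<omega> hs. ennreal ((SF Z \<omega> hs)\<^sup>2)) = (\<integral>\<^sup>+\<omega>. ennreal ((SF Z \<omega> [[]])\<^sup>2) \<partial>P)" by (rule annE_0) measurable
  also have "\<dots> = (\<integral>\<^sup>+z. ennreal ((Z z)\<^sup>2) \<partial>MV)"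
    using nn_integral_PiM_component[OF prob_space_MV, of "\<lambda>z. ennreal ((Z z)\<^sup>2)" "[] :: nat list"]
    by (simp add: SF_def P_def)
  also have "\<dots> \<le> ?v"
    using single_second_moment[OF assms(1) bd, of 0] by (simp add: Z_def)
  finally show ?case by (simp add: rho_0)
next
  let ?v = "\<integral>\<^sup>+z. ennreal ((Y z)\<^sup>2) \<partial>MV"
  have [measurable]: "Z \<in> borel_measurable MV" unfolding Z_def by measurable
  case (Suc t)
  have "annE (Suc t) (\<lambda>\<omega> hs. ennreal ((SF Z \<omega> hs)\<^sup>2)) \<le>
      annE t (\<lambda>\<omega> hs. ennreal ((SF Z \<omega> hs)\<^sup>2) + ?v * inc \<omega> hs)"
  proof (rule annE_step)
    fix \<omega> x rest assume *: "ok \<omega>" "W \<omega> (x # rest) \<noteq> 0" "x \<notin> set rest"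
    have "(\<integral>\<^sup>+\<eta>. nxt (graft x \<omega> \<eta>) x (\<lambda>y. ennreal ((SF Z (graft x \<omega> \<eta>) (y # x # rest))\<^sup>2)) \<partial>PN) =
        (\<integral>\<^sup>+\<eta>. ennreal ((SF Z \<omega> (x # rest) + (\<Sum>j<nch \<omega> x. Z (\<eta> j)))\<^sup>2) \<partial>PN)"
      unfolding SF_graft_Cons[OF *(3,2)]
      by (intro nn_integral_cong_AE, use AE_okm_PN in eventually_elim)
         (simp add: nxt_const ok_graft *)
    also have "\<dots> \<le> ennreal ((SF Z \<omega> (x # rest))\<^sup>2) + of_nat (nch \<omega> x) * ?v"
      unfolding Z_def by (rule batch_second_moment[OF assms(1) bd])
    finally show "(\<integral>\<^sup>+\<eta>. nxt (graft x \<omega> \<eta>) x (\<lambda>y. ennreal ((SF Z (graft x \<omega> \<eta>) (y # x # rest))\<^sup>2)) \<partial>PN) \<le>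
        ennreal ((SF Z \<omega> (x # rest))\<^sup>2) + ?v * inc \<omega> (x # rest)"
      using *(3) by (simp add: inc_def mult.commute)
  qed (auto simp: SF_Cons nxt_const inc_def)
  also have "\<dots> = annE t (\<lambda>\<omega> hs. ennreal ((SF Z \<omega> hs)\<^sup>2)) + ?v * annE t inc"
    by (subst annE_add) (simp_all add: annE_cmult)
  also have "\<dots> \<le> ?v * \<rho> t + ?v * annE t inc"
    using Suc by (rule add_right_mono)
  finally show ?case by (simp add: rho_Suc distrib_left)
qed

text \<open>With only a finite mean available, truncating at \<open>2 ^ j\<close> at time \<open>2 ^ j\<close> makes both the
  truncation errors and the variances summable in \<open>j\<close>.\<close>

lemma LLN_event_bound:
  fixes h :: "mark \<Rightarrow> real"
  assumes [measurable]: "h \<in> borel_measurable MV" and h0: "\<And>z. 0 \<le> h z"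
    and fin: "(\<integral>\<^sup>+z. ennreal (h z) \<partial>MV) = ennreal H" and H0: "0 \<le> H" and K: "0 < K" and B: "0 < B"
  shows "annE t (\<lambda>\<omega> hs. of_bool (SF h \<omega> hs > H * SF (\<lambda>_. 1) \<omega> hs + K)) \<le>
    (\<integral>\<^sup>+z. ennreal ((if B < h z then 1 else 0) + (if h z \<le> B then (h z)\<^sup>2 else 0) / K\<^sup>2) \<partial>MV) * \<rho> t"
proof -
  define Y where "Y z = (if h z \<le> B then h z else 0)" for z
  define m where "m = (\<integral>z. Y z \<partial>MV)"
  define Z where "Z z = Y z - m" for z
  define f where "f z = (if B < h z then 1 else 0 :: real)" for z
  have [measurable]: "Y \<in> borel_measurable MV" "f \<in> borel_measurable MV" unfolding Y_def f_def by measurable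
  have [measurable]: "Z \<in> borel_measurable MV" unfolding Z_def by measurable
  have bd: "\<bar>Y z\<bar> \<le> B" for z using h0[of z] B by (auto simp: Y_def)
  have mH: "m \<le> H"
  proof -
    have "ennreal m = (\<integral>\<^sup>+z. ennreal (Y z) \<partial>MV)"
      unfolding m_def by (rule nn_integral_eq_integral[symmetric])
        (use bd h0 in \<open>auto simp: Y_def intro!: MV.integrable_const_bound[of _ B]\<close>)
    also have "\<dots> \<le> (\<integral>\<^sup>+z. ennreal (h z) \<partial>MV)"
      by (intro nn_integral_mono ennreal_leI) (simp add: Y_def h0)
    finally show ?thesis using fin H0 by simp
  qed
  have "annE t (\<lambda>\<omega> hs. of_bool (SF h \<omega> hs > H * SF (\<lambda>_. 1) \<omega> hs + K)) \<le>
    annE t (\<lambda>\<omega> hs. SF (\<lambda>z. ennreal (f z)) \<omega> hs + ennreal (1 / K\<^sup>2) * ennreal ((SF Z \<omega> hs)\<^sup>2))"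
  proof (rule annE_cong_mono)
    fix \<omega> hs
    show "of_bool (SF h \<omega> hs > H * SF (\<lambda>_. 1) \<omega> hs + K) \<le>
      SF (\<lambda>z. ennreal (f z)) \<omega> hs + ennreal (1 / K\<^sup>2) * ennreal ((SF Z \<omega> hs)\<^sup>2)"
    proof (cases "SF h \<omega> hs > H * SF (\<lambda>_. 1) \<omega> hs + K")
      case True
      show ?thesis
      \<comment> \<open>If some revealed mark exceeds \<open>B\<close>, the first summand is at
        least 1 by itself. Otherwise truncation changes nothing and \<open>m \<le> H\<close> forces
        the centred sum above \<open>K\<close>, which is Chebyshev's case.\<close>
      proof (cases "\<exists>c\<in>Rev \<omega> hs. B < h (\<omega> c)")
        case True
        then obtain c where c: "c \<in> Rev \<omega> hs" "B < h (\<omega> c)" by auto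
        have "ennreal (f (\<omega> c)) \<le> SF (\<lambda>z. ennreal (f z)) \<omega> hs"
          unfolding SF_Rev by (rule member_le_sum) (use c in auto)
        then have "1 \<le> SF (\<lambda>z. ennreal (f z)) \<omega> hs" using c by (simp add: f_def)
        then have "1 \<le> SF (\<lambda>z. ennreal (f z)) \<omega> hs + ennreal (1 / K\<^sup>2) * ennreal ((SF Z \<omega> hs)\<^sup>2)"
          by (rule add_increasing2[rotated]) simp
        then show ?thesis by (simp add: indicator_def)
      next
        case False
        have "SF Z \<omega> hs = (\<Sum>c\<in>Rev \<omega> hs. h (\<omega> c) - m)"
          unfolding SF_Rev by (rule sum.cong) (use False in \<open>auto simp: Z_def Y_def not_less\<close>)
        also have "\<dots> = SF h \<omega> hs - m * SF (\<lambda>_. 1) \<omega> hs"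
          unfolding SF_Rev by (simp add: sum_subtractf)
        finally have "SF Z \<omega> hs = SF h \<omega> hs - m * SF (\<lambda>_. 1) \<omega> hs" .
        moreover have "m * SF (\<lambda>_. 1) \<omega> hs \<le> H * SF (\<lambda>_. 1) \<omega> hs"
          by (rule mult_right_mono[OF mH]) (simp add: SF_Rev)
        ultimately have "K < SF Z \<omega> hs" using True by simp
        then have "K\<^sup>2 \<le> (SF Z \<omega> hs)\<^sup>2" using K by (intro power_mono) auto
        then have "1 \<le> 1 / K\<^sup>2 * (SF Z \<omega> hs)\<^sup>2" using K by (simp add: field_simps)
        then have "1 \<le> ennreal (1 / K\<^sup>2) * ennreal ((SF Z \<omega> hs)\<^sup>2)"
          by (subst ennreal_mult[symmetric]) (auto simp: ennreal_ge_1)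
        then have "1 \<le> SF (\<lambda>z. ennreal (f z)) \<omega> hs + ennreal (1 / K\<^sup>2) * ennreal ((SF Z \<omega> hs)\<^sup>2)"
          by (rule add_increasing[rotated]) simp
        then show ?thesis by (simp add: indicator_def)
      qed
    qed (simp add: indicator_def)
  qed
  also have "\<dots> = annE t (SF (\<lambda>z. ennreal (f z))) + ennreal (1 / K\<^sup>2) * annE t (\<lambda>\<omega> hs. ennreal ((SF Z \<omega> hs)\<^sup>2))"
    by (subst annE_add) (simp_all add: annE_cmult)
  also have "\<dots> \<le> (\<integral>\<^sup>+z. ennreal (f z) \<partial>MV) * \<rho> t + ennreal (1 / K\<^sup>2) * ((\<integral>\<^sup>+z. ennreal ((Y z)\<^sup>2) \<partial>MV) * \<rho> t)"
    using annE_second_moment[of Y B t, OF \<open>Y \<in> borel_measurable MV\<close> bd, folded m_def]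
    by (intro add_mono mult_left_mono annE_SF_le) (simp_all add: Z_def[abs_def])
  also have "\<dots> = (\<integral>\<^sup>+z. ennreal (f z) + ennreal (1 / K\<^sup>2) * ennreal ((Y z)\<^sup>2) \<partial>MV) * \<rho> t"
    by (simp add: nn_integral_add nn_integral_cmult distrib_right mult.assoc)
  also have "(\<lambda>z. ennreal (f z) + ennreal (1 / K\<^sup>2) * ennreal ((Y z)\<^sup>2)) =
     (\<lambda>z. ennreal ((if B < h z then 1 else 0) + (if h z \<le> B then (h z)\<^sup>2 else 0) / K\<^sup>2))"
  proof
    fix z
    have "ennreal (f z) + ennreal (1 / K\<^sup>2) * ennreal ((Y z)\<^sup>2) = ennreal (f z + 1 / K\<^sup>2 * (Y z)\<^sup>2)"
      by (subst ennreal_mult[symmetric]) (auto simp: f_def ennreal_plus[symmetric] simp del: ennreal_plus)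
    also have "f z + 1 / K\<^sup>2 * (Y z)\<^sup>2 = (if B < h z then 1 else 0) + (if h z \<le> B then (h z)\<^sup>2 else 0) / K\<^sup>2"
      by (auto simp: f_def Y_def)
    finally show "ennreal (f z) + ennreal (1 / K\<^sup>2) * ennreal ((Y z)\<^sup>2) =
      ennreal ((if B < h z then 1 else 0) + (if h z \<le> B then (h z)\<^sup>2 else 0) / K\<^sup>2)" .
  qed
  finally show ?thesis .
qed

text \<open>Each mark contributes to the bounds for all dyadic times together at most a multiple of
  its own \<open>h z\<close>, so a finite mean is enough for Borel-Cantelli. Times between powers of
  two are left to the monotonicity of the quantities that are counted.\<close>

lemma LLN:
  fixes h :: "mark \<Rightarrow> real"
  assumes [measurable]: "h \<in> borel_measurable MV" and h0: "\<And>z. 0 \<le> h z"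
    and fin: "(\<integral>\<^sup>+z. ennreal (h z) \<partial>MV) = ennreal H" and H0: "0 \<le> H" and \<kappa>: "0 < \<kappa>"
  shows "AE \<omega> in P. \<forall>Q. walk_law \<omega> Q \<longrightarrow> (AE X in Q. eventually (\<lambda>j.
     SF h \<omega> (hist X (2 ^ j)) \<le> H * SF (\<lambda>_. 1) \<omega> (hist X (2 ^ j)) + \<kappa> * 2 ^ j) sequentially)"
proof -
  define Ev where "Ev j \<omega> hs \<longleftrightarrow> SF h \<omega> hs > H * SF (\<lambda>_. 1) \<omega> hs + \<kappa> * 2 ^ j" for j :: nat and \<omega> hs
  obtain C where C: "0 \<le> C" "\<And>t. \<rho> t \<le> ennreal (C * real (Suc t))" using rho_linear by auto
  \<comment> \<open>The integrand of the bound at time \<open>2 ^ j\<close>, multiplied by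
    \<open>2 * C * 2 ^ j\<close>, which dominates \<open>\<rho> (2 ^ j)\<close>.\<close>
  define g where "g j z = 2 * C * (if 2 ^ j < h z then 2 ^ j else 0) +
     2 * C / \<kappa>\<^sup>2 * (if h z \<le> 2 ^ j then (h z)\<^sup>2 / 2 ^ j else 0)" for j :: nat and z
  have g0: "0 \<le> g j z" for j z using C by (simp add: g_def)
  have [measurable]: "g j \<in> borel_measurable MV" for j unfolding g_def by measurable
  have le: "annE (2 ^ j) (\<lambda>\<omega> hs. of_bool (Ev j \<omega> hs)) \<le> (\<integral>\<^sup>+z. ennreal (g j z) \<partial>MV)" for j
  proof -
    have "annE (2 ^ j) (\<lambda>\<omega> hs. of_bool (Ev j \<omega> hs)) \<le>
      (\<integral>\<^sup>+z. ennreal ((if 2 ^ j < h z then 1 else 0) + (if h z \<le> 2 ^ j then (h z)\<^sup>2 else 0) / (\<kappa> * 2 ^ j)\<^sup>2) \<partial>MV) * \<rho> (2 ^ j)"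
      unfolding Ev_def by (rule LLN_event_bound[OF assms(1) h0 fin H0]) (use \<kappa> in auto)
    also have "\<dots> \<le> (\<integral>\<^sup>+z. ennreal ((if 2 ^ j < h z then 1 else 0) + (if h z \<le> 2 ^ j then (h z)\<^sup>2 else 0) / (\<kappa> * 2 ^ j)\<^sup>2) \<partial>MV) * ennreal (2 * C * 2 ^ j)"
    proof (rule mult_left_mono)
      have "\<rho> (2 ^ j) \<le> ennreal (C * real (Suc (2 ^ j)))" by (rule C)
      also have "\<dots> \<le> ennreal (2 * C * 2 ^ j)"
        using mult_left_mono[OF one_le_power[of "2::real" j] C(1)]
        by (intro ennreal_leI) (simp add: algebra_simps)
      finally show "\<rho> (2 ^ j) \<le> ennreal (2 * C * 2 ^ j)" .
    qed simp
    also have "\<dots> = (\<integral>\<^sup>+z. ennreal (g j z) \<partial>MV)"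
      using C \<kappa> by (subst nn_integral_multc[symmetric])
        (auto intro!: nn_integral_cong simp: ennreal_mult[symmetric] g_def field_simps power2_eq_square)
    finally show ?thesis .
  qed
  have sum_g: "(\<Sum>j. ennreal (g j z)) \<le> ennreal (4 * C + 4 * C / \<kappa>\<^sup>2) * ennreal (h z)" for z
  proof -
    have "(\<Sum>j<n. g j z) \<le> (4 * C + 4 * C / \<kappa>\<^sup>2) * h z" for n
    proof -
      have "(\<Sum>j<n. g j z) = 2 * C * (\<Sum>j<n. if 2 ^ j < h z then 2 ^ j else 0) +
          2 * C / \<kappa>\<^sup>2 * (\<Sum>j<n. if h z \<le> 2 ^ j then (h z)\<^sup>2 / 2 ^ j else 0)"
        unfolding g_def by (simp only: sum.distrib sum_distrib_left)
      also have "\<dots> \<le> 2 * C * (2 * h z) + 2 * C / \<kappa>\<^sup>2 * (2 * h z)"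
        using C by (intro add_mono mult_left_mono sum_pow2_below sum_pow2_above h0) auto
      finally show ?thesis by (simp add: algebra_simps)
    qed
    then have "(\<Sum>j. ennreal (g j z)) \<le> ennreal ((4 * C + 4 * C / \<kappa>\<^sup>2) * h z)"
      by (intro suminf_ennreal_bound g0)
    then show ?thesis using C h0 by (simp add: ennreal_mult)
  qed
  have "(\<Sum>j. annE (2 ^ j) (\<lambda>\<omega> hs. of_bool (Ev j \<omega> hs))) \<le> (\<Sum>j. \<integral>\<^sup>+z. ennreal (g j z) \<partial>MV)"
    by (intro suminf_le le) auto
  also have "\<dots> = (\<integral>\<^sup>+z. (\<Sum>j. ennreal (g j z)) \<partial>MV)"
    by (rule nn_integral_suminf[symmetric]) measurable
  also have "\<dots> \<le> (\<integral>\<^sup>+z. ennreal (4 * C + 4 * C / \<kappa>\<^sup>2) * ennreal (h z) \<partial>MV)"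
    by (intro nn_integral_mono sum_g)
  also have "\<dots> < \<infinity>"
    by (simp add: nn_integral_cmult fin ennreal_mult_less_top)
  finally have "AE \<omega> in P. \<forall>Q. walk_law \<omega> Q \<longrightarrow>
    (AE X in Q. eventually (\<lambda>j. \<not> Ev j \<omega> (hist X (2 ^ j))) sequentially)"
    by (intro quenched_Borel_Cantelli) (auto simp: Ev_def)
  then show ?thesis by (simp add: Ev_def not_less)
qed

end

section \<open>Visited vertices that are not good\<close>

definition good :: "nat \<Rightarrow> real \<Rightarrow> env \<Rightarrow> nat list \<Rightarrow> bool" where
  "good T L \<omega> v \<longleftrightarrow> v \<noteq> [] \<and> fst (\<omega> v) \<le> T \<and> cpar \<omega> v \<le> L"

text \<open>A heavy vertex pays for itself and for all its children: there are at most N + 1 \<le> 2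
  * N of them, which makes the factor 3. The conductance to the parent depends on the parent's index
  and so is not a function of one mark; but a parent of index above \<open>T\<close> has already
  paid, so it suffices to take all candidates with \<open>a \<le> T\<close>.\<close>

abbreviation bad_weight :: "nat \<Rightarrow> real \<Rightarrow> mark \<Rightarrow> real" where
  "bad_weight T L \<equiv> \<lambda>z. 3 * heavy T z + (if fst z \<le> T \<and> (\<exists>a\<in>{..T}. L < cn a z) then 1 else 0)"

abbreviation nbad :: "nat \<Rightarrow> real \<Rightarrow> env \<Rightarrow> nat list list \<Rightarrow> real" where
  "nbad T L \<omega> hs \<equiv> real (card {v\<in>set hs. \<not> good T L \<omega> v})"

abbreviation ngood :: "nat \<Rightarrow> real \<Rightarrow> env \<Rightarrow> nat list list \<Rightarrow> real" where
  "ngood T L \<omega> hs \<equiv> real (card {v\<in>set hs. good T L \<omega> v})"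

lemma card_not_good_le:
  fixes T :: nat and L :: real
  defines "h \<equiv> \<lambda>z. bad_weight T L z"
  assumes W: "W \<omega> hs \<noteq> 0"
  shows "nbad T L \<omega> (tl hs) \<le> 1 + SF h \<omega> hs"
proof -
  define S where "S = set (tl hs)"
  have fS[simp]: "finite S" by (simp add: S_def)
  have S_hs: "S \<subseteq> set hs" by (cases hs) (auto simp: S_def)
  define f where "f z = heavy T z" for z :: mark
  define g where "g z = (if fst z \<le> T \<and> (\<exists>a\<in>{..T}. L < cn a z) then 1 else 0 :: real)" for z :: mark
  let ?A1 = "{v\<in>S. T < fst (\<omega> v)}"
  let ?A2 = "\<Union>u\<in>{u\<in>S. T < fst (\<omega> u)}. (\<lambda>j. j # u) ` {..<nch \<omega> u}"
  let ?A3 = "{v\<in>S. fst (\<omega> v) \<le> T \<and> (\<exists>a\<in>{..T}. L < cn a (\<omega> v))}"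
  have sub: "{v\<in>S. \<not> good T L \<omega> v} \<subseteq> {[]} \<union> ?A1 \<union> ?A2 \<union> ?A3"
  proof
    fix v assume v: "v \<in> {v\<in>S. \<not> good T L \<omega> v}"
    show "v \<in> {[]} \<union> ?A1 \<union> ?A2 \<union> ?A3"
    proof (cases "v = [] \<or> T < fst (\<omega> v)")
      case False
      then have L: "L < cn (fst (\<omega> (tl v))) (\<omega> v)" using v by (auto simp: good_def cpar_def)
      have "v \<in> Rev \<omega> hs" using v S_hs W_subset_Rev[OF W] by auto
      then obtain j u where u: "v = j # u" "u \<in> S" "j < nch \<omega> u" using False by (auto simp: Rev_def S_def)
      show ?thesis
      proof (cases "T < fst (\<omega> u)")
        case True
        then show ?thesis using u by blast
      next
        case f: False
        then have "v \<in> ?A3" using False L v u by auto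
        then show ?thesis by blast
      qed
    qed (use v in auto)
  qed
  have c1: "real (card ?A1) \<le> (\<Sum>v\<in>S. f (\<omega> v))"
  proof -
    have "real (card ?A1) = (\<Sum>v\<in>S. if T < fst (\<omega> v) then 1 else 0)"
      by (simp add: sum.If_cases Int_def conj_commute)
    also have "\<dots> \<le> (\<Sum>v\<in>S. f (\<omega> v))" by (rule sum_mono) (auto simp: f_def)
    finally show ?thesis .
  qed
  have c2: "real (card ?A2) \<le> (\<Sum>v\<in>S. 2 * f (\<omega> v))"
  proof -
    have "card ?A2 \<le> (\<Sum>u\<in>{u\<in>S. T < fst (\<omega> u)}. card ((\<lambda>j. j # u) ` {..<nch \<omega> u}))"
      by (rule card_UN_le) simp
    also have "\<dots> = (\<Sum>u\<in>{u\<in>S. T < fst (\<omega> u)}. nch \<omega> u)"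
      by (simp add: card_image inj_on_def)
    also have "\<dots> = (\<Sum>u\<in>S. if T < fst (\<omega> u) then nch \<omega> u else 0)"
      by (simp add: sum.If_cases Int_def conj_commute)
    finally have "real (card ?A2) \<le> (\<Sum>u\<in>S. real (if T < fst (\<omega> u) then nch \<omega> u else 0))"
      by (simp only: of_nat_le_iff flip: of_nat_sum)
    also have "\<dots> \<le> (\<Sum>v\<in>S. 2 * f (\<omega> v))"
      by (rule sum_mono) (auto simp: f_def nch_def)
    finally show ?thesis .
  qed
  have c3: "real (card ?A3) \<le> (\<Sum>v\<in>S. g (\<omega> v))"
    by (simp add: g_def sum.If_cases Int_def conj_commute)
  have "card {v\<in>S. \<not> good T L \<omega> v} \<le> card ({[]} \<union> ?A1 \<union> ?A2 \<union> ?A3)"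
    by (rule card_mono[OF _ sub]) auto
  also have "\<dots> \<le> card {[] :: nat list} + card ?A1 + card ?A2 + card ?A3"
    by (intro order_trans[OF card_Un_le] add_mono order_refl)
  finally have "real (card {v\<in>S. \<not> good T L \<omega> v}) \<le> 1 + real (card ?A1) + real (card ?A2) + real (card ?A3)"
    by simp
  also have "\<dots> \<le> 1 + (\<Sum>v\<in>S. h (\<omega> v))"
  proof -
    have "(\<Sum>v\<in>S. h (\<omega> v)) = 3 * (\<Sum>v\<in>S. f (\<omega> v)) + (\<Sum>v\<in>S. g (\<omega> v))"
      by (simp add: h_def f_def g_def sum.distrib sum_distrib_left)
    moreover have "(\<Sum>v\<in>S. 2 * f (\<omega> v)) = 2 * (\<Sum>v\<in>S. f (\<omega> v))" by (simp add: sum_distrib_left)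
    ultimately show ?thesis using c1 c2 c3 by linarith
  qed
  also have "(\<Sum>v\<in>S. h (\<omega> v)) \<le> SF h \<omega> hs"
    by (rule SF_visited[OF W _ S_hs]) (simp add: h_def)
  finally show ?thesis by (simp add: S_def)
qed

context gw_env
begin

text \<open>The null set of environments does not depend on the law \<open>Q\<close>. The notion is
  stable under countable conjunctions, which is how the conditions on a trajectory are
  combined.\<close>

definition aew :: "(env \<Rightarrow> (nat \<Rightarrow> nat list) \<Rightarrow> bool) \<Rightarrow> bool" where
  "aew \<Phi> \<longleftrightarrow> (AE \<omega> in P. \<forall>Q. walk_law \<omega> Q \<longrightarrow> (AE X in Q. \<Phi> \<omega> X))"

lemma aew_mp2:
  assumes "aew \<Phi>" "aew \<Psi>" "\<And>\<omega> X. \<Phi> \<omega> X \<Longrightarrow> \<Psi> \<omega> X \<Longrightarrow> \<Theta> \<omega> X"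
  shows "aew \<Theta>"
  using assms(1,2) unfolding aew_def
proof eventually_elim
  case (elim \<omega>)
  show ?case
  proof (intro allI impI)
    fix Q assume "walk_law \<omega> Q"
    with elim have "AE X in Q. \<Phi> \<omega> X" "AE X in Q. \<Psi> \<omega> X" by auto
    then show "AE X in Q. \<Theta> \<omega> X" by eventually_elim (rule assms(3))
  qed
qed

lemma aew_all:
  assumes "\<And>n::nat. aew (\<Phi> n)"
  shows "aew (\<lambda>\<omega> X. \<forall>n. \<Phi> n \<omega> X)"
proof -
  have "AE \<omega> in P. \<forall>n. \<forall>Q. walk_law \<omega> Q \<longrightarrow> (AE X in Q. \<Phi> n \<omega> X)"
    using assms unfolding aew_def by (subst AE_all_countable) simp
  then show ?thesis
    unfolding aew_def by eventually_elim (auto simp: AE_all_countable)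
qed

lemma aew_valid: "aew (\<lambda>\<omega> X. \<forall>t. W \<omega> (hist X t) \<noteq> 0)"
  unfolding aew_def by (rule AE_valid)

text \<open>The pathwise form of \<open>rho_linear\<close>: by the law of large numbers, heavy marks
  account for at most half of the revealed vertices plus \<open>2 ^ j\<close>, and the half is
  absorbed. The constant is twice \<open>2 + 1 + T\<close>, the 2 being bounded by
  \<open>2 * 2 ^ j\<close>.\<close>

lemma aew_revealed_linear: "\<exists>c>0. aew (\<lambda>\<omega> X. eventually (\<lambda>j. SF (\<lambda>_. 1 :: real) \<omega> (hist X (2 ^ j)) \<le> c * 2 ^ j) sequentially)"
proof -
  obtain T where T: "(\<integral>\<^sup>+z. ennreal (heavy T z) \<partial>MV) < ennreal (1/2)"
    using eventually_happens[OF tail_mean_small[of "ennreal (1/2)"]]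
    by (auto simp: ennreal_less_zero_iff simp del: ennreal_half)
  define f where "f z = heavy T z" for z :: mark
  have [measurable]: "f \<in> borel_measurable MV" unfolding f_def by measurable
  obtain H where H: "(\<integral>\<^sup>+z. ennreal (f z) \<partial>MV) = ennreal H" "0 \<le> H"
    using T by (cases "\<integral>\<^sup>+z. ennreal (f z) \<partial>MV") (auto simp: f_def)
  have "ennreal H < ennreal (1/2)" using T H by (simp add: f_def[abs_def])
  then have H2: "H \<le> 1/2" using H by (simp add: ennreal_less_iff del: ennreal_half)
  have "aew (\<lambda>\<omega> X. eventually (\<lambda>j. SF f \<omega> (hist X (2 ^ j)) \<le> H * SF (\<lambda>_. 1) \<omega> (hist X (2 ^ j)) + 1 * 2 ^ j) sequentially)"
    unfolding aew_def by (rule LLN) (use H in \<open>auto simp: f_def\<close>)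
  then have "aew (\<lambda>\<omega> X. eventually (\<lambda>j. SF (\<lambda>_. 1 :: real) \<omega> (hist X (2 ^ j)) \<le> (6 + 2 * real T) * 2 ^ j) sequentially)"
  proof (rule aew_mp2[OF _ aew_valid])
    fix \<omega> X
    assume 1: "eventually (\<lambda>j. SF f \<omega> (hist X (2 ^ j)) \<le> H * SF (\<lambda>_. 1) \<omega> (hist X (2 ^ j)) + 1 * 2 ^ j) sequentially"
      and 2: "\<forall>t. W \<omega> (hist X t) \<noteq> 0"
    show "eventually (\<lambda>j. SF (\<lambda>_. 1 :: real) \<omega> (hist X (2 ^ j)) \<le> (6 + 2 * real T) * 2 ^ j) sequentially"
      using 1
    proof eventually_elim
      case (elim j)
      let ?R = "SF (\<lambda>_. 1 :: real) \<omega> (hist X (2 ^ j))"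
      have a: "?R \<le> 2 + real T * real (2 ^ j) + SF f \<omega> (hist X (2 ^ j))"
        unfolding f_def[abs_def] using 2 by (intro SF_one_le) auto
      have b: "H * ?R \<le> 1/2 * ?R" by (rule mult_right_mono[OF H2]) (simp add: SF_Rev)
      have d: "(1::real) \<le> 2 ^ j" and e: "real (2 ^ j) = 2 ^ j" by simp_all
      have key: "R \<le> 2 * (2 * x + y + x)" if "s \<le> hr + 1 * x" "R \<le> 2 + y + s" "hr \<le> 1/2 * R" "1 \<le> x"
        for R x y s hr :: real using that by argo
      have "?R \<le> 2 * (2 * 2 ^ j + real T * 2 ^ j + 2 ^ j)" by (rule key[OF elim a[unfolded e] b d])
      then show ?case by (simp add: algebra_simps)
    qed
  qed
  then show ?thesis by (intro exI[of _ "6 + 2 * real T"]) auto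
qed

text \<open>The quantifiers are nested because \<open>L\<close> must be large depending on
  \<open>T\<close>. Every sufficiently large \<open>T\<close> and then every sufficiently large
  \<open>L\<close> will do, so the choice can be shared with the trap argument.\<close>

lemma aew_not_good:
  assumes \<kappa>: "0 < \<kappa>"
  shows "eventually (\<lambda>T. eventually (\<lambda>L. aew (\<lambda>\<omega> X. eventually (\<lambda>t.
    nbad T (real L) \<omega> (hist X t) \<le> \<kappa> * real t) sequentially)) sequentially) sequentially"
proof -
  obtain c where c: "c > 0" and R: "aew (\<lambda>\<omega> X. eventually (\<lambda>j. SF (\<lambda>_. 1 :: real) \<omega> (hist X (2 ^ j)) \<le> c * 2 ^ j) sequentially)"
    using aew_revealed_linear by auto
  \<comment> \<open>With at most \<open>c * 2 ^ j\<close> revealed vertices, a mean weight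
    \<open>\<eta>\<close> amounts to \<open>\<kappa> / 8 * 2 ^ j\<close>; the error in the law of
    large numbers is another \<open>\<kappa> / 8 * 2 ^ j\<close>.\<close>
  define \<eta> where "\<eta> = \<kappa> / (8 * c)"
  have \<eta>: "\<eta> > 0" using c \<kappa> by (simp add: \<eta>_def)
  have *: "aew (\<lambda>\<omega> X. eventually (\<lambda>t. nbad T L \<omega> (hist X t) \<le> \<kappa> * real t) sequentially)"
    if small: "(\<integral>\<^sup>+z. ennreal (bad_weight T L z) \<partial>MV) \<le> ennreal \<eta>" for T L
  proof -
    define h where "h z = bad_weight T L z" for z :: mark
    have [measurable]: "h \<in> borel_measurable MV" unfolding h_def by measurable
    obtain H where H: "(\<integral>\<^sup>+z. ennreal (h z) \<partial>MV) = ennreal H" "0 \<le> H"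
      using small by (cases "\<integral>\<^sup>+z. ennreal (h z) \<partial>MV") (auto simp: h_def top_unique)
    have "ennreal H \<le> ennreal \<eta>" using small H by (simp add: h_def[abs_def])
    then have H\<eta>: "H \<le> \<eta>" using \<eta> by simp
    have "aew (\<lambda>\<omega> X. eventually (\<lambda>j. SF h \<omega> (hist X (2 ^ j)) \<le> H * SF (\<lambda>_. 1) \<omega> (hist X (2 ^ j)) + \<kappa> / 8 * 2 ^ j) sequentially)"
      unfolding aew_def by (rule LLN) (use H \<kappa> in \<open>auto simp: h_def\<close>)
    then have "aew (\<lambda>\<omega> X. eventually (\<lambda>j. SF h \<omega> (hist X (2 ^ j)) \<le> \<kappa> / 4 * 2 ^ j) sequentially)"
    proof (rule aew_mp2[OF _ R])
      fix \<omega> X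
      assume 1: "eventually (\<lambda>j. SF h \<omega> (hist X (2 ^ j)) \<le> H * SF (\<lambda>_. 1) \<omega> (hist X (2 ^ j)) + \<kappa> / 8 * 2 ^ j) sequentially"
        and 2: "eventually (\<lambda>j. SF (\<lambda>_. 1 :: real) \<omega> (hist X (2 ^ j)) \<le> c * 2 ^ j) sequentially"
      show "eventually (\<lambda>j. SF h \<omega> (hist X (2 ^ j)) \<le> \<kappa> / 4 * 2 ^ j) sequentially"
        using 1 2
      proof eventually_elim
        case (elim j)
        have "H * SF (\<lambda>_. 1) \<omega> (hist X (2 ^ j)) \<le> \<eta> * (c * 2 ^ j)"
          using H\<eta> elim(2) H \<eta> by (intro mult_mono) (auto simp: SF_Rev)
        also have "\<dots> = \<kappa> / 8 * 2 ^ j" using c by (simp add: \<eta>_def)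
        finally show ?case using elim(1) by simp
      qed
    qed
    then show ?thesis
    proof (rule aew_mp2[OF _ aew_valid])
      fix \<omega> X
      assume 1: "eventually (\<lambda>j. SF h \<omega> (hist X (2 ^ j)) \<le> \<kappa> / 4 * 2 ^ j) sequentially"
        and 2: "\<forall>t. W \<omega> (hist X t) \<noteq> 0"
      obtain j1 where j1: "4 / \<kappa> < 2 ^ j1" using real_arch_pow[of 2 "4 / \<kappa>"] by auto
      have "eventually (\<lambda>j. 4 / \<kappa> \<le> 2 ^ j) sequentially"
      proof (rule eventually_sequentiallyI)
        fix j assume "j1 \<le> j"
        then have "(2::real) ^ j1 \<le> 2 ^ j" by (intro power_increasing) auto
        then show "4 / \<kappa> \<le> 2 ^ j" using j1 by linarith
      qed
      with 1 have "eventually (\<lambda>j. 4 / \<kappa> \<le> 2 ^ j \<and> SF h \<omega> (hist X (2 ^ j)) \<le> \<kappa> / 4 * 2 ^ j) sequentially"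
        by eventually_elim auto
      then obtain j0 where j0: "\<And>j. j \<ge> j0 \<Longrightarrow> 4 / \<kappa> \<le> 2 ^ j \<and> SF h \<omega> (hist X (2 ^ j)) \<le> \<kappa> / 4 * 2 ^ j"
        by (auto simp: eventually_sequentially)
      show "eventually (\<lambda>t. nbad T L \<omega> (hist X t) \<le> \<kappa> * real t) sequentially"
      proof (rule eventually_sequentiallyI)
        fix t :: nat assume t: "2 ^ j0 \<le> t"
        then have t0: "0 < t" using less_le_trans[of 0 "2 ^ j0" t] by simp
        obtain i where i: "2 ^ i \<le> t" "t < 2 ^ (i + 1)" using ex_power_ivl1[of 2 t] t0 by auto
        have "2 ^ j0 < (2::nat) ^ (i + 1)" using t i by linarith
        then have "j0 < i + 1" by (rule power_less_imp_less_exp[rotated]) simp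
        then have j: "j0 \<le> i + 1" by simp
        \<comment> \<open>Passing from \<open>t\<close> to the next power of two costs a factor of
          at most 2. As \<open>t < 2 ^ (i + 1)\<close>, everything visited by time \<open>t\<close>
          lies in the tail of the longer history, where the count of vertices that are not good
          applies. The extra 1 in that count is absorbed by
          \<open>4 / \<kappa> \<le> 2 ^ (i + 1)\<close>.\<close>
        have hsub: "set (hist X t) \<subseteq> set (tl (hist X (2 ^ (i + 1))))"
          using i by (auto simp: hist_def)
        have "nbad T L \<omega> (hist X t) \<le> nbad T L \<omega> (tl (hist X (2 ^ (i + 1))))"
          by (intro of_nat_mono card_mono) (use hsub in auto)
        also have "\<dots> \<le> 1 + SF h \<omega> (hist X (2 ^ (i + 1)))"
          unfolding h_def[abs_def] using 2 by (intro card_not_good_le) auto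
        also have "\<dots> \<le> \<kappa> / 4 * 2 ^ (i + 1) + \<kappa> / 4 * 2 ^ (i + 1)"
          using j0[OF j] \<kappa> by (intro add_mono) (auto simp: field_simps)
        also have "\<dots> = \<kappa> * 2 ^ i" by simp
        also have "\<dots> \<le> \<kappa> * real t" using i(1) \<kappa> by (simp flip: of_nat_le_iff)
        finally show "nbad T L \<omega> (hist X t) \<le> \<kappa> * real t" .
      qed
    qed
  qed
  \<comment> \<open>The heavy part enters with factor 3 and so gets \<open>\<eta> / 6\<close>; the
    part with large conductances gets the other \<open>\<eta> / 2\<close>.\<close>
  have "eventually (\<lambda>T. (\<integral>\<^sup>+z. ennreal (heavy T z) \<partial>MV) < ennreal (\<eta> / 6)) sequentially"
    by (rule tail_mean_small) (use \<eta> in simp)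
  then show ?thesis
  proof eventually_elim
    case (elim T)
    have "eventually (\<lambda>L::nat. (\<integral>\<^sup>+z. (if fst z \<le> T \<and> (\<exists>a\<in>{..T}. real L < cn a z) then 1 else 0) \<partial>MV) < ennreal (\<eta> / 2)) sequentially"
    proof (rule nn_integral_tail_small)
      show "(\<integral>\<^sup>+z. 1 \<partial>MV) < \<infinity>" using MV.emeasure_space_1 by simp
      fix z :: mark
      have "eventually (\<lambda>L::nat. cn a z \<le> real L) sequentially" for a
        using filterlim_real_sequentially unfolding filterlim_at_top by auto
      then have "eventually (\<lambda>L::nat. \<forall>a\<in>{..T}. cn a z \<le> real L) sequentially"
        by (intro eventually_ball_finite) auto
      then show "eventually (\<lambda>L::nat. \<not> (fst z \<le> T \<and> (\<exists>a\<in>{..T}. real L < cn a z))) sequentially"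
        by eventually_elim force
    qed (use \<eta> in auto)
    then show ?case
    proof eventually_elim
      case L: (elim L)
      show ?case
      proof (rule *)
        let ?f = "heavy T"
        let ?g = "\<lambda>z. if fst z \<le> T \<and> (\<exists>a\<in>{..T}. real L < cn a z) then 1 else 0 :: ennreal"
        have "(\<integral>\<^sup>+z. ennreal (3 * ?f z + (if fst z \<le> T \<and> (\<exists>a\<in>{..T}. real L < cn a z) then 1 else 0)) \<partial>MV) =
            (\<integral>\<^sup>+z. 3 * ennreal (?f z) + ?g z \<partial>MV)"
          by (rule nn_integral_cong) (auto simp: ennreal_mult)
        also have "\<dots> = 3 * (\<integral>\<^sup>+z. ennreal (?f z) \<partial>MV) + (\<integral>\<^sup>+z. ?g z \<partial>MV)"
          by (subst nn_integral_add) (auto simp: nn_integral_cmult)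
        also have "\<dots> \<le> 3 * ennreal (\<eta> / 6) + ennreal (\<eta> / 2)"
          using elim L by (intro add_mono mult_left_mono) auto
        also have "3 * ennreal (\<eta> / 6) = ennreal (3 * (\<eta> / 6))"
          by (subst ennreal_mult) (use \<eta> in auto)
        also have "ennreal (3 * (\<eta> / 6)) + ennreal (\<eta> / 2) = ennreal (3 * (\<eta> / 6) + \<eta> / 2)"
          by (rule ennreal_plus[symmetric]) (use \<eta> in auto)
        also have "\<dots> = ennreal \<eta>" by simp
        finally show "(\<integral>\<^sup>+z. ennreal (3 * ?f z + (if fst z \<le> T \<and> (\<exists>a\<in>{..T}. real L < cn a z) then 1 else 0)) \<partial>MV) \<le> ennreal \<eta>" .
      qed
    qed
  qed
qed

end

section \<open>The trap supermartingale\<close>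

text \<open>When a trap edge of conductance x is left with probability about 2 * L / x per step and
  each step is discounted at rate 1 / M, the expected discount falls short of 1 by about x / (x + 2
  * L * M). The formula is a lower bound for this, linear in \<open>min x M\<close>, so that its
  expectation is a truncated mean.\<close>

definition trap_gain :: "real \<Rightarrow> real \<Rightarrow> real \<Rightarrow> real" where
  "trap_gain L M x = min x M / (M * (1 + 2 * L))"

lemma trap_gain_bounds:
  assumes "1 \<le> L" "1 \<le> M" "0 < x"
  shows "0 \<le> trap_gain L M x" "trap_gain L M x \<le> 1 / 3"
proof -
  show "0 \<le> trap_gain L M x" using assms by (simp add: trap_gain_def)
  have "trap_gain L M x \<le> M / (M * (1 + 2 * L))"
    unfolding trap_gain_def using assms by (intro divide_right_mono) auto
  also have "\<dots> = 1 / (1 + 2 * L)" using assms by simp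
  also have "\<dots> \<le> 1 / 3" using assms by (intro divide_left_mono) auto
  finally show "trap_gain L M x \<le> 1 / 3" .
qed

text \<open>With r = 2 * L / (x + 2 * L) bounding the probability of leaving the edge, the claim
  follows from F * (r + 1 / M) \<le> 1 / M. The two summands use up the normalisation
  \<open>1 + 2 * L\<close>: s * r is at most 2 * L, and s / M is at most 1.\<close>

lemma trap_gain_step:
  assumes L: "1 \<le> L" and M: "1 \<le> M" and x: "0 < x" and q: "x / (x + 2 * L) \<le> q"
  shows "1 - q * trap_gain L M x \<le> (1 + 1 / M) * (1 - trap_gain L M x)"
proof -
  define F where "F = trap_gain L M x"
  define s where "s = min x M"
  have s: "0 < s" "s \<le> x" "s \<le> M" using assms by (auto simp: s_def)
  have F: "F = s / (M * (1 + 2 * L))" by (simp add: F_def trap_gain_def s_def)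
  have F0: "0 \<le> F" using s assms by (simp add: F)
  have "s * (2 * L / (x + 2 * L)) \<le> x * (2 * L / (x + 2 * L))"
    using s assms by (intro mult_right_mono) auto
  also have "\<dots> \<le> 2 * L" using assms by (simp add: field_simps)
  finally have 1: "s * (2 * L / (x + 2 * L)) \<le> 2 * L" .
  have 2: "s / M \<le> 1" using s assms by simp
  have "F * (2 * L / (x + 2 * L) + 1 / M) = (s * (2 * L / (x + 2 * L)) + s / M) / (M * (1 + 2 * L))"
  proof -
    have "s / K * (A + 1 / M) = (s * A + s / M) / K" for K A by (simp add: distrib_left add_divide_distrib)
    then show ?thesis unfolding F .
  qed
  also have "\<dots> \<le> (2 * L + 1) / (M * (1 + 2 * L))"
    using add_mono[OF 1 2] assms by (intro divide_right_mono) auto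
  also have "\<dots> = 1 / M"
  proof -
    have "1 + 2 * L \<noteq> 0" "M \<noteq> 0" using L M by auto
    then show ?thesis unfolding add.commute[of "2 * L" 1] by simp
  qed
  finally have le: "F * (2 * L / (x + 2 * L) + 1 / M) \<le> 1 / M" .
  have "x / (x + 2 * L) = 1 - 2 * L / (x + 2 * L)" using assms by (simp add: field_simps)
  then have le': "F * (1 - 2 * L / (x + 2 * L)) \<le> q * F"
    using mult_right_mono[OF q F0] by (simp add: mult.commute)
  have "1 - e \<le> (1 + i) * (1 - F)" if "F * (1 - r) \<le> e" "F * (r + i) \<le> i" for r i e
    using that by (simp add: algebra_simps)
  from this[OF le' le] show ?thesis unfolding F_def .
qed

text \<open>A lower bound for the probability of stepping from a fresh good vertex of index
  \<open>a\<close> to child \<open>0\<close>, if that child can be the upper end of a trap. The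
  leading \<open>L\<close> in the denominator bounds the conductance to the parent.\<close>

abbreviation down :: "nat \<Rightarrow> nat \<Rightarrow> real \<Rightarrow> (nat \<Rightarrow> mark) \<Rightarrow> real" where
  "down k a L \<eta> \<equiv> if fst (\<eta> 0) = k \<and> cn a (\<eta> 0) \<le> L
     then cn a (\<eta> 0) / (L + (\<Sum>j<a. cn a (\<eta> j))) else 0"

text \<open>The integral bounds say: after arriving at the lower end of the trap it is good enough with
  probability proportional to \<open>c\<close>, the expected gain on arrival at its upper end is at least \<open>D\<close>,
  and from any good vertex its upper end is reached next with probability at least \<open>\<beta>\<close>.
  What matters is that \<open>M * D\<close> can be made arbitrarily large.\<close>

locale gw_trap = gw_env +
  fixes k m T :: nat and L M c D \<beta> :: real
  assumes k: "1 \<le> k" "k \<le> T" and L: "1 \<le> L" and M: "1 \<le> M"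
    and c: "0 \<le> c" "c \<le> 1" and D: "0 < D" "D \<le> 1" and \<beta>: "0 < \<beta>" "\<beta> \<le> 1"
    and hyp2: "\<And>F. 0 \<le> F \<Longrightarrow> F \<le> 1 \<Longrightarrow>
      (\<integral>\<^sup>+\<eta>. ennreal (1 - (if (\<Sum>j<m. cn m (\<eta> j)) \<le> 2 * L then 1 / (1 + 2 * L) else 0) * F) \<partial>PN) \<le> ennreal (1 - c * F)"
    and hyp1: "(\<integral>\<^sup>+\<eta>. ennreal (1 - (if fst (\<eta> 0) = m \<and> (\<Sum>j\<in>{1..<k}. cn k (\<eta> j)) \<le> L \<and> 1 \<le> cn k (\<eta> 0)
        then 1 / (1 + 2 * L) * (c * trap_gain L M (cn k (\<eta> 0))) else 0)) \<partial>PN) \<le> ennreal (1 - D)"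
    and hyp0: "\<And>a. 1 \<le> a \<Longrightarrow> a \<le> T \<Longrightarrow>
      (\<integral>\<^sup>+\<eta>. ennreal (1 - (down k a L \<eta>) * (D / 2)) \<partial>PN)
        \<le> ennreal (1 - \<beta> * D / 2)"
begin

definition entry :: "env \<Rightarrow> nat list \<Rightarrow> bool" where
  "entry \<omega> v \<longleftrightarrow> v \<noteq> [] \<and> fst (\<omega> v) = k \<and> cpar \<omega> v \<le> L"

definition sib :: "env \<Rightarrow> nat list \<Rightarrow> bool" where
  "sib \<omega> v \<longleftrightarrow> (\<Sum>j\<in>{1..<k}. cpar \<omega> (j # v)) \<le> L"

text \<open>The trap edge joins \<open>v\<close> to child \<open>0\<close>. At \<open>v\<close> the
  other conductances sum to at most \<open>2 * L\<close>, half for the parent and half for the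
  siblings; at the lower end the bound is also \<open>2 * L\<close>. So from either end an edge of
  conductance x is crossed with probability at least x / (x + 2 * L).\<close>

definition trap :: "env \<Rightarrow> nat list \<Rightarrow> bool" where
  "trap \<omega> v \<longleftrightarrow> entry \<omega> v \<and> fst (\<omega> (0 # v)) = m \<and> sib \<omega> v \<and> (\<Sum>j<m. cpar \<omega> (j # 0 # v)) \<le> 2 * L"

definition gain :: "env \<Rightarrow> nat list \<Rightarrow> real" where
  "gain \<omega> v = trap_gain L M (cpar \<omega> (0 # v))"

text \<open>The stage at which the trap edge is known and bearable from above, but the children of
  its lower end are unrevealed. The final negation excludes overlapping chains, possible when
  \<open>k = m\<close>, so that every vertex left uncounted directly follows a counted one.\<close>

fun entered :: "env \<Rightarrow> nat list list \<Rightarrow> bool" where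
  "entered \<omega> (y # x # rest) \<longleftrightarrow> y = 0 # x \<and> y \<notin> set (x # rest) \<and> x \<notin> set rest \<and> entry \<omega> x \<and>
     fst (\<omega> y) = m \<and> sib \<omega> x \<and> 1 \<le> cpar \<omega> y \<and> \<not> entered \<omega> (x # rest)"
| "entered \<omega> [x] = False"
| "entered \<omega> [] = False"

definition tg :: "env \<Rightarrow> nat list set \<Rightarrow> nat list \<Rightarrow> real" where
  "tg \<omega> S v = (if 0 # v \<in> S \<and> trap \<omega> v then gain \<omega> v else 0)"

text \<open>\<open>\<psi>\<close> bounds the expected discount, at rate \<open>1 / M\<close> per step, collected while the walk remains
  in the trap it occupies or is about to enter; every fresh good vertex may then be paid a factor
  \<open>1 + \<theta>\<close>, except for those counted by \<open>entered\<close>, whose potential may be too close to \<open>1\<close>.\<close>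

definition \<psi> :: "env \<Rightarrow> nat list list \<Rightarrow> real" where
  "\<psi> \<omega> hs = (if hd hs \<notin> set (tl hs)
     then (if entered \<omega> hs then 1 - c * gain \<omega> (tl (hd hs)) else if entry \<omega> (hd hs) then 1 - D / 2 else 1)
     else 1 - max (tg \<omega> (set (tl hs)) (hd hs)) (if hd hs = 0 # tl (hd hs) then tg \<omega> (set (tl hs)) (tl (hd hs)) else 0))"

text \<open>A vertex is counted at the step that leaves it after its first visit, since that is
  where its children's marks are averaged and the reward can be paid. The current position is never
  counted.\<close>

fun Gd :: "env \<Rightarrow> nat list list \<Rightarrow> nat" where
  "Gd \<omega> (y # x # rest) = Gd \<omega> (x # rest) + (if x \<notin> set rest \<and> good T L \<omega> x \<and> \<not> entered \<omega> (x # rest) then 1 else 0)"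
| "Gd \<omega> [x] = 0"
| "Gd \<omega> [] = 0"

text \<open>From a fresh good vertex of potential 1 the expected potential after one step is at most
  \<open>1 - \<theta>\<close>, and \<open>(1 + \<theta>) * (1 - \<theta>) \<le> 1\<close>.\<close>

definition \<theta> :: real where "\<theta> = \<beta> * D / 2"

definition \<Phi> :: "env \<Rightarrow> nat list list \<Rightarrow> ennreal" where
  "\<Phi> \<omega> hs = ennreal ((1 + \<theta>) ^ Gd \<omega> hs * (M / (M + 1)) ^ length hs * \<psi> \<omega> hs)"

lemma measurable_entry[measurable]: "Measurable.pred P (\<lambda>\<omega>. entry \<omega> v)"
  unfolding entry_def by measurable

lemma measurable_sib[measurable]: "Measurable.pred P (\<lambda>\<omega>. sib \<omega> v)"
  unfolding sib_def by measurable

lemma measurable_trap[measurable]: "Measurable.pred P (\<lambda>\<omega>. trap \<omega> v)"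
  unfolding trap_def by measurable

lemma measurable_good[measurable]: "Measurable.pred P (\<lambda>\<omega>. good T L \<omega> v)"
  unfolding good_def by measurable

lemma measurable_gain[measurable]: "(\<lambda>\<omega>. gain \<omega> v) \<in> borel_measurable P"
  unfolding gain_def trap_gain_def by measurable

lemma measurable_entered[measurable]: "Measurable.pred P (\<lambda>\<omega>. entered \<omega> hs)"
proof (induction hs rule: induct_list012)
  case (3 y x hs)
  have [measurable]: "Measurable.pred P (\<lambda>\<omega>. entered \<omega> (x # hs))" by fact
  show ?case by simp
qed simp_all

lemma measurable_psi[measurable]: "(\<lambda>\<omega>. \<psi> \<omega> hs) \<in> borel_measurable P"
  unfolding \<psi>_def tg_def by measurable

lemma measurable_Gd[measurable]: "(\<lambda>\<omega>. Gd \<omega> hs) \<in> measurable P (count_space UNIV)"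
proof (induction hs rule: induct_list012)
  case (3 y x hs)
  have [measurable]: "(\<lambda>\<omega>. Gd \<omega> (x # hs)) \<in> measurable P (count_space UNIV)" by fact
  show ?case by simp
qed simp_all

lemma measurable_Phi[measurable]: "(\<lambda>\<omega>. \<Phi> \<omega> hs) \<in> borel_measurable P"
proof -
  have [measurable]: "(\<lambda>\<omega>. (1 + \<theta>) ^ Gd \<omega> hs) \<in> borel_measurable P"
    by (rule measurable_compose[OF measurable_Gd]) simp
  show ?thesis unfolding \<Phi>_def by measurable
qed

section \<open>Bounds for the potential and the marks on which it depends\<close>

lemma theta: "0 < \<theta>" "\<theta> \<le> 1 / 2"
proof -
  show "0 < \<theta>" using D \<beta> by (simp add: \<theta>_def)
  have "\<beta> * D \<le> 1 * 1" using D \<beta> by (intro mult_mono) auto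
  then show "\<theta> \<le> 1 / 2" by (simp add: \<theta>_def)
qed

lemma gain_bounds:
  assumes "ok \<omega>" shows "0 \<le> gain \<omega> v" "gain \<omega> v \<le> 1 / 3"
  unfolding gain_def by (intro trap_gain_bounds L M ok_cpar[OF assms])+

lemma tg_bounds: assumes "ok \<omega>" shows "0 \<le> tg \<omega> S v" "tg \<omega> S v \<le> 1 / 3"
  using gain_bounds[OF assms] by (auto simp: tg_def)

text \<open>The upper bound is what a neighbour is worth when nothing is known about it; the lower
  bound lets \<open>\<psi>\<close> be dropped from \<open>\<Phi>\<close> at the cost of a factor
  2.\<close>

lemma psi_bounds:
  assumes ok: "ok \<omega>" shows "\<psi> \<omega> hs \<le> 1" "1 / 2 \<le> \<psi> \<omega> hs"
proof -
  have cg: "0 \<le> c * gain \<omega> v" "c * gain \<omega> v \<le> 1 * (1 / 3)" for v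
    using c gain_bounds[OF ok] by (simp, intro mult_mono, auto)
  show "\<psi> \<omega> hs \<le> 1"
    using cg[of "tl (hd hs)"] D tg_bounds[OF ok] by (auto simp: \<psi>_def max_def)
  show "1 / 2 \<le> \<psi> \<omega> hs"
    using cg[of "tl (hd hs)"] D tg_bounds(2)[OF ok, of "set (tl hs)" "hd hs"] tg_bounds(2)[OF ok, of "set (tl hs)" "tl (hd hs)"]
    by (auto simp: \<psi>_def max_def)
qed

lemma psi_nonneg: "ok \<omega> \<Longrightarrow> 0 \<le> \<psi> \<omega> hs"
  using psi_bounds(2)[of \<omega> hs] by simp

lemma entered_cong:
  assumes "\<And>v. v \<in> set (tl hs) \<Longrightarrow> \<omega>' v = \<omega> v \<and> \<omega>' (tl v) = \<omega> (tl v) \<and> (\<forall>j. \<omega>' (j # v) = \<omega> (j # v))"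
  shows "entered \<omega>' hs = entered \<omega> hs"
  using assms
proof (induction \<omega> hs rule: entered.induct)
  case (1 \<omega> y x rest)
  have IH: "entered \<omega>' (x # rest) = entered \<omega> (x # rest)"
    by (rule 1) (use 1(2) in auto)
  have x: "\<omega>' x = \<omega> x" "\<omega>' (tl x) = \<omega> (tl x)" "\<And>j. \<omega>' (j # x) = \<omega> (j # x)"
    using 1(2)[of x] by auto
  have cp: "cpar \<omega>' x = cpar \<omega> x" "\<And>j. cpar \<omega>' (j # x) = cpar \<omega> (j # x)"
    by (simp_all add: cpar_def x)
  show ?case
    by (cases "y = 0 # x") (simp_all add: IH entry_def sib_def x cp)
qed auto

lemma Gd_cong:
  assumes "\<And>v. v \<in> set (tl hs) \<Longrightarrow> \<omega>' v = \<omega> v \<and> \<omega>' (tl v) = \<omega> (tl v) \<and> (\<forall>j. \<omega>' (j # v) = \<omega> (j # v))"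
  shows "Gd \<omega>' hs = Gd \<omega> hs"
  using assms
proof (induction \<omega> hs rule: Gd.induct)
  case (1 \<omega> y x rest)
  have IH: "Gd \<omega>' (x # rest) = Gd \<omega> (x # rest)"
    by (rule 1) (use 1(2) in auto)
  have ent: "entered \<omega>' (x # rest) = entered \<omega> (x # rest)"
    by (rule entered_cong) (use 1(2) in auto)
  have x: "\<omega>' x = \<omega> x" "\<omega>' (tl x) = \<omega> (tl x)" using 1(2)[of x] by auto
  have cp: "cpar \<omega>' x = cpar \<omega> x" by (simp add: cpar_def x)
  show ?case by (simp add: IH ent good_def x cp)
qed auto

lemma graft_agree:
  assumes "W \<omega> (x # rest) \<noteq> 0" "x \<notin> set rest" "v \<in> set rest"
  shows "graft x \<omega> \<eta> v = \<omega> v \<and> graft x \<omega> \<eta> (tl v) = \<omega> (tl v) \<and> (\<forall>j. graft x \<omega> \<eta> (j # v) = \<omega> (j # v))"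
proof -
  have cl: "tl_closed rest" using W_tl_closed_tl[OF assms(1)] by simp
  then have "tl v \<in> set rest" "tl (tl v) \<in> set rest" using assms(3) by (auto simp: tl_closed_def)
  then have "tl v \<noteq> x" "tl (tl v) \<noteq> x" "v \<noteq> x" using assms by auto
  then show ?thesis by (simp add: graft_other)
qed

lemma cpar_graft_child: "cpar (graft x \<omega> \<eta>) (j # x) = cn (fst (\<omega> x)) (\<eta> j)"
  by (simp add: cpar_def)

lemma cpar_graft_self: "cpar (graft x \<omega> \<eta>) x = cpar \<omega> x"
  by (simp add: cpar_def)

lemma entry_graft_self: "entry (graft x \<omega> \<eta>) x = entry \<omega> x"
  by (simp add: entry_def cpar_graft_self)

lemma nch_nonroot: "x \<noteq> [] \<Longrightarrow> nch \<omega> x = fst (\<omega> x)"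
  by (simp add: nch_def)

lemma nbrs_child0: "ok \<omega> \<Longrightarrow> 0 # x \<in> nbrs \<omega> x"
  using ok_nch[of \<omega> x] by (auto simp: nbrs_def)

lemma nbrs_tl_mem: "x \<noteq> [] \<Longrightarrow> tl x \<in> nbrs \<omega> x"
  by (auto simp: nbrs_def)

lemma ratio_mono: "0 < (x::real) \<Longrightarrow> 0 \<le> s \<Longrightarrow> s \<le> t \<Longrightarrow> x / (x + t) \<le> x / (x + s)"
  by (intro divide_left_mono) auto

lemma ratio_mono2: "1 \<le> (x::real) \<Longrightarrow> 0 \<le> s \<Longrightarrow> 1 / (1 + s) \<le> x / (x + s)"
  using mult_left_mono[of 1 x s] by (simp add: field_simps)

section \<open>One-step estimates for the potential\<close>

lemma trans_prob_trap_down: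
  assumes ok: "ok \<omega>" and e: "entry \<omega> x" and s: "sib \<omega> x"
  shows "cpar \<omega> (0 # x) / (cpar \<omega> (0 # x) + 2 * L) \<le> trans_prob \<omega> x (0 # x)"
proof -
  have x: "x \<noteq> []" "nch \<omega> x = k" using e by (auto simp: entry_def nch_nonroot)
  have "{..<k} = insert 0 {1..<k}" using k by auto
  then have ct: "ctot \<omega> x = cpar \<omega> (0 # x) + (cpar \<omega> x + (\<Sum>j\<in>{1..<k}. cpar \<omega> (j # x)))"
    using x by (simp add: ctot_def)
  have pos: "0 \<le> (\<Sum>j\<in>{1..<k}. cpar \<omega> (j # x))" by (intro sum_nonneg less_imp_le ok_cpar ok)
  have "cpar \<omega> (0 # x) / (cpar \<omega> (0 # x) + 2 * L) \<le> cpar \<omega> (0 # x) / ctot \<omega> x"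
    unfolding ct by (rule ratio_mono) (use e s pos ok_cpar[OF ok] in \<open>auto simp: entry_def sib_def less_imp_le add_nonneg_nonneg\<close>)
  then show ?thesis using trans_prob_child[of 0 \<omega> x] ok_nch[OF ok, of x] by simp
qed

lemma trans_prob_trap_up:
  assumes ok: "ok \<omega>" and x: "x \<noteq> []" "fst (\<omega> x) = m" and s: "(\<Sum>j<m. cpar \<omega> (j # x)) \<le> 2 * L"
  shows "cpar \<omega> x / (cpar \<omega> x + 2 * L) \<le> trans_prob \<omega> x (tl x)"
proof -
  have ct: "ctot \<omega> x = cpar \<omega> x + (\<Sum>j<m. cpar \<omega> (j # x))"
    using x by (simp add: ctot_def nch_nonroot)
  have pos: "0 \<le> (\<Sum>j<m. cpar \<omega> (j # x))" by (intro sum_nonneg less_imp_le ok_cpar ok)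
  have "cpar \<omega> x / (cpar \<omega> x + 2 * L) \<le> cpar \<omega> x / ctot \<omega> x"
    unfolding ct by (rule ratio_mono) (use s pos ok_cpar[OF ok] in auto)
  then show ?thesis using trans_prob_parent[of x \<omega>] x by simp
qed

lemma psi_step_old:
  assumes ok: "ok \<omega>" and W: "W \<omega> (x # rest) \<noteq> 0" and old: "x \<in> set rest"
  shows "nxt \<omega> x (\<lambda>y. ennreal (\<psi> \<omega> (y # x # rest))) \<le> ennreal ((1 + 1 / M) * \<psi> \<omega> (x # rest))"
proof -
  define g1 where "g1 = tg \<omega> (set rest) x"
  define g2 where "g2 = (if x = 0 # tl x then tg \<omega> (set rest) (tl x) else 0)"
  have \<psi>: "\<psi> \<omega> (x # rest) = 1 - max g1 g2" using old by (simp add: \<psi>_def g1_def g2_def)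
  have g: "0 \<le> g1" "0 \<le> g2" using tg_bounds[OF ok] by (auto simp: g1_def g2_def)
  have cl: "tl x \<in> set (x # rest)" using W_tl_closed[OF W] by (auto simp: tl_closed_def)
  have gain: "nxt \<omega> x (\<lambda>y. ennreal (\<psi> \<omega> (y # x # rest))) \<le> ennreal ((1 + 1 / M) * (1 - gain \<omega> v))"
    if "y0 \<in> nbrs \<omega> x" "\<psi> \<omega> (y0 # x # rest) \<le> 1 - gain \<omega> v"
      "cpar \<omega> (0 # v) / (cpar \<omega> (0 # v) + 2 * L) \<le> trans_prob \<omega> x y0" for y0 v
  proof -
    have "nxt \<omega> x (\<lambda>y. ennreal (\<psi> \<omega> (y # x # rest))) \<le> ennreal (1 - trans_prob \<omega> x y0 * gain \<omega> v)"
      by (rule nxt_gain[OF ok that(1)]) (use that psi_bounds[OF ok] psi_nonneg[OF ok] in auto)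
    also have "\<dots> \<le> ennreal ((1 + 1 / M) * (1 - gain \<omega> v))"
      unfolding gain_def by (intro ennreal_leI trap_gain_step L M ok_cpar ok that)
    finally show ?thesis .
  qed
  consider "max g1 g2 = 0" | "max g1 g2 = g1" "0 < g1" | "max g1 g2 = g2" "0 < g2"
    using g by (metis max_def less_eq_real_def)
  then show ?thesis
  proof cases
    case 1
    have "nxt \<omega> x (\<lambda>y. ennreal (\<psi> \<omega> (y # x # rest))) \<le> 1"
      by (rule nxt_le_one[OF ok]) (use psi_bounds[OF ok] in auto)
    also have "1 \<le> ennreal (1 + 1 / M)" using M by (simp add: ennreal_ge_1)
    finally show ?thesis using 1 by (simp add: \<psi>)
  next
    case 2
    then have t: "0 # x \<in> set rest" "trap \<omega> x" "g1 = gain \<omega> x" by (auto simp: g1_def tg_def split: if_splits)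
    have "\<psi> \<omega> ((0 # x) # x # rest) \<le> 1 - gain \<omega> x"
      using t by (auto simp: \<psi>_def tg_def)
    moreover have "cpar \<omega> (0 # x) / (cpar \<omega> (0 # x) + 2 * L) \<le> trans_prob \<omega> x (0 # x)"
      using t by (intro trans_prob_trap_down ok) (auto simp: trap_def)
    ultimately show ?thesis using gain[OF nbrs_child0[OF ok], of x] 2 t by (simp add: \<psi>)
  next
    case 3
    then have t: "x = 0 # tl x" "trap \<omega> (tl x)" "g2 = gain \<omega> (tl x)"
      by (auto simp: g2_def tg_def split: if_splits)
    then have x: "x \<noteq> []" by auto
    have "\<psi> \<omega> (tl x # x # rest) \<le> 1 - gain \<omega> (tl x)"
      using t cl by (auto simp: \<psi>_def tg_def)
    moreover have "cpar \<omega> (0 # tl x) / (cpar \<omega> (0 # tl x) + 2 * L) \<le> trans_prob \<omega> x (tl x)"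
      using t x trans_prob_trap_up[OF ok x] by (simp add: trap_def)
    ultimately show ?thesis using gain[OF nbrs_tl_mem[OF x], of "tl x"] 3 t(3) by (simp add: \<psi>)
  qed
qed

text \<open>The cases form a ladder, each rung using one favourable step: from a good vertex down to
  a fresh entry, from an entry down to the stage \<open>entered\<close>, and from there back up into
  a trap that is now completely known. Being averaged over new marks, these steps lose nothing to
  the discount.\<close>

lemma psi_step_new:
  assumes ok: "ok \<omega>" and W: "W \<omega> (x # rest) \<noteq> 0" and new: "x \<notin> set rest"
  shows "ennreal (if good T L \<omega> x \<and> \<not> entered \<omega> (x # rest) then 1 + \<theta> else 1) *
      (\<integral>\<^sup>+\<eta>. nxt (graft x \<omega> \<eta>) x (\<lambda>y. ennreal (\<psi> (graft x \<omega> \<eta>) (y # x # rest))) \<partial>PN) \<le> ennreal (\<psi> \<omega> (x # rest))"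
proof -
  let ?n = "\<lambda>\<eta>. nxt (graft x \<omega> \<eta>) x (\<lambda>y. ennreal (\<psi> (graft x \<omega> \<eta>) (y # x # rest)))"
  let ?I = "\<integral>\<^sup>+\<eta>. ?n \<eta> \<partial>PN"
  note agree = graft_agree[OF W new]
  have ent': "entered (graft x \<omega> \<eta>) (x # rest) = entered \<omega> (x # rest)" for \<eta>
    by (rule entered_cong) (use agree in auto)
  \<comment> \<open>Had child \<open>0\<close> been visited, closure under parents would make
    \<open>x\<close> an old vertex.\<close>
  have child_new: "0 # x \<notin> set (x # rest)"
    using W_tl_closed_tl[OF W] new by (auto simp: tl_closed_def)
  have okg: "ok (graft x \<omega> \<eta>)" if "\<forall>j. okm (\<eta> j)" for \<eta> using that ok by (intro ok_graft) auto
  have base: "?n \<eta> \<le> 1"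
    if "\<forall>j. okm (\<eta> j)" for \<eta>
    by (rule nxt_le_one[OF okg[OF that]]) (use psi_bounds[OF okg[OF that]] in auto)
  have gain: "?n \<eta> \<le> ennreal (1 - r * F)"
    if "\<forall>j. okm (\<eta> j)" "y0 \<in> nbrs (graft x \<omega> \<eta>) x" "\<psi> (graft x \<omega> \<eta>) (y0 # x # rest) \<le> 1 - F"
      "r \<le> trans_prob (graft x \<omega> \<eta>) x y0" "0 \<le> F" for y0 F r \<eta>
  proof -
    note okg = okg[OF that(1)]
    have "?n \<eta> \<le>
        ennreal (1 - trans_prob (graft x \<omega> \<eta>) x y0 * F)"
      by (rule nxt_gain[OF okg that(2)]) (use that psi_bounds[OF okg] psi_nonneg[OF okg] in auto)
    also have "\<dots> \<le> ennreal (1 - r * F)"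
      using that by (intro ennreal_leI) (simp add: mult_right_mono)
    finally show ?thesis .
  qed
  show ?thesis
  proof (cases "entered \<omega> (x # rest)")
    case True
    then obtain v rest' where r: "rest = v # rest'" by (cases rest) auto
    have e: "x = 0 # v" "v \<notin> set rest'" "entry \<omega> v" "fst (\<omega> x) = m" "sib \<omega> v" "1 \<le> cpar \<omega> x"
      using True by (auto simp: r)
    have agv: "graft x \<omega> \<eta> v = \<omega> v" "graft x \<omega> \<eta> (tl v) = \<omega> (tl v)" "graft x \<omega> \<eta> (j # v) = \<omega> (j # v)" for \<eta> j
      using agree[of v] r by auto
    have cpv: "cpar (graft x \<omega> \<eta>) v = cpar \<omega> v" "cpar (graft x \<omega> \<eta>) (j # v) = cpar \<omega> (j # v)" for \<eta> j
      by (simp_all add: cpar_def agv)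
    have gainv: "gain (graft x \<omega> \<eta>) v = gain \<omega> v" for \<eta> by (simp add: gain_def cpv)
    have \<psi>: "\<psi> \<omega> (x # rest) = 1 - c * gain \<omega> v" using True new by (simp add: \<psi>_def e(1))
    have "?I \<le>
       (\<integral>\<^sup>+\<eta>. ennreal (1 - (if (\<Sum>j<m. cn m (\<eta> j)) \<le> 2 * L then 1 / (1 + 2 * L) else 0) * gain \<omega> v) \<partial>PN)"
    proof (rule nn_integral_mono_AE, use AE_okm_PN in eventually_elim)
      case (elim \<eta>)
      show ?case
      proof (cases "(\<Sum>j<m. cn m (\<eta> j)) \<le> 2 * L")
        case True
        let ?\<omega>' = "graft x \<omega> \<eta>"
        have s: "(\<Sum>j<m. cpar ?\<omega>' (j # x)) \<le> 2 * L"
          using True by (simp add: cpar_graft_child e(4))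
        have s': "(\<Sum>j<m. cpar ?\<omega>' (j # 0 # v)) \<le> 2 * L"
          using s by (simp only: e(1)[symmetric])
        have "entry ?\<omega>' v" "sib ?\<omega>' v"
          using e(3,5) by (simp_all add: entry_def sib_def agv cpv)
        moreover have "fst (?\<omega>' (0 # v)) = m" using e(1,4) agv(3) by metis
        ultimately have tr: "trap ?\<omega>' v"
          using s' by (simp only: trap_def)
        have "v \<noteq> x" using e(1) by auto
        then have "\<psi> ?\<omega>' (v # x # rest) \<le> 1 - gain \<omega> v"
          using tr by (auto simp: \<psi>_def r tg_def e(1)[symmetric] gainv)
        moreover have "1 / (1 + 2 * L) \<le> trans_prob ?\<omega>' x v"
        proof -
          have "1 / (1 + 2 * L) \<le> cpar \<omega> x / (cpar \<omega> x + 2 * L)"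
            by (rule ratio_mono2) (use e L in auto)
          also have "\<dots> \<le> trans_prob ?\<omega>' x (tl x)"
            using trans_prob_trap_up[OF okg[OF elim], of x] s e by (simp add: cpar_graft_self)
          finally show ?thesis by (simp add: e(1))
        qed
        moreover have "v \<in> nbrs ?\<omega>' x" using nbrs_tl_mem[of x] e(1) by simp
        ultimately show ?thesis
          using gain[OF elim, of v "gain \<omega> v" "1 / (1 + 2 * L)"] gain_bounds[OF ok] True by simp
      next
        case False
        then show ?thesis using base[OF elim] by simp
      qed
    qed
    also have "\<dots> \<le> ennreal (1 - c * gain \<omega> v)"
      by (rule hyp2) (use gain_bounds[OF ok, of v] in auto)
    finally show ?thesis using True by (simp add: \<psi>)
  next
    case notent: False
    show ?thesis
    proof (cases "entry \<omega> x")
      case e: True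
      have xk: "x \<noteq> []" "fst (\<omega> x) = k" "cpar \<omega> x \<le> L" using e by (auto simp: entry_def)
      have gd: "good T L \<omega> x" using xk k by (simp add: good_def)
      have \<psi>: "\<psi> \<omega> (x # rest) = 1 - D / 2" using notent new e by (simp add: \<psi>_def)
      have "?I \<le>
         (\<integral>\<^sup>+\<eta>. ennreal (1 - (if fst (\<eta> 0) = m \<and> (\<Sum>j\<in>{1..<k}. cn k (\<eta> j)) \<le> L \<and> 1 \<le> cn k (\<eta> 0)
            then 1 / (1 + 2 * L) * (c * trap_gain L M (cn k (\<eta> 0))) else 0)) \<partial>PN)"
      proof (rule nn_integral_mono_AE, use AE_okm_PN in eventually_elim)
        case (elim \<eta>)
        let ?\<omega>' = "graft x \<omega> \<eta>"
        show ?case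
        proof (cases "fst (\<eta> 0) = m \<and> (\<Sum>j\<in>{1..<k}. cn k (\<eta> j)) \<le> L \<and> 1 \<le> cn k (\<eta> 0)")
          case True
          have s: "sib ?\<omega>' x" using True by (simp add: sib_def cpar_graft_child xk)
          have e': "entry ?\<omega>' x" using e by (simp add: entry_graft_self)
          have "entered ?\<omega>' ((0 # x) # x # rest)"
            using child_new new e' s True notent ent' by (simp add: cpar_graft_child xk)
          moreover have g: "gain ?\<omega>' x = trap_gain L M (cn k (\<eta> 0))" by (simp add: gain_def cpar_graft_child xk)
          ultimately have "\<psi> ?\<omega>' ((0 # x) # x # rest) \<le> 1 - c * trap_gain L M (cn k (\<eta> 0))"
            using child_new by (simp add: \<psi>_def)
          moreover have "1 / (1 + 2 * L) \<le> trans_prob ?\<omega>' x (0 # x)"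
          proof -
            have "1 / (1 + 2 * L) \<le> cpar ?\<omega>' (0 # x) / (cpar ?\<omega>' (0 # x) + 2 * L)"
              by (rule ratio_mono2) (use True L in \<open>auto simp: cpar_graft_child xk\<close>)
            also have "\<dots> \<le> trans_prob ?\<omega>' x (0 # x)"
              by (rule trans_prob_trap_down[OF okg[OF elim] e' s])
            finally show ?thesis .
          qed
          moreover have "0 \<le> c * trap_gain L M (cn k (\<eta> 0))"
            using gain_bounds[OF okg[OF elim], of x] c unfolding g by simp
          ultimately show ?thesis
            using gain[OF elim nbrs_child0[OF okg[OF elim]], of "c * trap_gain L M (cn k (\<eta> 0))" "1 / (1 + 2 * L)"] True by simp
        next
          case False
          then show ?thesis using base[OF elim] by auto
        qed
      qed
      also have "\<dots> \<le> ennreal (1 - D)" by (rule hyp1)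
      finally have "?I \<le> ennreal (1 - D)" .
      then have "ennreal (1 + \<theta>) * ?I \<le>
          ennreal (1 + \<theta>) * ennreal (1 - D)" by (rule mult_left_mono) simp
      also have "\<dots> = ennreal ((1 + \<theta>) * (1 - D))" using theta D by (intro ennreal_mult[symmetric]) auto
      also have "\<dots> \<le> ennreal (1 - D / 2)"
      proof (rule ennreal_leI)
        \<comment> \<open>An entry is itself good as \<open>k \<le> T\<close>. Its potential is set
          to \<open>1 - D / 2\<close> rather than \<open>1 - D\<close> so that the reward for it can
          be paid as well.\<close>
        have "\<theta> \<le> D / 2" using D \<beta> mult_right_mono[of \<beta> 1 D] by (simp add: \<theta>_def)
        moreover have "0 \<le> \<theta> * D" using theta D by simp
        ultimately show "(1 + \<theta>) * (1 - D) \<le> 1 - D / 2" by (simp add: algebra_simps)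
      qed
      finally show ?thesis using gd notent by (simp add: \<psi>)
    next
      case nentry: False
      have \<psi>: "\<psi> \<omega> (x # rest) = 1" using notent new nentry by (simp add: \<psi>_def)
      show ?thesis
      proof (cases "good T L \<omega> x")
        case gd: True
        define a where "a = fst (\<omega> x)"
        have x: "x \<noteq> []" "a \<le> T" "cpar \<omega> x \<le> L" "1 \<le> a" using gd ok_fst[OF ok, of x] by (auto simp: good_def a_def)
        have "?I \<le>
           (\<integral>\<^sup>+\<eta>. ennreal (1 - (down k a L \<eta>) * (D / 2)) \<partial>PN)"
        proof (rule nn_integral_mono_AE, use AE_okm_PN in eventually_elim)
          case (elim \<eta>)
          let ?\<omega>' = "graft x \<omega> \<eta>"
          show ?case
          proof (cases "fst (\<eta> 0) = k \<and> cn a (\<eta> 0) \<le> L")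
            case True
            have e0: "entry ?\<omega>' (0 # x)" using True by (simp add: entry_def cpar_graft_child a_def)
            have "\<not> entered ?\<omega>' ((0 # x) # x # rest)" using nentry by (simp add: entry_graft_self)
            then have "\<psi> ?\<omega>' ((0 # x) # x # rest) \<le> 1 - D / 2"
              using child_new e0 by (simp add: \<psi>_def del: entered.simps)
            moreover have "cn a (\<eta> 0) / (L + (\<Sum>j<a. cn a (\<eta> j))) \<le> trans_prob ?\<omega>' x (0 # x)"
            proof -
              have pos: "0 < cn a (\<eta> j)" for j using elim by (simp add: cn_def okm_def)
              have ct: "ctot ?\<omega>' x = cpar \<omega> x + (\<Sum>j<a. cn a (\<eta> j))"
                using x by (simp add: ctot_def cpar_graft_self cpar_graft_child nch_nonroot a_def)
              have "cn a (\<eta> 0) / (L + (\<Sum>j<a. cn a (\<eta> j))) \<le> cn a (\<eta> 0) / ctot ?\<omega>' x"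
                unfolding ct using x pos L ok_cpar[OF ok, of x] sum_nonneg[of "{..<a}" "\<lambda>j. cn a (\<eta> j)"]
                by (intro divide_left_mono mult_pos_pos add_pos_nonneg) (auto intro: less_imp_le sum_nonneg)
              also have "\<dots> = trans_prob ?\<omega>' x (0 # x)"
                using trans_prob_child[of 0 ?\<omega>' x] ok_nch[OF okg[OF elim], of x] by (simp add: cpar_graft_child a_def)
              finally show ?thesis .
            qed
            ultimately show ?thesis
              using gain[OF elim nbrs_child0[OF okg[OF elim]], of "D / 2" "cn a (\<eta> 0) / (L + (\<Sum>j<a. cn a (\<eta> j)))"] True D by simp
          next
            case False
            then show ?thesis using base[OF elim] by auto
          qed
        qed
        also have "\<dots> \<le> ennreal (1 - \<beta> * D / 2)" by (rule hyp0) (use x in auto)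
        finally have "ennreal (1 + \<theta>) * ?I \<le>
            ennreal (1 + \<theta>) * ennreal (1 - \<theta>)" unfolding \<theta>_def by (rule mult_left_mono) simp
        also have "\<dots> = ennreal ((1 + \<theta>) * (1 - \<theta>))" using theta by (intro ennreal_mult[symmetric]) auto
        also have "\<dots> \<le> 1"
          using theta by (simp add: algebra_simps ennreal_le_1)
        finally show ?thesis using gd notent by (simp add: \<psi>)
      next
        case False
        have "?I \<le> (\<integral>\<^sup>+\<eta>. 1 \<partial>PN)"
          by (rule nn_integral_mono_AE, use AE_okm_PN in eventually_elim) (rule base)
        also have "\<dots> = 1" using PN.emeasure_space_1 by simp
        finally show ?thesis using False by (simp add: \<psi>)
      qed
    qed
  qed
qed

text \<open>One discount \<open>M / (M + 1)\<close> cancels the factor \<open>1 + 1 / M\<close> lost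
  at visited vertices. At fresh vertices the potential already decreases together with the reward,
  and the discount is given away.\<close>

lemma Phi_step: "annE (Suc t) \<Phi> \<le> annE t \<Phi>"
proof (rule annE_step)
  define \<delta> where "\<delta> = M / (M + 1)"
  have "1 + 1 / M = (M + 1) / M" using M by (simp add: add_divide_distrib)
  then have \<delta>: "0 < \<delta>" "\<delta> * (1 + 1 / M) = 1" using M by (simp_all add: \<delta>_def)
  have Phi_Cons: "\<Phi> \<omega> (y # x # rest) = ennreal ((1 + \<theta>) ^ Gd \<omega> (x # rest) * \<delta> ^ Suc (length rest) * \<delta>) *
      (ennreal (if x \<notin> set rest \<and> good T L \<omega> x \<and> \<not> entered \<omega> (x # rest) then 1 + \<theta> else 1) * ennreal (\<psi> \<omega> (y # x # rest)))"
    if "ok \<omega>" for \<omega> y x rest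
    using psi_nonneg[OF that] theta \<delta> unfolding \<Phi>_def \<delta>_def[symmetric]
    by (auto simp: ennreal_mult[symmetric] mult_ac)
  have fin: "ennreal ((1 + \<theta>) ^ n * \<delta> ^ Suc l * \<delta>) * ennreal ((1 + 1 / M) * s) = ennreal ((1 + \<theta>) ^ n * \<delta> ^ Suc l * s)"
    if "0 \<le> s" for n l s
  proof -
    have "ennreal ((1 + \<theta>) ^ n * \<delta> ^ Suc l * \<delta>) * ennreal ((1 + 1 / M) * s) =
        ennreal (((1 + \<theta>) ^ n * \<delta> ^ Suc l * \<delta>) * ((1 + 1 / M) * s))"
      using that theta \<delta> M by (intro ennreal_mult[symmetric]) auto
    also have "((1 + \<theta>) ^ n * \<delta> ^ Suc l * \<delta>) * ((1 + 1 / M) * s) = (1 + \<theta>) ^ n * \<delta> ^ Suc l * (\<delta> * (1 + 1 / M)) * s"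
      by (simp only: mult_ac)
    finally show ?thesis by (simp only: \<delta>(2) mult_1_right)
  qed
  {
    fix \<omega> x rest assume *: "ok \<omega>" "W \<omega> (x # rest) \<noteq> 0" "x \<in> set rest"
    have "nxt \<omega> x (\<lambda>y. \<Phi> \<omega> (y # x # rest)) =
        ennreal ((1 + \<theta>) ^ Gd \<omega> (x # rest) * \<delta> ^ Suc (length rest) * \<delta>) * nxt \<omega> x (\<lambda>y. ennreal (\<psi> \<omega> (y # x # rest)))"
      using *(3) by (simp only: Phi_Cons[OF *(1)] nxt_cmult if_False ennreal_1 mult_1_left not_True_eq_False simp_thms)
    also have "\<dots> \<le> ennreal ((1 + \<theta>) ^ Gd \<omega> (x # rest) * \<delta> ^ Suc (length rest) * \<delta>) * ennreal ((1 + 1 / M) * \<psi> \<omega> (x # rest))"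
      by (intro mult_left_mono psi_step_old *) simp
    also have "\<dots> = \<Phi> \<omega> (x # rest)"
      unfolding fin[OF psi_nonneg[OF *(1)]] by (simp add: \<Phi>_def \<delta>_def)
    finally show "nxt \<omega> x (\<lambda>y. \<Phi> \<omega> (y # x # rest)) \<le> \<Phi> \<omega> (x # rest)" .
  next
    fix \<omega> x rest assume *: "ok \<omega>" "W \<omega> (x # rest) \<noteq> 0" "x \<notin> set rest"
    let ?C = "ennreal ((1 + \<theta>) ^ Gd \<omega> (x # rest) * \<delta> ^ Suc (length rest) * \<delta>)"
    let ?b = "ennreal (if good T L \<omega> x \<and> \<not> entered \<omega> (x # rest) then 1 + \<theta> else 1)"
    have gd: "good T L (graft x \<omega> \<eta>) x = good T L \<omega> x" for \<eta>
      by (simp add: good_def cpar_graft_self)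
    have inv: "Gd (graft x \<omega> \<eta>) (x # rest) = Gd \<omega> (x # rest)"
      "entered (graft x \<omega> \<eta>) (x # rest) = entered \<omega> (x # rest)" for \<eta>
      using graft_agree[OF *(2,3)] by (intro Gd_cong entered_cong; simp)+
    have m: "(\<lambda>\<eta>. nxt (graft x \<omega> \<eta>) x (\<lambda>y. ennreal (\<psi> (graft x \<omega> \<eta>) (y # x # rest)))) \<in> borel_measurable PN"
      by (rule graft_measurable[where F="\<lambda>\<omega>. nxt \<omega> x (\<lambda>y. ennreal (\<psi> \<omega> (y # x # rest)))"]) measurable
    have "(\<integral>\<^sup>+\<eta>. nxt (graft x \<omega> \<eta>) x (\<lambda>y. \<Phi> (graft x \<omega> \<eta>) (y # x # rest)) \<partial>PN) =
      (\<integral>\<^sup>+\<eta>. ?C * (?b * nxt (graft x \<omega> \<eta>) x (\<lambda>y. ennreal (\<psi> (graft x \<omega> \<eta>) (y # x # rest)))) \<partial>PN)"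
    proof (rule nn_integral_cong_AE, use AE_okm_PN in eventually_elim)
      case (elim \<eta>)
      then have "ok (graft x \<omega> \<eta>)" using *(1) by (intro ok_graft) auto
      then show ?case using *(3) by (simp add: Phi_Cons nxt_cmult inv gd)
    qed
    also have "\<dots> = ?C * (?b * (\<integral>\<^sup>+\<eta>. nxt (graft x \<omega> \<eta>) x (\<lambda>y. ennreal (\<psi> (graft x \<omega> \<eta>) (y # x # rest))) \<partial>PN))"
      using m by (simp add: nn_integral_cmult)
    also have "\<dots> \<le> ?C * ennreal (\<psi> \<omega> (x # rest))"
      by (intro mult_left_mono psi_step_new *) simp
    also have "\<dots> \<le> ?C * ennreal ((1 + 1 / M) * \<psi> \<omega> (x # rest))"
      using psi_nonneg[OF *(1), of "x # rest"] M by (intro mult_left_mono ennreal_leI) (auto simp: distrib_right)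
    also have "\<dots> = \<Phi> \<omega> (x # rest)"
      unfolding fin[OF psi_nonneg[OF *(1)]] by (simp add: \<Phi>_def \<delta>_def)
    finally show "(\<integral>\<^sup>+\<eta>. nxt (graft x \<omega> \<eta>) x (\<lambda>y. \<Phi> (graft x \<omega> \<eta>) (y # x # rest)) \<partial>PN) \<le> \<Phi> \<omega> (x # rest)" .
  }
qed measurable

section \<open>Counting good vertices by means of the supermartingale\<close>

lemma annE_Phi_le_1: "annE t \<Phi> \<le> 1"
proof (induction t)
  case 0
  have "annE 0 \<Phi> = (\<integral>\<^sup>+\<omega>. \<Phi> \<omega> [[]] \<partial>P)" by (rule annE_0) measurable
  also have "\<dots> \<le> (\<integral>\<^sup>+\<omega>. 1 \<partial>P)"
  proof (rule nn_integral_mono_AE, use AE_ok in eventually_elim)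
    case (elim \<omega>)
    have "M / (M + 1) * \<psi> \<omega> [[]] \<le> 1 * 1"
      using M psi_bounds[OF elim, of "[[]]"] by (intro mult_mono) auto
    then show ?case by (simp add: \<Phi>_def ennreal_le_1)
  qed
  also have "\<dots> = 1" using env.emeasure_space_1 by simp
  finally show ?case .
next
  case (Suc t)
  then show ?case using Phi_step[of t] by (rule order_trans[rotated])
qed

text \<open>A good vertex left out by \<open>Gd\<close> is the lower end at stage
  \<open>entered\<close>, and the position just before it was a fresh good vertex that is counted.
  The term for \<open>entered \<omega> hs\<close> carries this debt for the current position through
  the induction.\<close>

lemma card_good_le: "card {v\<in>set (tl hs). good T L \<omega> v} + (if entered \<omega> hs then 1 else 0) \<le> 2 * Gd \<omega> hs"
proof (induction \<omega> hs rule: Gd.induct)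
  case (1 \<omega> y x rest)
  have eg: "entered \<omega> (y # x # rest) \<Longrightarrow> good T L \<omega> x"
    using k by (auto simp: entry_def good_def)
  show ?case
  proof (cases "x \<in> set rest")
    case True
    then have "\<not> entered \<omega> (y # x # rest)" by simp
    moreover have "{v \<in> set (tl (y # x # rest)). good T L \<omega> v} = {v \<in> set (tl (x # rest)). good T L \<omega> v}"
      using True by auto
    ultimately show ?thesis using 1 True by (simp del: entered.simps)
  next
    case False
    have e: "{v \<in> set (tl (y # x # rest)). good T L \<omega> v} =
        (if good T L \<omega> x then insert x {v \<in> set (tl (x # rest)). good T L \<omega> v} else {v \<in> set (tl (x # rest)). good T L \<omega> v})"
      by auto
    have ee: "entered \<omega> (x # rest) \<Longrightarrow> \<not> entered \<omega> (y # x # rest)" by simp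
    show ?thesis unfolding e using 1 False eg ee by (auto simp del: entered.simps)
  qed
qed auto

lemma aew_good: "aew (\<lambda>\<omega> X. eventually (\<lambda>t. ngood T L \<omega> (hist X t) \<le> 16 * real (t + 2) / (M * (\<beta> * D))) sequentially)"
proof -
  define \<delta> where "\<delta> = M / (M + 1)"
  have "1 + 1 / M = (M + 1) / M" using M by (simp add: add_divide_distrib)
  then have \<delta>: "0 < \<delta>" "\<delta> < 1" "1 / \<delta> = 1 + 1 / M" using M by (simp_all add: \<delta>_def)
  \<comment> \<open>The exponent is twice what the discount in \<open>\<Phi>\<close> undoes. The
    surplus \<open>\<delta> ^ length hs\<close> makes the Markov bound summable in
    \<open>t\<close>.\<close>
  define Ev where "Ev t \<omega> hs \<longleftrightarrow> (1 / \<delta>) ^ (2 * length hs) \<le> (1 + \<theta>) ^ Gd \<omega> hs" for t :: nat and \<omega> hs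
  have [measurable]: "Measurable.pred P (\<lambda>\<omega>. Ev j \<omega> hs)" for j hs
    unfolding Ev_def by (rule measurable_compose[OF measurable_Gd]) simp
  have le: "annE t (\<lambda>\<omega> hs. of_bool (Ev t \<omega> hs)) \<le> ennreal (2 * \<delta> * \<delta> ^ t)" for t
  proof -
    have "annE t (\<lambda>\<omega> hs. of_bool (Ev t \<omega> hs)) \<le> annE t (\<lambda>\<omega> hs. ennreal (2 * \<delta> * \<delta> ^ t) * \<Phi> \<omega> hs)"
    proof (rule annE_cong_mono)
      fix \<omega> and hs :: "nat list list" assume *: "ok \<omega>" "length hs = Suc t"
      show "of_bool (Ev t \<omega> hs) \<le> ennreal (2 * \<delta> * \<delta> ^ t) * \<Phi> \<omega> hs"
      proof (cases "Ev t \<omega> hs")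
        case True
        have "1 = \<delta> ^ (2 * Suc t) * (1 / \<delta>) ^ (2 * Suc t)"
          unfolding power_mult_distrib[symmetric] using \<delta>(1) by simp
        also have "\<dots> \<le> \<delta> ^ (2 * Suc t) * ((1 + \<theta>) ^ Gd \<omega> hs)"
          using True *(2) \<delta> unfolding Ev_def by (intro mult_left_mono) auto
        also have "\<dots> = \<delta> ^ (2 * Suc t) * ((1 + \<theta>) ^ Gd \<omega> hs) * (2 * (1 / 2))" by simp
        also have "\<dots> \<le> \<delta> ^ (2 * Suc t) * ((1 + \<theta>) ^ Gd \<omega> hs) * (2 * \<psi> \<omega> hs)"
          using psi_bounds[OF *(1), of hs] \<delta> theta by (intro mult_left_mono) auto
        also have "\<dots> = (2 * \<delta> * \<delta> ^ t) * ((1 + \<theta>) ^ Gd \<omega> hs * \<delta> ^ length hs * \<psi> \<omega> hs)"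
        proof -
          have "\<delta> ^ (2 * Suc t) = \<delta> * \<delta> ^ t * \<delta> ^ Suc t"
            unfolding mult_2 power_add by simp
          then show ?thesis unfolding *(2) by (simp only: mult_ac)
        qed
        finally have "1 \<le> ennreal ((2 * \<delta> * \<delta> ^ t) * ((1 + \<theta>) ^ Gd \<omega> hs * \<delta> ^ length hs * \<psi> \<omega> hs))"
          by (simp add: ennreal_ge_1)
        also have "\<dots> = ennreal (2 * \<delta> * \<delta> ^ t) * \<Phi> \<omega> hs"
          unfolding \<Phi>_def \<delta>_def[symmetric] using \<delta> theta psi_nonneg[OF *(1), of hs] by (intro ennreal_mult) auto
        finally show ?thesis by (simp add: indicator_def)
      qed (simp add: indicator_def)
    qed
    also have "\<dots> = ennreal (2 * \<delta> * \<delta> ^ t) * annE t \<Phi>" by (rule annE_cmult) measurable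
    also have "\<dots> \<le> ennreal (2 * \<delta> * \<delta> ^ t) * 1" by (intro mult_left_mono annE_Phi_le_1) simp
    finally show ?thesis by simp
  qed
  have "(\<Sum>t. annE t (\<lambda>\<omega> hs. of_bool (Ev t \<omega> hs))) \<le> (\<Sum>t. ennreal (2 * \<delta> * \<delta> ^ t))"
    by (intro suminf_le le) auto
  also have "\<dots> = ennreal (\<Sum>t. 2 * \<delta> * \<delta> ^ t)"
    using \<delta> by (intro suminf_ennreal2) (auto intro!: summable_mult summable_geometric)
  also have "\<dots> < \<infinity>" by simp
  finally have "aew (\<lambda>\<omega> X. eventually (\<lambda>t. \<not> Ev t \<omega> (hist X t)) sequentially)"
    unfolding aew_def by (intro quenched_Borel_Cantelli) auto
  then show ?thesis
  proof (rule aew_mp2[OF _ aew_valid])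
    fix \<omega> X assume "eventually (\<lambda>t. \<not> Ev t \<omega> (hist X t)) sequentially"
    \<comment> \<open>Since \<open>Gd\<close> skips the current position, the history at time
      \<open>t + 1\<close>, of length \<open>t + 2\<close>, is needed to count everything visited by
      time \<open>t\<close>.\<close>
    then have "eventually (\<lambda>t. \<not> Ev (Suc t) \<omega> (hist X (Suc t))) sequentially"
      by (rule eventually_sequentially_Suc[THEN iffD2])
    then show "eventually (\<lambda>t. ngood T L \<omega> (hist X t) \<le> 16 * real (t + 2) / (M * (\<beta> * D))) sequentially"
    proof eventually_elim
      case (elim t)
      let ?G = "Gd \<omega> (hist X (Suc t))"
      have "(1 + \<theta>) ^ ?G < (1 + 1 / M) ^ (2 * (t + 2))"
        using elim by (simp add: Ev_def not_le \<delta>(3))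
      moreover have pos: "0 < 1 + \<theta>" "0 < 1 + 1 / M" using theta M by (simp_all add: add_pos_nonneg)
      ultimately have "ln ((1 + \<theta>) ^ ?G) < ln ((1 + 1 / M) ^ (2 * (t + 2)))"
        by (intro iffD2[OF ln_less_cancel_iff] zero_less_power)
      then have "real ?G * ln (1 + \<theta>) < real (2 * (t + 2)) * ln (1 + 1 / M)"
        unfolding ln_realpow .
      also have "\<dots> \<le> real (2 * (t + 2)) * (1 / M)"
        using M by (intro mult_left_mono ln_add_one_self_le_self) auto
      finally have 1: "real ?G * ln (1 + \<theta>) \<le> real (2 * (t + 2)) * (1 / M)" by simp
      have "\<theta> / 2 \<le> \<theta> - \<theta>\<^sup>2"
        using theta mult_left_mono[of \<theta> "1/2" \<theta>] by (simp add: power2_eq_square)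
      also have "\<dots> \<le> ln (1 + \<theta>)" using theta by (intro ln_one_plus_pos_lower_bound) auto
      finally have "real ?G * (\<theta> / 2) \<le> real ?G * ln (1 + \<theta>)" by (rule mult_left_mono) simp
      from order_trans[OF this 1] have le: "real ?G * (\<theta> / 2) \<le> real (2 * (t + 2)) * (1 / M)" .
      have "real ?G * (\<beta> * D) = 4 * (real ?G * (\<theta> / 2))" by (simp add: \<theta>_def)
      also have "\<dots> \<le> 4 * (real (2 * (t + 2)) * (1 / M))" using le by (rule mult_left_mono) simp
      also have "\<dots> = 8 * real (t + 2) / M" by simp
      finally have "real ?G * (\<beta> * D) \<le> 8 * real (t + 2) / M" .
      moreover have "0 < \<beta> * D" using \<beta> D by simp
      ultimately have "real ?G \<le> 8 * real (t + 2) / M / (\<beta> * D)" by (simp only: pos_le_divide_eq)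
      then have 2: "real ?G \<le> 8 * real (t + 2) / (M * (\<beta> * D))"
        by (simp only: divide_divide_eq_left)
      have "card {v\<in>set (hist X t). good T L \<omega> v} \<le> 2 * ?G"
        using card_good_le[of "hist X (Suc t)" \<omega>] by (simp add: hist_Suc split: if_splits)
      then have "ngood T L \<omega> (hist X t) \<le> 2 * real ?G" by linarith
      also have "\<dots> \<le> 2 * (8 * real (t + 2) / (M * (\<beta> * D)))" using 2 by (rule mult_left_mono) simp
      also have "\<dots> = 16 * real (t + 2) / (M * (\<beta> * D))" by (simp only: times_divide_eq_right mult.assoc[symmetric])
      finally show ?case .
    qed
  qed
qed

end

section \<open>Choice of the constants\<close>

lemma (in prob_space) eventually_prob_bounded_pos:
  fixes f :: "'a \<Rightarrow> real"
  assumes [measurable]: "f \<in> borel_measurable M" "Measurable.pred M A"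
    and pos: "0 < emeasure M {x\<in>space M. A x}"
  shows "eventually (\<lambda>L::nat. 0 < emeasure M {x\<in>space M. A x \<and> f x \<le> real L}) sequentially"
proof -
  define B where "B L = {x\<in>space M. A x \<and> f x \<le> real L}" for L :: nat
  have "(\<lambda>L. emeasure M (B L)) \<longlonglongrightarrow> emeasure M (\<Union>L. B L)"
    by (rule Lim_emeasure_incseq) (auto simp: B_def incseq_def)
  also have "(\<Union>L. B L) = {x\<in>space M. A x}"
    by (auto simp: B_def) (meson real_arch_simple)
  finally show ?thesis using pos unfolding B_def by (rule order_tendstoD)
qed

text \<open>Translates a lower bound for an expected loss into the form required by the hypotheses
  of \<open>gw_trap\<close>.\<close>

lemma (in prob_space) nn_integral_one_minus_le:
  fixes g :: "'a \<Rightarrow> real"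
  assumes [measurable]: "g \<in> borel_measurable M"
    and bd: "AE x in M. 0 \<le> g x \<and> g x \<le> 1"
    and d: "0 \<le> d" "ennreal d \<le> (\<integral>\<^sup>+x. ennreal (g x) \<partial>M)"
  shows "(\<integral>\<^sup>+x. ennreal (1 - g x) \<partial>M) \<le> ennreal (1 - d)"
proof -
  have i: "integrable M g"
    by (rule integrable_const_bound[of _ 1]) (use bd in auto)
  have "(\<integral>\<^sup>+x. ennreal (g x) \<partial>M) = ennreal (\<integral>x. g x \<partial>M)"
    by (rule nn_integral_eq_integral[OF i]) (use bd in auto)
  moreover have "0 \<le> (\<integral>x. g x \<partial>M)" by (rule integral_nonneg_AE) (use bd in auto)
  ultimately have le: "d \<le> (\<integral>x. g x \<partial>M)" using d by simp
  have "(\<integral>\<^sup>+x. ennreal (1 - g x) \<partial>M) = ennreal (\<integral>x. 1 - g x \<partial>M)"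
    by (rule nn_integral_eq_integral) (use i bd in auto)
  also have "(\<integral>x. 1 - g x \<partial>M) = 1 - (\<integral>x. g x \<partial>M)" using i by (simp add: prob_space)
  finally show ?thesis using le by (simp add: ennreal_leI)
qed

section \<open>Integrals over the children of one vertex\<close>

context gw_env
begin

lemma nn_integral_PN_component:
  "f \<in> borel_measurable MV \<Longrightarrow> (\<integral>\<^sup>+\<eta>. f (\<eta> j) \<partial>PN) = (\<integral>\<^sup>+z. f z \<partial>MV)"
  unfolding PN_def by (rule nn_integral_PiM_component[OF prob_space_MV])

text \<open>Dropping conductances below 1 costs the mean at most 1, and fixing the child's index
  costs the positive factor \<open>pmf p m\<close>. The restriction to values at least 1 is the one
  made in \<open>entered\<close>, where it keeps the crossing probability above
  \<open>1 / (1 + 2 * L)\<close>.\<close>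

lemma heavy_edge_integral:
  assumes km: "1 \<le> k" "1 \<le> m" and pm: "0 < pmf p m" and inf: "(\<integral>\<^sup>+x. ennreal x \<partial>\<mu>t k m) = \<infinity>"
  shows "(\<integral>\<^sup>+z. (if fst z = m \<and> 1 \<le> cn k z then ennreal (cn k z) else 0) \<partial>MV) = \<infinity>"
proof -
  interpret B: prob_space "\<Pi>\<^sub>M km\<in>UNIV. cond_law \<mu>t km"
    by (rule prob_space_PiM) (rule prob_space_cond_law)
  interpret C: prob_space "cond_law \<mu>t (k, m)" by (rule prob_space_cond_law)
  let ?f = "\<lambda>x. if 1 \<le> x then ennreal x else 0"
  have cl: "cond_law \<mu>t (k, m) = \<mu>t k m" using km by (simp add: cond_law_def)
  have [measurable]: "?f \<in> borel_measurable (cond_law \<mu>t (k, m))"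
    by (subst measurable_cong_sets[OF sets_cond_law refl]) measurable
  have id: "(\<lambda>x. x) \<in> borel_measurable (cond_law \<mu>t (k, m))"
    by (subst measurable_cong_sets[OF sets_cond_law refl]) measurable
  have "\<infinity> = (\<integral>\<^sup>+x. ennreal x \<partial>cond_law \<mu>t (k, m))" using inf cl by simp
  also have "\<dots> \<le> (\<integral>\<^sup>+x. 1 + ?f x \<partial>cond_law \<mu>t (k, m))"
    by (intro nn_integral_mono) (auto simp: ennreal_le_1 add_increasing)
  also have "\<dots> = 1 + (\<integral>\<^sup>+x. ?f x \<partial>cond_law \<mu>t (k, m))"
    by (subst nn_integral_add) (auto simp: C.emeasure_space_1)
  finally have f_inf: "(\<integral>\<^sup>+x. ?f x \<partial>cond_law \<mu>t (k, m)) = \<infinity>" by (simp add: top_unique)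
  have "distr (\<Pi>\<^sub>M km\<in>UNIV. cond_law \<mu>t km) (cond_law \<mu>t (k, m)) (\<lambda>\<xi>. \<xi> (k, m)) = cond_law \<mu>t (k, m)"
    by (rule distr_PiM_component) (auto intro: prob_space_cond_law)
  then have "(\<integral>\<^sup>+x. ?f x \<partial>cond_law \<mu>t (k, m)) =
      (\<integral>\<^sup>+x. ?f x \<partial>distr (\<Pi>\<^sub>M km\<in>UNIV. cond_law \<mu>t km) (cond_law \<mu>t (k, m)) (\<lambda>\<xi>. \<xi> (k, m)))" by simp
  also have "\<dots> = (\<integral>\<^sup>+\<xi>. ?f (\<xi> (k, m)) \<partial>(\<Pi>\<^sub>M km\<in>UNIV. cond_law \<mu>t km))"
    by (rule nn_integral_distr) measurable
  finally have inner: "(\<integral>\<^sup>+\<xi>. ?f (\<xi> (k, m)) \<partial>(\<Pi>\<^sub>M km\<in>UNIV. cond_law \<mu>t km)) = \<infinity>" using f_inf by simp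
  define G where "G z = (if fst z = m \<and> 1 \<le> cn k z then ennreal (cn k z) else 0)" for z :: mark
  have "G \<in> borel_measurable MV" unfolding G_def by measurable
  then have Gm: "G \<in> borel_measurable (measure_pmf p \<Otimes>\<^sub>M (\<Pi>\<^sub>M km\<in>UNIV. cond_law \<mu>t km))"
    by (simp add: MV_def)
  have "(\<integral>\<^sup>+z. G z \<partial>MV) = (\<integral>\<^sup>+N. \<integral>\<^sup>+\<xi>. G (N, \<xi>) \<partial>(\<Pi>\<^sub>M km\<in>UNIV. cond_law \<mu>t km) \<partial>measure_pmf p)"
    unfolding MV_def by (rule B.nn_integral_fst[symmetric, OF Gm])
  also have "\<dots> = (\<integral>\<^sup>+N. ennreal (pmf p N) * (\<integral>\<^sup>+\<xi>. G (N, \<xi>) \<partial>(\<Pi>\<^sub>M km\<in>UNIV. cond_law \<mu>t km)) \<partial>count_space UNIV)"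
    by (rule nn_integral_measure_pmf)
  also have "\<dots> \<ge> ennreal (pmf p m) * (\<integral>\<^sup>+\<xi>. G (m, \<xi>) \<partial>(\<Pi>\<^sub>M km\<in>UNIV. cond_law \<mu>t km))"
    by (rule nn_integral_ge_point) simp
  also have "(\<integral>\<^sup>+\<xi>. G (m, \<xi>) \<partial>(\<Pi>\<^sub>M km\<in>UNIV. cond_law \<mu>t km)) = \<infinity>"
    using inner unfolding G_def cn_def fst_conv snd_conv by simp
  finally show ?thesis using pm by (simp add: G_def ennreal_mult_top top_unique)
qed

lemma truncated_integral_unbounded:
  assumes km: "1 \<le> k" "1 \<le> m" and pm: "0 < pmf p m" and inf: "(\<integral>\<^sup>+x. ennreal x \<partial>\<mu>t k m) = \<infinity>"
  shows "\<exists>n\<ge>1::nat. ennreal K < (\<integral>\<^sup>+z. (if fst z = m \<and> 1 \<le> cn k z then ennreal (min (cn k z) (real n)) else 0) \<partial>MV)"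
proof -
  define g where "g n z = (if fst z = m \<and> 1 \<le> cn k z then ennreal (min (cn k z) (real n)) else 0)" for n :: nat and z :: mark
  have gm[measurable]: "g n \<in> borel_measurable MV" for n unfolding g_def by measurable
  have inc: "incseq g" by (auto simp: incseq_def le_fun_def g_def intro!: ennreal_leI)
  have sup: "(SUP n. g n z) = (if fst z = m \<and> 1 \<le> cn k z then ennreal (cn k z) else 0)" for z
  proof (cases "fst z = m \<and> 1 \<le> cn k z")
    case True
    obtain n where "cn k z \<le> real n" using real_arch_simple by blast
    then have n: "g n z = ennreal (cn k z)" using True by (simp add: g_def min_def)
    show ?thesis
    proof (rule antisym)
      show "(SUP n. g n z) \<le> (if fst z = m \<and> 1 \<le> cn k z then ennreal (cn k z) else 0)"
        by (rule SUP_least) (auto simp: g_def intro!: ennreal_leI)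
      show "(if fst z = m \<and> 1 \<le> cn k z then ennreal (cn k z) else 0) \<le> (SUP n. g n z)"
        using True n by (simp add: SUP_upper2[of n])
    qed
  next
    case False
    then have "g n z = 0" for n by (auto simp: g_def)
    then show ?thesis using False by auto
  qed
  have "(SUP n. \<integral>\<^sup>+z. g n z \<partial>MV) = (\<integral>\<^sup>+z. (SUP n. g n z) \<partial>MV)"
    by (rule nn_integral_monotone_convergence_SUP[symmetric, OF inc gm])
  also have "\<dots> = \<infinity>" unfolding sup by (rule heavy_edge_integral[OF assms])
  finally have "ennreal K < (SUP n. \<integral>\<^sup>+z. g n z \<partial>MV)"
    by (metis ennreal_less_top infinity_ennreal_def)
  then obtain n where n: "ennreal K < (\<integral>\<^sup>+z. g n z \<partial>MV)" by (auto simp: less_SUP_iff)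
  have "(\<integral>\<^sup>+z. g n z \<partial>MV) \<le> (\<integral>\<^sup>+z. g (max 1 n) z \<partial>MV)"
    by (intro nn_integral_mono le_funD[OF incseqD[OF inc]]) simp
  with n have "ennreal K < (\<integral>\<^sup>+z. g (max 1 n) z \<partial>MV)" by (rule less_le_trans)
  then show ?thesis unfolding g_def by (intro exI[of _ "max 1 n"]) simp
qed

lemma measurable_sum_cn_PN[measurable]: "(\<lambda>\<eta>. \<Sum>j\<in>J. cn a (\<eta> j)) \<in> borel_measurable PN"
  by measurable

text \<open>Resampling child \<open>0\<close> leaves the sum over its siblings unchanged.\<close>

lemma nn_integral_PN_indep:
  assumes [measurable]: "f \<in> borel_measurable MV"
  shows "(\<integral>\<^sup>+\<eta>. (if (\<Sum>j\<in>{1..<k}. cn a (\<eta> j)) \<le> L then f (\<eta> 0) else 0) \<partial>PN) =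
    emeasure PN {\<eta>. (\<Sum>j\<in>{1..<k}. cn a (\<eta> j)) \<le> L} * (\<integral>\<^sup>+z. f z \<partial>MV)"
proof -
  let ?B = "{\<eta>. (\<Sum>j\<in>{1..<k}. cn a (\<eta> j)) \<le> L}"
  have B: "?B \<in> sets PN" using measurable_sets[OF measurable_sum_cn_PN[of a "{1..<k}"], of "{..L}"] by (simp add: vimage_def)
  have m: "(\<lambda>\<eta>. if (\<Sum>j\<in>{1..<k}. cn a (\<eta> j)) \<le> L then f (\<eta> 0) else 0) \<in> borel_measurable (PiM UNIV (\<lambda>_::nat. MV))"
    unfolding PN_def[symmetric] by measurable
  have s: "(\<Sum>j\<in>{1..<k}. cn a (fun_upd \<eta> 0 z j)) = (\<Sum>j\<in>{1..<k}. cn a (\<eta> j))" for \<eta> z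
    by (rule sum.cong) auto
  have "(\<integral>\<^sup>+\<eta>. (if (\<Sum>j\<in>{1..<k}. cn a (\<eta> j)) \<le> L then f (\<eta> 0) else 0) \<partial>PN) =
     (\<integral>\<^sup>+\<eta>. \<integral>\<^sup>+z. (if (\<Sum>j\<in>{1..<k}. cn a (\<eta> j)) \<le> L then f z else 0) \<partial>MV \<partial>PN)"
    unfolding PN_def nn_integral_PiM_upd[OF prob_space_MV m, of 0] s fun_upd_same ..
  also have "\<dots> = (\<integral>\<^sup>+\<eta>. (\<integral>\<^sup>+z. f z \<partial>MV) * indicator ?B \<eta> \<partial>PN)"
    by (rule nn_integral_cong) (simp add: indicator_def)
  also have "\<dots> = (\<integral>\<^sup>+z. f z \<partial>MV) * emeasure PN ?B" by (rule nn_integral_cmult_indicator[OF B])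
  finally show ?thesis by (simp add: mult.commute)
qed

lemma AE_cn_pos: "AE \<eta> in PN. \<forall>j a. 0 < cn a (\<eta> j)"
  using AE_okm_PN by eventually_elim (simp add: cn_def okm_def)

text \<open>Child \<open>0\<close> has index \<open>k\<close> with probability
  \<open>pmf p k\<close>, and for large \<open>L\<close> its conductance stays below
  \<open>L\<close> on part of that event. There the ratio is strictly positive because all
  conductances are positive and finitely many.\<close>

lemma eventually_good_step_pos:
  assumes pk: "0 < pmf p k" and a: "1 \<le> a"
  shows "eventually (\<lambda>L::nat. 0 < (\<integral>\<^sup>+\<eta>. ennreal (down k a (real L) \<eta>) \<partial>PN)) sequentially"
proof -
  have "emeasure PN {\<eta>\<in>space PN. fst (\<eta> 0) = k} = (\<integral>\<^sup>+\<eta>. indicator {k} (fst (\<eta> 0)) \<partial>PN)"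
  proof -
    have "{\<eta>\<in>space PN. fst (\<eta> 0) = k} \<in> sets PN" by measurable
    then have "emeasure PN {\<eta>\<in>space PN. fst (\<eta> 0) = k} = (\<integral>\<^sup>+\<eta>. indicator {\<eta>\<in>space PN. fst (\<eta> 0) = k} \<eta> \<partial>PN)"
      by (rule nn_integral_indicator[symmetric])
    also have "\<dots> = (\<integral>\<^sup>+\<eta>. indicator {k} (fst (\<eta> 0)) \<partial>PN)"
      by (rule nn_integral_cong) (simp add: indicator_def)
    finally show ?thesis .
  qed
  also have "\<dots> = (\<integral>\<^sup>+z. indicator {k} (fst z) \<partial>MV)"
    by (rule nn_integral_PN_component[of "\<lambda>z. indicator {k} (fst z)"]) (simp add: indicator_def)
  also have "\<dots> = (\<integral>\<^sup>+N. indicator {k} N \<partial>measure_pmf p)" by (rule nn_integral_MV_fst)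
  also have "\<dots> = ennreal (pmf p k)" by (simp add: emeasure_pmf_single)
  finally have "0 < emeasure PN {\<eta>\<in>space PN. fst (\<eta> 0) = k}" using pk by simp
  then have "eventually (\<lambda>L::nat. 0 < emeasure PN {\<eta>\<in>space PN. fst (\<eta> 0) = k \<and> cn a (\<eta> 0) \<le> real L}) sequentially"
    by (intro PN.eventually_prob_bounded_pos[OF measurable_cn_PN]) auto
  then show ?thesis
  proof eventually_elim
    case (elim L)
    let ?h = "\<lambda>\<eta>. ennreal (down k a (real L) \<eta>)"
    have hm: "?h \<in> borel_measurable PN" by measurable
    show ?case
    proof (rule ccontr)
      assume "\<not> 0 < (\<integral>\<^sup>+\<eta>. ?h \<eta> \<partial>PN)"
      then have "(\<integral>\<^sup>+\<eta>. ?h \<eta> \<partial>PN) = 0" by (simp add: not_less)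
      then have "AE \<eta> in PN. ?h \<eta> = 0" using nn_integral_0_iff_AE[OF hm] by blast
      then have "AE \<eta> in PN. \<not> (fst (\<eta> 0) = k \<and> cn a (\<eta> 0) \<le> real L)"
        using AE_cn_pos
      proof eventually_elim
        case (elim \<eta>)
        have "0 < (\<Sum>j<a. cn a (\<eta> j))" using a elim(2) by (intro sum_pos) (auto simp: lessThan_empty_iff)
        then have "0 < cn a (\<eta> 0) / (real L + (\<Sum>j<a. cn a (\<eta> j)))" using elim(2) by simp
        then show ?case using elim(1) by (auto simp: ennreal_eq_0_iff split: if_splits)
      qed
      then have "emeasure PN {\<eta>\<in>space PN. fst (\<eta> 0) = k \<and> cn a (\<eta> 0) \<le> real L} = 0"
        by (intro emeasure_eq_0_AE) auto
      with elim show False by simp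
    qed
  qed
qed

text \<open>The order of choice matters: \<open>r\<close>, \<open>c\<close>,
  \<open>\<kappa>1\<close>, \<open>\<beta>\<close> and hence \<open>C\<close> depend on
  \<open>T\<close> and \<open>L\<close> only, and the truncation level \<open>M\<close> is taken
  last. Even if \<open>D\<close> becomes small, \<open>M * (\<beta> * D) = C * J\<close> is as large
  as desired because \<open>J\<close> is an unbounded truncated mean.\<close>

lemma aew_good_sublinear:
  assumes km: "1 \<le> k" "1 \<le> m" and pk: "0 < pmf p k" and pm: "0 < pmf p m"
    and inf: "(\<integral>\<^sup>+x. ennreal x \<partial>\<mu>t k m) = \<infinity>" and T: "k \<le> T" and \<epsilon>: "0 < \<epsilon>"
  shows "eventually (\<lambda>L::nat. aew (\<lambda>\<omega> X. eventually (\<lambda>t. ngood T (real L) \<omega> (hist X t) \<le> \<epsilon> * real t) sequentially)) sequentially"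
proof -
  have pos: "eventually (\<lambda>L::nat. 0 < emeasure PN {\<eta>. (\<Sum>j\<in>J. cn a (\<eta> j)) \<le> real L}) sequentially" for a :: nat and J
    using PN.eventually_prob_bounded_pos[of "\<lambda>\<eta>. \<Sum>j\<in>J. cn a (\<eta> j)" "\<lambda>_. True"] PN.emeasure_space_1 by simp
  have pos1: "eventually (\<lambda>L::nat. 0 < emeasure PN {\<eta>. (\<Sum>j\<in>{1..<k}. cn k (\<eta> j)) \<le> real L}) sequentially"
    and pos2: "eventually (\<lambda>L::nat. 0 < emeasure PN {\<eta>. (\<Sum>j\<in>{..<m}. cn m (\<eta> j)) \<le> real L}) sequentially"
    by (rule pos)+
  have steps: "eventually (\<lambda>L::nat. \<forall>a\<in>{1..T}. 0 < (\<integral>\<^sup>+\<eta>. ennreal (down k a (real L) \<eta>) \<partial>PN)) sequentially"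
    by (intro eventually_ball_finite ballI eventually_good_step_pos pk) auto
  show ?thesis
    using pos1 pos2 steps eventually_ge_at_top[of "1::nat"]
  proof eventually_elim
    case (elim n)
    define L where "L = real n"
    have L: "1 \<le> L" using elim(4) by (simp add: L_def)
    define r where "r = 1 / (1 + 2 * L)"
    have r: "0 < r" "r \<le> 1" using L by (auto simp: r_def)
    define E1 where "E1 = {\<eta>. (\<Sum>j\<in>{1..<k}. cn k (\<eta> j)) \<le> L}"
    define E2 where "E2 = {\<eta>. (\<Sum>j<m. cn m (\<eta> j)) \<le> 2 * L}"
    have E1m: "E1 \<in> sets PN" using measurable_sets[OF measurable_sum_cn_PN[of k "{1..<k}"], of "{..L}"] by (simp add: vimage_def E1_def)
    have E2m: "E2 \<in> sets PN" using measurable_sets[OF measurable_sum_cn_PN[of m "{..<m}"], of "{..2 * L}"] by (simp add: vimage_def E2_def)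
    define \<kappa>1 where "\<kappa>1 = measure PN E1"
    define \<kappa>2 where "\<kappa>2 = measure PN E2"
    have \<kappa>1: "0 < \<kappa>1" "\<kappa>1 \<le> 1" "emeasure PN E1 = ennreal \<kappa>1"
      using elim(1) by (simp_all add: \<kappa>1_def E1_def L_def PN.emeasure_eq_measure)
    have "emeasure PN {\<eta>. (\<Sum>j\<in>{..<m}. cn m (\<eta> j)) \<le> real n} \<le> emeasure PN E2"
      by (rule emeasure_mono[OF _ E2m]) (auto simp: E2_def L_def)
    with elim(2) have "0 < emeasure PN E2" by (rule less_le_trans)
    then have \<kappa>2: "0 < \<kappa>2" "\<kappa>2 \<le> 1" "emeasure PN E2 = ennreal \<kappa>2"
      by (simp_all add: \<kappa>2_def PN.emeasure_eq_measure)
    \<comment> \<open>The conductances below the lower end are small with probability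
      \<open>\<kappa>2\<close>, and then the walk returns to the upper end with probability at least
      \<open>r\<close>.\<close>
    define c where "c = r * \<kappa>2"
    have c: "0 < c" "c \<le> 1" using r \<kappa>2 mult_mono[of r 1 \<kappa>2 1] by (auto simp: c_def)
    define h where "h a \<eta> = (down k a L \<eta>)" for a \<eta>
    have hm[measurable]: "h a \<in> borel_measurable PN" for a unfolding h_def by measurable
    have h01: "AE \<eta> in PN. 0 \<le> h a \<eta> \<and> h a \<eta> \<le> 1" if "1 \<le> a" for a
      using AE_cn_pos
    proof eventually_elim
      case (elim \<eta>)
      have "0 \<le> (\<Sum>j<a. cn a (\<eta> j))" using elim by (intro sum_nonneg) (auto intro: less_imp_le)
      moreover have "cn a (\<eta> 0) \<le> (\<Sum>j<a. cn a (\<eta> j))"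
        using elim that by (intro member_le_sum) (auto intro: less_imp_le)
      ultimately show ?case using elim L by (auto simp: h_def less_imp_le)
    qed
    define b where "b a = enn2real (\<integral>\<^sup>+\<eta>. ennreal (h a \<eta>) \<partial>PN)" for a
    have b: "0 < b a" "b a \<le> 1" "(\<integral>\<^sup>+\<eta>. ennreal (h a \<eta>) \<partial>PN) = ennreal (b a)" if "a \<in> {1..T}" for a
    proof -
      have "(\<integral>\<^sup>+\<eta>. ennreal (h a \<eta>) \<partial>PN) \<le> (\<integral>\<^sup>+\<eta>. 1 \<partial>PN)"
        by (rule nn_integral_mono_AE, use h01[of a] that in \<open>auto elim!: eventually_mono simp: ennreal_le_1\<close>)
      then have le: "(\<integral>\<^sup>+\<eta>. ennreal (h a \<eta>) \<partial>PN) \<le> 1" using PN.emeasure_space_1 by simp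
      then show eq: "(\<integral>\<^sup>+\<eta>. ennreal (h a \<eta>) \<partial>PN) = ennreal (b a)"
        unfolding b_def by (intro ennreal_enn2real[symmetric]) (auto simp: less_top[symmetric] top_unique)
      have "0 < (\<integral>\<^sup>+\<eta>. ennreal (h a \<eta>) \<partial>PN)"
        using elim(3) that unfolding h_def L_def by blast
      then show "0 < b a" unfolding eq by simp
      show "b a \<le> 1" using le unfolding eq by (simp add: ennreal_le_1)
    qed
    \<comment> \<open>The minimum is positive because a good vertex has one of finitely many
      indices; this is the purpose of the bound \<open>T\<close>.\<close>
    define \<beta> where "\<beta> = Min (b ` {1..T})"
    have ne: "b ` {1..T} \<noteq> {}" using km T by auto
    have \<beta>_le: "\<beta> \<le> b a" if "a \<in> {1..T}" for a unfolding \<beta>_def using that by (intro Min_le) auto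
    have \<beta>0: "0 < \<beta>" unfolding \<beta>_def using ne b by (subst Min_gr_iff) auto
    have \<beta>1: "\<beta> \<le> 1" using \<beta>_le[of k] b(2)[of k] km T by auto
    define C where "C = \<beta> * (r * c * \<kappa>1 * r)"
    have C: "0 < C" using \<beta>0 r c \<kappa>1 by (simp add: C_def)
    obtain N where N: "1 \<le> N" "ennreal (32 / (C * \<epsilon>)) <
       (\<integral>\<^sup>+z. (if fst z = m \<and> 1 \<le> cn k z then ennreal (min (cn k z) (real N)) else 0) \<partial>MV)"
      using truncated_integral_unbounded[OF km pm inf] by blast
    define M where "M = real N"
    have M: "1 \<le> M" using N by (simp add: M_def)
    define f where "f z = (if fst z = m \<and> 1 \<le> cn k z then ennreal (min (cn k z) M) else 0)" for z :: mark
    have fm[measurable]: "f \<in> borel_measurable MV" unfolding f_def by measurable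
    have "(\<integral>\<^sup>+z. f z \<partial>MV) \<le> (\<integral>\<^sup>+z. ennreal M \<partial>MV)"
      by (intro nn_integral_mono) (auto simp: f_def intro!: ennreal_leI)
    then have fle: "(\<integral>\<^sup>+z. f z \<partial>MV) \<le> ennreal M" using MV.emeasure_space_1 by simp
    obtain J where J: "0 \<le> J" "(\<integral>\<^sup>+z. f z \<partial>MV) = ennreal J"
      using fle by (cases "\<integral>\<^sup>+z. f z \<partial>MV") (auto simp: top_unique)
    have JM: "J \<le> M" using fle J M by simp
    have "ennreal (32 / (C * \<epsilon>)) < ennreal J" using N(2) unfolding J(2)[symmetric] f_def M_def .
    then have Jbig: "32 / (C * \<epsilon>) < J" using C \<epsilon> by (simp add: ennreal_less_iff)
    then have J0: "0 < J" using C \<epsilon> less_trans[of 0 "32 / (C * \<epsilon>)" J] by simp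
    \<comment> \<open>One \<open>r\<close> bounds the step to the lower end, the other is the
      normalisation inside \<open>trap_gain\<close>. \<open>\<kappa>1\<close> is the probability of
      light siblings, and \<open>c\<close> is the share of the gain credited on arrival at the lower
      end.\<close>
    define D where "D = r * c * \<kappa>1 * r * J / M"
    have D0: "0 < D" using r c \<kappa>1 J0 M by (simp add: D_def)
    have D1: "D \<le> 1"
    proof -
      have "r * c * \<kappa>1 * r * (J / M) \<le> 1 * 1 * 1 * 1 * 1"
        using r c \<kappa>1 J0 M JM by (intro mult_mono) auto
      then show ?thesis by (simp add: D_def)
    qed
    interpret gw_trap p \<mu>t k m T L M c D \<beta>
    proof
      fix F :: real assume F: "0 \<le> F" "F \<le> 1"
      have "(\<integral>\<^sup>+\<eta>. ennreal (1 - (if (\<Sum>j<m. cn m (\<eta> j)) \<le> 2 * L then r else 0) * F) \<partial>PN) \<le> ennreal (1 - c * F)"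
      proof (rule PN.nn_integral_one_minus_le)
        show "AE \<eta> in PN. 0 \<le> (if (\<Sum>j<m. cn m (\<eta> j)) \<le> 2 * L then r else 0) * F \<and>
           (if (\<Sum>j<m. cn m (\<eta> j)) \<le> 2 * L then r else 0) * F \<le> 1"
          using F r mult_mono[of r 1 F 1] by (intro AE_I2) auto
        have "(\<integral>\<^sup>+\<eta>. ennreal ((if (\<Sum>j<m. cn m (\<eta> j)) \<le> 2 * L then r else 0) * F) \<partial>PN) =
           (\<integral>\<^sup>+\<eta>. ennreal (r * F) * indicator E2 \<eta> \<partial>PN)"
          by (rule nn_integral_cong) (simp add: indicator_def E2_def)
        also have "\<dots> = ennreal (r * F) * emeasure PN E2" by (rule nn_integral_cmult_indicator[OF E2m])
        also have "\<dots> = ennreal (c * F)" using F r \<kappa>2 by (simp add: c_def ennreal_mult[symmetric] mult_ac)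
        finally show "ennreal (c * F) \<le> (\<integral>\<^sup>+\<eta>. ennreal ((if (\<Sum>j<m. cn m (\<eta> j)) \<le> 2 * L then r else 0) * F) \<partial>PN)" by simp
      qed (use F c in auto)
      then show "(\<integral>\<^sup>+\<eta>. ennreal (1 - (if (\<Sum>j<m. cn m (\<eta> j)) \<le> 2 * L then 1 / (1 + 2 * L) else 0) * F) \<partial>PN) \<le> ennreal (1 - c * F)"
        by (simp only: r_def)
    next
      define g where "g \<eta> = (if fst (\<eta> 0) = m \<and> (\<Sum>j\<in>{1..<k}. cn k (\<eta> j)) \<le> L \<and> 1 \<le> cn k (\<eta> 0)
        then r * (c * trap_gain L M (cn k (\<eta> 0))) else 0)" for \<eta> :: "nat \<Rightarrow> mark"
      have tg: "0 \<le> trap_gain L M x" "trap_gain L M x \<le> 1" if "1 \<le> x" for x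
        using trap_gain_bounds[OF L M, of x] that by auto
      have "(\<integral>\<^sup>+\<eta>. ennreal (1 - g \<eta>) \<partial>PN) \<le> ennreal (1 - D)"
      proof (rule PN.nn_integral_one_minus_le)
        show "g \<in> borel_measurable PN" unfolding g_def trap_gain_def by measurable
        have "0 \<le> r * (c * trap_gain L M x) \<and> r * (c * trap_gain L M x) \<le> 1 * (1 * 1)" if "1 \<le> x" for x
          using tg[OF that] r c by (intro conjI mult_nonneg_nonneg mult_mono) auto
        then show "AE \<eta> in PN. 0 \<le> g \<eta> \<and> g \<eta> \<le> 1" by (intro AE_I2) (auto simp: g_def)
        have "(\<integral>\<^sup>+\<eta>. ennreal (g \<eta>) \<partial>PN) = (\<integral>\<^sup>+\<eta>. (if (\<Sum>j\<in>{1..<k}. cn k (\<eta> j)) \<le> L then ennreal (r * c * r / M) * f (\<eta> 0) else 0) \<partial>PN)"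
        proof (rule nn_integral_cong)
          fix \<eta>
          have "r * (c * trap_gain L M x) = r * c * r / M * min x M" for x
            by (simp add: trap_gain_def r_def)
          then show "ennreal (g \<eta>) = (if (\<Sum>j\<in>{1..<k}. cn k (\<eta> j)) \<le> L then ennreal (r * c * r / M) * f (\<eta> 0) else 0)"
            using r c M by (auto simp: g_def f_def ennreal_mult[symmetric])
        qed
        also have "\<dots> = emeasure PN {\<eta>. (\<Sum>j\<in>{1..<k}. cn k (\<eta> j)) \<le> L} * (\<integral>\<^sup>+z. ennreal (r * c * r / M) * f z \<partial>MV)"
          by (rule nn_integral_PN_indep) measurable
        also have "\<dots> = ennreal \<kappa>1 * (ennreal (r * c * r / M) * ennreal J)"
          using \<kappa>1(3) J(2) by (simp add: nn_integral_cmult E1_def)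
        also have "\<dots> = ennreal (\<kappa>1 * (r * c * r / M * J))"
        proof -
          have "ennreal (r * c * r / M) * ennreal J = ennreal (r * c * r / M * J)"
            using r c M J by (intro ennreal_mult[symmetric]) auto
          moreover have "ennreal \<kappa>1 * ennreal (r * c * r / M * J) = ennreal (\<kappa>1 * (r * c * r / M * J))"
            using r c M J \<kappa>1 by (intro ennreal_mult[symmetric]) auto
          ultimately show ?thesis by simp
        qed
        also have "\<kappa>1 * (r * c * r / M * J) = D" by (simp add: D_def)
        finally show "ennreal D \<le> (\<integral>\<^sup>+\<eta>. ennreal (g \<eta>) \<partial>PN)" by simp
      qed (use D0 in simp)
      then show "(\<integral>\<^sup>+\<eta>. ennreal (1 - (if fst (\<eta> 0) = m \<and> (\<Sum>j\<in>{1..<k}. cn k (\<eta> j)) \<le> L \<and> 1 \<le> cn k (\<eta> 0)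
        then 1 / (1 + 2 * L) * (c * trap_gain L M (cn k (\<eta> 0))) else 0)) \<partial>PN) \<le> ennreal (1 - D)"
        by (simp only: g_def r_def)
    next
      fix a :: nat assume a: "1 \<le> a" "a \<le> T"
      have "(\<integral>\<^sup>+\<eta>. ennreal (1 - h a \<eta> * (D / 2)) \<partial>PN) \<le> ennreal (1 - \<beta> * D / 2)"
      proof (rule PN.nn_integral_one_minus_le)
        show "AE \<eta> in PN. 0 \<le> h a \<eta> * (D / 2) \<and> h a \<eta> * (D / 2) \<le> 1"
          using h01[OF a(1)]
        proof eventually_elim
          case (elim \<eta>)
          then show ?case using D0 D1 mult_mono[of "h a \<eta>" 1 "D / 2" 1] by auto
        qed
        have "ennreal (\<beta> * D / 2) \<le> ennreal (b a * (D / 2))"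
          using \<beta>_le[of a] a D0 by (intro ennreal_leI) (simp add: mult_right_mono)
        also have "\<dots> = ennreal (b a) * ennreal (D / 2)"
          by (rule ennreal_mult) (use b(1)[of a] a D0 in auto)
        also have "\<dots> = (\<integral>\<^sup>+\<eta>. ennreal (h a \<eta>) \<partial>PN) * ennreal (D / 2)"
          using b(3)[of a] a by simp
        also have "\<dots> = (\<integral>\<^sup>+\<eta>. ennreal (h a \<eta>) * ennreal (D / 2) \<partial>PN)"
          by (rule nn_integral_multc[symmetric]) measurable
        also have "\<dots> = (\<integral>\<^sup>+\<eta>. ennreal (h a \<eta> * (D / 2)) \<partial>PN)"
          using D0 by (intro nn_integral_cong_AE, use h01[OF a(1)] in eventually_elim) (intro ennreal_mult[symmetric], auto)
        finally show "ennreal (\<beta> * D / 2) \<le> (\<integral>\<^sup>+\<eta>. ennreal (h a \<eta> * (D / 2)) \<partial>PN)" .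
      qed (use D0 \<beta>0 in auto)
      then show "(\<integral>\<^sup>+\<eta>. ennreal (1 - (down k a L \<eta>) * (D / 2)) \<partial>PN)
        \<le> ennreal (1 - \<beta> * D / 2)" by (simp only: h_def)
    qed (use km T L M c D0 D1 \<beta>0 \<beta>1 in auto)
    have MD: "M * (\<beta> * D) = C * J" using M by (simp add: C_def D_def)
    have CJ: "32 / \<epsilon> \<le> C * J"
    proof -
      have "32 / \<epsilon> = C * (32 / (C * \<epsilon>))" using C by simp
      also have "\<dots> \<le> C * J" using Jbig C by (intro mult_left_mono) auto
      finally show ?thesis .
    qed
    show ?case
    proof (rule aew_mp2[OF aew_good aew_valid])
      fix \<omega> X
      assume "eventually (\<lambda>t. ngood T L \<omega> (hist X t) \<le> 16 * real (t + 2) / (M * (\<beta> * D))) sequentially"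
      then show "eventually (\<lambda>t. ngood T (real n) \<omega> (hist X t) \<le> \<epsilon> * real t) sequentially"
        using eventually_ge_at_top[of 2]
      proof eventually_elim
        case (elim t)
        \<comment> \<open>The 32 in the choice of \<open>J\<close> is twice this 16: it leaves
          \<open>\<epsilon> * (t + 2) / 2\<close>, which is at most \<open>\<epsilon> * t\<close>
          from \<open>t = 2\<close> on.\<close>
        have "16 * real (t + 2) / (M * (\<beta> * D)) \<le> 16 * real (t + 2) / (32 / \<epsilon>)"
          unfolding MD using CJ \<epsilon> C J0 by (intro divide_left_mono mult_pos_pos) auto
        also have "\<dots> = \<epsilon> * (real (t + 2) / 2)" using \<epsilon> by simp
        also have "\<dots> \<le> \<epsilon> * real t" using \<epsilon> elim(2) by (intro mult_left_mono) auto
        finally show ?case using elim(1) by (simp add: L_def)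
      qed
    qed
  qed
qed

section \<open>From the size of the range to the speed\<close>

lemma length_less_card_closed:
  assumes "tl_closed hs" "x \<in> set hs"
  shows "length x < card (set hs)"
proof -
  \<comment> \<open>The ancestors of \<open>x\<close>, itself and the root included, are
    \<open>length x + 1\<close> vertices of distinct depths.\<close>
  have "drop i x \<in> set hs" for i
  proof (induction i)
    case (Suc i)
    then have "tl (drop i x) \<in> set hs" using assms(1) by (simp add: tl_closed_def)
    then show ?case by (simp add: drop_Suc tl_drop)
  qed (use assms in simp)
  then have "(\<lambda>i. drop i x) ` {..length x} \<subseteq> set hs" by auto
  moreover have "inj_on (\<lambda>i. drop i x) {..length x}"
    by (rule inj_onI) (metis atMost_iff diff_diff_cancel length_drop)
  ultimately have "card {..length x} \<le> card (set hs)"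
    by (metis card_image card_mono finite_set)
  then show ?thesis by simp
qed

lemma aew_speed_zero:
  assumes km: "1 \<le> k" "1 \<le> m" and pk: "0 < pmf p k" and pm: "0 < pmf p m"
    and inf: "(\<integral>\<^sup>+x. ennreal x \<partial>\<mu>t k m) = \<infinity>"
  shows "aew (\<lambda>\<omega> X. (\<lambda>n. real (length (X n)) / real n) \<longlonglongrightarrow> 0)"
proof -
  have each: "aew (\<lambda>\<omega> X. eventually (\<lambda>t. real (length (X t)) \<le> 2 * e * real t) sequentially)" if e: "0 < e" for e
  proof -
    have "eventually (\<lambda>T. k \<le> T \<and> eventually (\<lambda>L. aew (\<lambda>\<omega> X. eventually (\<lambda>t.
      nbad T (real L) \<omega> (hist X t) \<le> e * real t) sequentially)) sequentially) sequentially"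
      using aew_not_good[OF e] eventually_ge_at_top[of k] by eventually_elim auto
    then obtain T where T: "k \<le> T" and bad: "eventually (\<lambda>L. aew (\<lambda>\<omega> X. eventually (\<lambda>t.
      nbad T (real L) \<omega> (hist X t) \<le> e * real t) sequentially)) sequentially"
      using eventually_happens'[OF sequentially_bot] by blast
    \<comment> \<open>With \<open>T\<close> fixed, both bounds hold for all large \<open>L\<close>,
      so one \<open>L\<close> serves both.\<close>
    obtain L :: nat where
      L1: "aew (\<lambda>\<omega> X. eventually (\<lambda>t. nbad T (real L) \<omega> (hist X t) \<le> e * real t) sequentially)" and
      L2: "aew (\<lambda>\<omega> X. eventually (\<lambda>t. ngood T (real L) \<omega> (hist X t) \<le> e * real t) sequentially)"
      using eventually_happens'[OF sequentially_bot eventually_conj[OF bad aew_good_sublinear[OF km pk pm inf T e]]] by blast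
    have "aew (\<lambda>\<omega> X. eventually (\<lambda>t. real (card (set (hist X t))) \<le> 2 * e * real t) sequentially)"
    proof (rule aew_mp2[OF L1 L2])
      fix \<omega> and X :: "nat \<Rightarrow> nat list"
      assume "eventually (\<lambda>t. nbad T (real L) \<omega> (hist X t) \<le> e * real t) sequentially"
        "eventually (\<lambda>t. ngood T (real L) \<omega> (hist X t) \<le> e * real t) sequentially"
      then show "eventually (\<lambda>t. real (card (set (hist X t))) \<le> 2 * e * real t) sequentially"
      proof eventually_elim
        case (elim t)
        have "set (hist X t) = {v\<in>set (hist X t). \<not> good T (real L) \<omega> v} \<union> {v\<in>set (hist X t). good T (real L) \<omega> v}"
          by auto
        then have "card (set (hist X t)) \<le> card {v\<in>set (hist X t). \<not> good T (real L) \<omega> v} + card {v\<in>set (hist X t). good T (real L) \<omega> v}"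
          by (metis card_Un_le)
        then show ?case using elim by linarith
      qed
    qed
    then show ?thesis
    proof (rule aew_mp2[OF _ aew_valid])
      fix \<omega> and X :: "nat \<Rightarrow> nat list"
      assume "eventually (\<lambda>t. real (card (set (hist X t))) \<le> 2 * e * real t) sequentially"
        and W: "\<forall>t. W \<omega> (hist X t) \<noteq> 0"
      then show "eventually (\<lambda>t. real (length (X t)) \<le> 2 * e * real t) sequentially"
      proof (elim eventually_mono)
        fix t assume le: "real (card (set (hist X t))) \<le> 2 * e * real t"
        have "length (X t) < card (set (hist X t))"
          by (rule length_less_card_closed[OF W_tl_closed]) (use W hd_in_set[of "hist X t"] in auto)
        with le show "real (length (X t)) \<le> 2 * e * real t" by linarith
      qed
    qed
  qed
  have "aew (\<lambda>\<omega> X. \<forall>n. eventually (\<lambda>t. real (length (X t)) \<le> 2 * (1 / real (Suc n)) * real t) sequentially)"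
    by (intro aew_all each) simp
  then show ?thesis
  proof (rule aew_mp2[OF _ aew_valid])
    fix \<omega> and X :: "nat \<Rightarrow> nat list"
    assume *: "\<forall>n. eventually (\<lambda>t. real (length (X t)) \<le> 2 * (1 / real (Suc n)) * real t) sequentially"
    show "(\<lambda>n. real (length (X n)) / real n) \<longlonglongrightarrow> 0"
    proof (rule tendstoI)
      fix e :: real assume "0 < e"
      then obtain n where n: "1 / real (Suc n) < e / 2" using nat_approx_posE[of "e / 2"] by auto
      show "eventually (\<lambda>t. dist (real (length (X t)) / real t) 0 < e) sequentially"
        using *[rule_format, of n] eventually_gt_at_top[of 0]
      proof eventually_elim
        case (elim t)
        then have "real (length (X t)) / real t \<le> 2 * (1 / real (Suc n))"
          by (simp only: pos_divide_le_eq of_nat_0_less_iff)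
        also have "\<dots> < e" using n by linarith
        finally show ?case by simp
      qed
    qed
  qed
qed

end

theorem theorem4p5:
  fixes p :: "nat pmf" and \<mu>t :: "nat \<Rightarrow> nat \<Rightarrow> real measure"
  assumes p0: "pmf p 0 = 0"
    and mean_fin: "summable (\<lambda>j. real j * pmf p j)"
    and mean_gt1: "1 < (\<Sum>j. real j * pmf p j)"
    and mu_prob: "\<And>k m. 1 \<le> k \<Longrightarrow> 1 \<le> m \<Longrightarrow> prob_space (\<mu>t k m)"
    and mu_sets: "\<And>k m. 1 \<le> k \<Longrightarrow> 1 \<le> m \<Longrightarrow> sets (\<mu>t k m) = sets borel"
    and mu_pos: "\<And>k m. 1 \<le> k \<Longrightarrow> 1 \<le> m \<Longrightarrow> (AE x in \<mu>t k m. 0 < x)"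
    and mu_sym: "\<And>k m. 1 \<le> k \<Longrightarrow> 1 \<le> m \<Longrightarrow> \<mu>t k m = \<mu>t m k"
    and inf_mean: "\<exists>k m. 1 \<le> k \<and> 1 \<le> m \<and> pmf p k > 0 \<and> pmf p m > 0 \<and>
                      (\<integral>\<^sup>+ x. ennreal x \<partial>(\<mu>t k m)) = \<infinity>"
  shows "AE \<omega> in env_measure p \<mu>t.
           \<forall>Q. walk_law \<omega> Q \<longrightarrow>
             (AE X in Q. (\<lambda>n. real (length (X n)) / real n) \<longlonglongrightarrow> 0)"
proof -
  interpret gw_env p \<mu>t
    by (intro gw_env.intro p0 mean_fin mu_prob mu_sets mu_pos)
  obtain k m where "1 \<le> k" "1 \<le> m" "0 < pmf p k" "0 < pmf p m" "(\<integral>\<^sup>+x. ennreal x \<partial>\<mu>t k m) = \<infinity>"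
    using inf_mean by blast
  from aew_speed_zero[OF this] show ?thesis
    unfolding aew_def env_measure_eq .
qed

end
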